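(* Let $\mu\in P_2(\mathbb{R}^d)$ and let $\nu\in P_2(\mathbb{R}^d)$ be absolutely continuous with respect to Lebesgue measure. The following are equivalent: (i) the (unique) minimizer of $\mathcal{T}_2(\cdot,\nu)$ over $\mathrm{P}^{cx}_{2,\mu\le}$ is $\mu$; (ii) there exists a convex expansion $\phi$ such that $(\nabla\phi)_\#\nu=\mu$.
   Context: $\mu\le_{cx}\xi$: $\int\varphi\,d\mu\le\int\varphi\,d\xi$ for all real-valued convex $\varphi$ with both integrals existing in the extended sense. $\mathrm{P}^{cx}_{2,\mu\le}=\{\xi\in P_2(\mathbb{R}^d):\mu\le_{cx}\xi\}$. $\mathcal{T}_2(\xi,\nu)=\inf_{\pi\in\Pi(\xi,\nu)}\int|x-y|^2d\pi$. A proper lsc convex $\psi$ is a convex expansion if $\psi=\phi^*$ (Legendre transform) for some proper $\phi$ with $D^2\phi\le\mathrm{Id}$ in the sense of distributions (equivalently $D^2\psi\ge\mathrm{Id}$). *)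

theory Defs
  imports "HOL-Probability.Probability"
begin

definition P2 :: "'a::euclidean_space measure \<Rightarrow> bool" where
  "P2 M \<longleftrightarrow> prob_space M \<and> sets M = sets borel \<and> integrable M (\<lambda>x. (norm x)^2)"

definition ext_int_exists :: "'a measure \<Rightarrow> ('a \<Rightarrow> real) \<Rightarrow> bool" where
  "ext_int_exists M f \<longleftrightarrow> f \<in> borel_measurable M \<and>
     \<not> ((\<integral>\<^sup>+x. ennreal (f x) \<partial>M) = \<infinity> \<and> (\<integral>\<^sup>+x. ennreal (- f x) \<partial>M) = \<infinity>)"

definition ext_int :: "'a measure \<Rightarrow> ('a \<Rightarrow> real) \<Rightarrow> ereal" where
  "ext_int M f = enn2ereal (\<integral>\<^sup>+x. ennreal (f x) \<partial>M) - enn2ereal (\<integral>\<^sup>+x. ennreal (- f x) \<partial>M)"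

definition cx_le :: "'a::euclidean_space measure \<Rightarrow> 'a measure \<Rightarrow> bool" where
  "cx_le \<mu> \<xi> \<longleftrightarrow> (\<forall>\<phi>::'a \<Rightarrow> real. convex_on UNIV \<phi> \<longrightarrow> ext_int_exists \<mu> \<phi> \<longrightarrow>
      ext_int_exists \<xi> \<phi> \<longrightarrow> ext_int \<mu> \<phi> \<le> ext_int \<xi> \<phi>)"

definition Pcx :: "'a::euclidean_space measure \<Rightarrow> 'a measure set" where
  "Pcx \<mu> = {\<xi>. P2 \<xi> \<and> cx_le \<mu> \<xi>}"

definition coupling :: "'a::euclidean_space measure \<Rightarrow> 'a measure \<Rightarrow> ('a \<times> 'a) measure \<Rightarrow> bool" where
  "coupling \<xi> \<nu> \<pi> \<longleftrightarrow> sets \<pi> = sets (borel \<Otimes>\<^sub>M borel) \<and>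
     distr \<pi> borel fst = \<xi> \<and> distr \<pi> borel snd = \<nu>"

definition T2 :: "'a::euclidean_space measure \<Rightarrow> 'a measure \<Rightarrow> ennreal" where
  "T2 \<xi> \<nu> = (INF \<pi> \<in> {\<pi>. coupling \<xi> \<nu> \<pi>}. \<integral>\<^sup>+z. ennreal ((norm (fst z - snd z))^2) \<partial>\<pi>)"

definition dirderiv :: "'a::real_normed_vector \<Rightarrow> ('a \<Rightarrow> real) \<Rightarrow> 'a \<Rightarrow> real" where
  "dirderiv v f x = frechet_derivative f (at x) v"

fun iter_dirderiv :: "'a::real_normed_vector list \<Rightarrow> ('a \<Rightarrow> real) \<Rightarrow> 'a \<Rightarrow> real" where
  "iter_dirderiv [] f = f"
| "iter_dirderiv (v # vs) f = dirderiv v (iter_dirderiv vs f)"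

definition smooth_fun :: "('a::euclidean_space \<Rightarrow> real) \<Rightarrow> bool" where
  "smooth_fun f \<longleftrightarrow> (\<forall>vs x. iter_dirderiv vs f differentiable (at x))"

definition test_fun :: "('a::euclidean_space \<Rightarrow> real) \<Rightarrow> bool" where
  "test_fun \<eta> \<longleftrightarrow> smooth_fun \<eta> \<and> compact (closure {x. \<eta> x \<noteq> 0})"

definition hess_le_id :: "('a::euclidean_space \<Rightarrow> real) \<Rightarrow> bool" where
  "hess_le_id \<phi> \<longleftrightarrow> (\<forall>\<eta> v. test_fun \<eta> \<longrightarrow> (\<forall>x. 0 \<le> \<eta> x) \<longrightarrow>
     (\<integral>x. \<phi> x * dirderiv v (dirderiv v \<eta>) x \<partial>lborel) \<le> (v \<bullet> v) * (\<integral>x. \<eta> x \<partial>lborel))"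

definition legendre :: "('a::euclidean_space \<Rightarrow> real) \<Rightarrow> 'a \<Rightarrow> ereal" where
  "legendre \<phi> y = (SUP x. ereal (x \<bullet> y - \<phi> x))"

definition proper_fun :: "('a \<Rightarrow> ereal) \<Rightarrow> bool" where
  "proper_fun \<psi> \<longleftrightarrow> (\<forall>x. \<psi> x \<noteq> -\<infinity>) \<and> (\<exists>x. \<psi> x \<noteq> \<infinity>)"

definition lsc_fun :: "('a::topological_space \<Rightarrow> ereal) \<Rightarrow> bool" where
  "lsc_fun \<psi> \<longleftrightarrow> (\<forall>x. \<psi> x \<le> Liminf (at x) \<psi>)"

definition convex_ext :: "('a::real_vector \<Rightarrow> ereal) \<Rightarrow> bool" where
  "convex_ext \<psi> \<longleftrightarrow> (\<forall>x y t. 0 \<le> t \<and> t \<le> 1 \<longrightarrow>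
     \<psi> ((1 - t) *\<^sub>R x + t *\<^sub>R y) \<le> ereal (1 - t) * \<psi> x + ereal t * \<psi> y)"

definition convex_expansion :: "('a::euclidean_space \<Rightarrow> ereal) \<Rightarrow> bool" where
  "convex_expansion \<psi> \<longleftrightarrow> proper_fun \<psi> \<and> lsc_fun \<psi> \<and> convex_ext \<psi> \<and>
     (\<exists>\<phi>::'a \<Rightarrow> real. continuous_on UNIV \<phi> \<and> hess_le_id \<phi> \<and> \<psi> = legendre \<phi>)"

definition has_gradient :: "('a::euclidean_space \<Rightarrow> ereal) \<Rightarrow> 'a \<Rightarrow> 'a \<Rightarrow> bool" where
  "has_gradient \<psi> x g \<longleftrightarrow> (\<forall>\<^sub>F z in nhds x. \<bar>\<psi> z\<bar> \<noteq> \<infinity>) \<and>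
     ((\<lambda>z. real_of_ereal (\<psi> z)) has_derivative (\<lambda>h. g \<bullet> h)) (at x)"

end

(*
Write p = x - y and let f = |.|^2/2 - phi, psi = phi^*; distributional semiconcavity of phi means that f is convex.

An expansion psi yields a minimizer: for every coupling of xi and nu with xi above mu, the Fenchel gap
phi(x) + psi(y) - x.y is nonnegative, and its integral is at most half of the excess of the transport cost over the
cost of the map grad psi, because f is convex. Along almost optimal couplings the gap therefore tends to 0 in
probability. Where psi is differentiable a small gap forces x to be close to grad psi(y), hence xi = mu.

Conversely, let mu be minimal. No optimal plan is needed: take almost optimal couplings of mu and nu and let Gamma be
the set of points all of whose neighbourhoods keep mass along a subsequence. Moving an epsilon fraction of the mass
at y_i to y_i + p_j, and compensating at x_j to keep the barycentre, raises the first marginal in convex order. To first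
order in epsilon, minimality says that p is cyclically monotone in y on Gamma. Rockafellar's construction then gives
psi with psi - |.|^2/2 convex and x in the subdifferential of psi at y on Gamma. The Fenchel gap of psi vanishes on
Gamma, so it tends to 0 in probability and the argument above gives (grad psi)_# nu = mu.
*)
theory Submission
  imports Defs "HOL-Complex_Analysis.Great_Picard"
begin

section \<open>Couplings and image measures\<close>

text \<open>Why the first order term is a cyclic sum: the mass sent to y_i + p_j and paired with y_i
  pays |p_j|^2, the price already paid at (x_j, y_j). The compensation at x_j turns p_j into p_j -
  \<delta> (y_i - y_j), so its cost changes by -2 \<delta> p_j . (y_i - y_j) plus a term of order
  \<delta>^2. Finitely many neighbourhoods of points of \<Gamma> keep a mass bounded below
  independently of n, so a positive cyclic sum would yield a gain independent of n, whereas the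
  slack of the n-th coupling tends to 0. This replaces the passage to a limit coupling. In the same
  spirit the potential built from \<Gamma> is never integrated: only the masses of compact sets
  missing \<Gamma> are used, and the tails of the fixed marginals, uniform over all couplings, do
  the rest. Absolute continuity of \<nu> enters twice, both times through Lebesgue null sets: the
  frontier of the convex domain where psi is finite, and the points of non-differentiability in its
  interior.\<close>

lemma sum_measure_exists:
  assumes "sets M = sets N"
  obtains R where "sets R = sets M"
    and "\<And>F. F \<in> borel_measurable M \<Longrightarrow> (\<integral>\<^sup>+x. F x \<partial>R) = (\<integral>\<^sup>+x. F x \<partial>M) + (\<integral>\<^sup>+x. F x \<partial>N)"
proof -
  \<comment> \<open>The perturbed coupling will be assembled from pieces in this way. All later
    computations on it are nonnegative integrals, so only the integration rule is exported.\<close>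
  define R where "R = measure_of (space M) (sets M) (\<lambda>A. emeasure M A + emeasure N A)"
  have sR: "sets R = sets M" by (simp add: R_def)
  have sp: "space R = space M" by (simp add: R_def)
  have em: "emeasure R A = emeasure M A + emeasure N A" if "A \<in> sets M" for A
    unfolding R_def
  proof (rule emeasure_measure_of_sigma)
    show "sigma_algebra (space M) (sets M)" ..
    show "positive (sets M) (\<lambda>A. emeasure M A + emeasure N A)" by (simp add: positive_def)
    show "countably_additive (sets M) (\<lambda>A. emeasure M A + emeasure N A)"
    proof (rule countably_additiveI)
      fix A :: "nat \<Rightarrow> 'a set"
      assume A: "range A \<subseteq> sets M" "disjoint_family A" "\<Union> (range A) \<in> sets M"
      then show "(\<Sum>i. emeasure M (A i) + emeasure N (A i)) = emeasure M (\<Union> (range A)) + emeasure N (\<Union> (range A))"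
        using assms by (simp add: suminf_add[symmetric] suminf_emeasure)
    qed
  qed fact
  have "(\<integral>\<^sup>+x. F x \<partial>R) = (\<integral>\<^sup>+x. F x \<partial>M) + (\<integral>\<^sup>+x. F x \<partial>N)" if "F \<in> borel_measurable M" for F
    using that
  proof (induction rule: borel_measurable_induct)
    case (cong f g)
    then show ?case
      using sets_eq_imp_space_eq[OF assms] sp by (simp cong: nn_integral_cong_simp)
  next
    case (set A)
    then show ?case using em assms sR by simp
  next
    case (mult u c)
    then show ?case using assms sR
      by (simp add: nn_integral_cmult measurable_cong_sets[OF assms refl] measurable_cong_sets[OF sR refl] distrib_left)
  next
    case (add u v)
    then show ?case using assms sR
      by (simp add: nn_integral_add measurable_cong_sets[OF assms refl] measurable_cong_sets[OF sR refl] ac_simps)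
  next
    case (seq U)
    have m: "U i \<in> borel_measurable N" "U i \<in> borel_measurable R" for i
      using seq(1)[of i] by (simp_all add: measurable_cong_sets[OF assms refl, symmetric] measurable_cong_sets[OF sR refl])
    have inc: "incseq (\<lambda>i. \<integral>\<^sup>+x. U i x \<partial>M)" "incseq (\<lambda>i. \<integral>\<^sup>+x. U i x \<partial>N)"
      using seq(3) by (auto simp: incseq_def le_fun_def intro!: nn_integral_mono)
    have "(\<integral>\<^sup>+x. (SUP i. U i) x \<partial>R) = (SUP i. \<integral>\<^sup>+x. U i x \<partial>R)"
      unfolding SUP_apply by (rule nn_integral_monotone_convergence_SUP[OF seq(3) m(2)])
    also have "\<dots> = (SUP i. (\<integral>\<^sup>+x. U i x \<partial>M) + (\<integral>\<^sup>+x. U i x \<partial>N))" using seq by simp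
    also have "\<dots> = (SUP i. (\<integral>\<^sup>+x. U i x \<partial>M)) + (SUP i. (\<integral>\<^sup>+x. U i x \<partial>N))"
      by (rule ennreal_SUP_add[OF inc])
    also have "\<dots> = (\<integral>\<^sup>+x. (SUP i. U i) x \<partial>M) + (\<integral>\<^sup>+x. (SUP i. U i) x \<partial>N)"
      unfolding SUP_apply using nn_integral_monotone_convergence_SUP[OF seq(3) seq(1)] nn_integral_monotone_convergence_SUP[OF seq(3) m(1)] by simp
    finally show ?case .
  qed
  with sR that show ?thesis by blast
qed

text \<open>\<open>coupling\<close> prescribes only the marginals; the total mass of \<pi> is read
  off from the second one, and the first marginal then inherits it.\<close>

lemma coupling_facts:
  assumes "coupling \<xi> \<nu> \<pi>" "prob_space \<nu>"
  shows "sets \<pi> = sets borel" "space \<pi> = UNIV" "prob_space \<pi>"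
    "fst \<in> borel_measurable \<pi>" "snd \<in> borel_measurable \<pi>"
    "prob_space \<xi>" "sets \<xi> = sets borel" "sets \<nu> = sets borel" "space \<xi> = UNIV" "space \<nu> = UNIV"
proof -
  note c = assms(1)[unfolded coupling_def]
  show s: "sets \<pi> = sets borel" unfolding borel_prod[symmetric] using c by blast
  show sp: "space \<pi> = UNIV" using sets_eq_imp_space_eq[OF s] by simp
  show f: "fst \<in> borel_measurable \<pi>" and g: "snd \<in> borel_measurable \<pi>"
    by (auto simp: measurable_cong_sets[OF s refl] intro!: borel_measurable_continuous_onI continuous_intros)
  have "emeasure \<nu> (space \<nu>) = 1" using assms(2) by (simp add: prob_space.emeasure_space_1)
  moreover have n: "\<nu> = distr \<pi> borel snd" using c by simp
  ultimately have "emeasure \<pi> (space \<pi>) = 1" using g by (simp add: emeasure_distr)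
  then show p: "prob_space \<pi>" by (rule prob_spaceI)
  have x: "\<xi> = distr \<pi> borel fst" using c by simp
  show "prob_space \<xi>" unfolding x using p f by (rule prob_space.prob_space_distr)
  show "sets \<xi> = sets borel" "sets \<nu> = sets borel" using n x by simp_all
  then show "space \<xi> = UNIV" "space \<nu> = UNIV" using sets_eq_imp_space_eq[of \<xi> borel] sets_eq_imp_space_eq[of \<nu> borel] by simp_all
qed

lemma coupling_fst_nn:
  assumes "coupling \<xi> \<nu> \<pi>" "prob_space \<nu>" "F \<in> borel_measurable borel"
  shows "(\<integral>\<^sup>+z. F (fst z) \<partial>\<pi>) = (\<integral>\<^sup>+x. F x \<partial>\<xi>)"
proof -
  have "\<xi> = distr \<pi> borel fst" using assms by (simp add: coupling_def)
  then show ?thesis using nn_integral_distr[OF coupling_facts(4)[OF assms(1,2)], of F] assms(3) by (metis measurable_distr_eq1)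
qed

lemma coupling_snd_nn:
  assumes "coupling \<xi> \<nu> \<pi>" "prob_space \<nu>" "F \<in> borel_measurable borel"
  shows "(\<integral>\<^sup>+z. F (snd z) \<partial>\<pi>) = (\<integral>\<^sup>+x. F x \<partial>\<nu>)"
proof -
  have "\<nu> = distr \<pi> borel snd" using assms by (simp add: coupling_def)
  then show ?thesis using nn_integral_distr[OF coupling_facts(5)[OF assms(1,2)], of F] assms(3) by (metis measurable_distr_eq1)
qed

lemma coupling_fst_int:
  fixes F :: "_ \<Rightarrow> real"
  assumes "coupling \<xi> \<nu> \<pi>" "prob_space \<nu>" "integrable \<xi> F"
  shows "integrable \<pi> (\<lambda>z. F (fst z))" "(\<integral>z. F (fst z) \<partial>\<pi>) = (\<integral>x. F x \<partial>\<xi>)"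
proof -
  have m: "F \<in> borel_measurable borel" using assms(3) coupling_facts(7)[OF assms(1,2)]
    by (metis borel_measurable_integrable measurable_cong_sets)
  have "\<xi> = distr \<pi> borel fst" using assms by (simp add: coupling_def)
  then show "integrable \<pi> (\<lambda>z. F (fst z))" "(\<integral>z. F (fst z) \<partial>\<pi>) = (\<integral>x. F x \<partial>\<xi>)"
    using integrable_distr_eq[OF coupling_facts(4)[OF assms(1,2)] m] integral_distr[OF coupling_facts(4)[OF assms(1,2)] m] assms(3) by auto
qed

lemma coupling_snd_int:
  fixes F :: "_ \<Rightarrow> real"
  assumes "coupling \<xi> \<nu> \<pi>" "prob_space \<nu>" "integrable \<nu> F"
  shows "integrable \<pi> (\<lambda>z. F (snd z))" "(\<integral>z. F (snd z) \<partial>\<pi>) = (\<integral>x. F x \<partial>\<nu>)"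
proof -
  have m: "F \<in> borel_measurable borel" using assms(3) coupling_facts(8)[OF assms(1,2)]
    by (metis borel_measurable_integrable measurable_cong_sets)
  have "\<nu> = distr \<pi> borel snd" using assms by (simp add: coupling_def)
  then show "integrable \<pi> (\<lambda>z. F (snd z))" "(\<integral>z. F (snd z) \<partial>\<pi>) = (\<integral>x. F x \<partial>\<nu>)"
    using integrable_distr_eq[OF coupling_facts(5)[OF assms(1,2)] m] integral_distr[OF coupling_facts(5)[OF assms(1,2)] m] assms(3) by auto
qed

section \<open>Identifying a marginal as an image measure through closed sets\<close>

lemma measure_eq_closedI:
  fixes M N :: "'a::{metric_space,second_countable_topology} measure"
  assumes "sets M = sets borel" "sets N = sets borel" "finite_measure M" "finite_measure N"
    and eq: "\<And>C. closed C \<Longrightarrow> measure M C = measure N C"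
  shows "M = N"
proof (rule measure_eqI_generator_eq[where E="Collect closed" and \<Omega>=UNIV and A="\<lambda>_. UNIV"])
  interpret M: finite_measure M by fact
  interpret N: finite_measure N by fact
  show "Int_stable (Collect closed :: 'a set set)" by (auto simp: Int_stable_def)
  show "sets M = sigma_sets UNIV (Collect closed)" "sets N = sigma_sets UNIV (Collect closed)"
    using assms(1,2) by (simp_all add: borel_eq_closed)
  show "emeasure M X = emeasure N X" if "X \<in> Collect closed" for X
    using eq that by (simp add: M.emeasure_eq_measure N.emeasure_eq_measure)
qed (auto simp: finite_measure.emeasure_finite[OF assms(3)])

text \<open>A nonempty closed set is the decreasing intersection of its closed neighbourhoods.
  Nonemptiness matters because \<open>infdist x {} = 0\<close>, which would make every neighbourhood
  of the empty set the whole space.\<close>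

lemma measure_closed_nbhd_limit:
  fixes N :: "'a::metric_space measure"
  assumes "finite_measure N" "sets N = sets borel" "closed C" "C \<noteq> {}"
    and le: "\<And>\<epsilon>. \<epsilon> > 0 \<Longrightarrow> c \<le> measure N {x. infdist x C \<le> \<epsilon>}"
  shows "c \<le> measure N C"
proof -
  interpret finite_measure N by fact
  define A where "A n = {x. infdist x C \<le> inverse (Suc n)}" for n :: nat
  have "closed (A n)" for n unfolding A_def
    by (intro closed_Collect_le continuous_intros)
  then have s: "range A \<subseteq> sets N" using assms(2) by auto
  have d: "decseq A" unfolding A_def decseq_def
    by (auto elim!: order_trans intro!: le_imp_inverse_le)
  have "(\<Inter>n. A n) = C"
  proof -
    have "x \<in> C" if "\<And>n. infdist x C \<le> inverse (Suc n)" for x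
    proof -
      have "infdist x C \<le> 0"
        by (rule LIMSEQ_le_const[OF LIMSEQ_inverse_real_of_nat]) (intro exI allI impI that)
      then show ?thesis using assms(3,4) by (metis in_closed_iff_infdist_zero order_antisym infdist_nonneg)
    qed
    moreover have "x \<in> A n" if "x \<in> C" for x n using that by (simp add: A_def)
    ultimately show ?thesis by (auto simp: A_def)
  qed
  then have "(\<lambda>n. measure N (A n)) \<longlonglongrightarrow> measure N C"
    using finite_Lim_measure_decseq[OF s d] by simp
  moreover have "\<forall>n. c \<le> measure N (A n)" unfolding A_def by (intro allI le) simp
  ultimately show ?thesis by (meson LIMSEQ_le_const)
qed

text \<open>A Levy-Prokhorov argument: if \<open>fst z\<close> and \<open>G (snd z)\<close> are
  \<epsilon> apart only with probability \<eta>, then each law gives a closed set at most the mass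
  that the other gives its \<epsilon>-neighbourhood, plus \<eta>. The coupling may depend on
  \<epsilon> and \<eta>, but the two laws do not, so first \<eta> and then \<epsilon> can go to
  0.\<close>

lemma marginal_eq_image:
  fixes \<xi> \<nu> :: "'a::euclidean_space measure"
  assumes nu: "prob_space \<nu>" and snu: "sets \<nu> = sets borel" and G: "G \<in> borel_measurable \<nu>"
    and xi: "prob_space \<xi>" "sets \<xi> = sets borel"
    and close: "\<And>\<epsilon> \<eta>. \<epsilon> > 0 \<Longrightarrow> \<eta> > 0 \<Longrightarrow> \<exists>\<pi>. coupling \<xi> \<nu> \<pi> \<and> measure \<pi> {z. norm (fst z - G (snd z)) \<ge> \<epsilon>} \<le> \<eta>"
  shows "distr \<nu> borel G = \<xi>"
proof -
  define \<theta> where "\<theta> = distr \<nu> borel G"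
  have Gb: "G \<in> borel_measurable borel" using G snu measurable_cong_sets by blast
  have lam: "prob_space \<theta>" "sets \<theta> = sets borel"
    unfolding \<theta>_def using prob_space.prob_space_distr[OF nu G] by auto
  interpret L: prob_space \<theta> by fact
  interpret X: prob_space \<xi> by fact
  have main: "measure \<xi> C \<le> measure \<theta> {x. infdist x C \<le> \<epsilon>} \<and> measure \<theta> C \<le> measure \<xi> {x. infdist x C \<le> \<epsilon>}"
    if "closed C" "C \<noteq> {}" "\<epsilon> > 0" for C \<epsilon>
  proof -
    have clE: "closed {x. infdist x C \<le> \<epsilon>}" by (intro closed_Collect_le continuous_intros)
    have "measure \<xi> C \<le> measure \<theta> {x. infdist x C \<le> \<epsilon>} + \<eta> \<and> measure \<theta> C \<le> measure \<xi> {x. infdist x C \<le> \<epsilon>} + \<eta>" if "\<eta> > 0" for \<eta>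
    proof -
      obtain \<pi> where c: "coupling \<xi> \<nu> \<pi>" and le: "measure \<pi> {z. norm (fst z - G (snd z)) \<ge> \<epsilon>} \<le> \<eta>"
        using close[OF \<open>\<epsilon> > 0\<close> \<open>\<eta> > 0\<close>] by blast
      note cf = coupling_facts[OF c nu]
      interpret P: prob_space \<pi> by (rule cf)
      have mG: "(\<lambda>z. G (snd z)) \<in> borel_measurable \<pi>"
        using measurable_compose[OF cf(5) Gb] by simp
      have x: "measure \<xi> S = measure \<pi> {z. fst z \<in> S}" if "closed S" for S
      proof -
        have "\<xi> = distr \<pi> borel fst" using c by (simp add: coupling_def)
        then show ?thesis using measure_distr[OF cf(4), of S] that cf(2) by (simp add: vimage_def)
      qed
      have l: "measure \<theta> S = measure \<pi> {z. G (snd z) \<in> S}" if "closed S" for S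
      proof -
        have "\<nu> = distr \<pi> borel snd" using c by (simp add: coupling_def)
        then have "\<theta> = distr \<pi> borel (\<lambda>z. G (snd z))"
          unfolding \<theta>_def using distr_distr[OF Gb cf(5)] by (simp add: o_def)
        then show ?thesis using measure_distr[OF mG, of S] that cf(2) by (simp add: vimage_def)
      qed
      have meas: "{z. fst z \<in> S} \<in> sets \<pi>" "{z. G (snd z) \<in> S} \<in> sets \<pi>" if "closed S" for S
        using measurable_sets[OF cf(4), of S] measurable_sets[OF mG, of S] that cf(2) by (auto simp: vimage_def)
      have mE: "{z. norm (fst z - G (snd z)) \<ge> \<epsilon>} \<in> sets \<pi>"
      proof -
        have "{z\<in>space \<pi>. norm (fst z - G (snd z)) \<ge> \<epsilon>} \<in> sets \<pi>"
          using cf(4) mG by measurable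
        then show ?thesis using cf(2) by simp
      qed
      have near: "infdist b C \<le> \<epsilon>" if "a \<in> C" "norm (a - b) < \<epsilon> \<or> norm (b - a) < \<epsilon>" for a b :: 'a
        using infdist_le[OF that(1), of b] that(2) by (auto simp: dist_norm norm_minus_commute)
      have "measure \<pi> {z. fst z \<in> C} \<le> measure \<pi> ({z. G (snd z) \<in> {x. infdist x C \<le> \<epsilon>}} \<union> {z. norm (fst z - G (snd z)) \<ge> \<epsilon>})"
      proof (intro P.finite_measure_mono sets.Un meas clE mE subsetI)
        fix z :: "'a \<times> 'a" assume "z \<in> {z. fst z \<in> C}"
        then show "z \<in> {z. G (snd z) \<in> {x. infdist x C \<le> \<epsilon>}} \<union> {z. norm (fst z - G (snd z)) \<ge> \<epsilon>}"
          using near[of "fst z" "G (snd z)"] by auto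
      qed
      also have "\<dots> \<le> measure \<pi> {z. G (snd z) \<in> {x. infdist x C \<le> \<epsilon>}} + measure \<pi> {z. norm (fst z - G (snd z)) \<ge> \<epsilon>}"
        by (intro measure_Un_le meas clE mE)
      finally have 1: "measure \<xi> C \<le> measure \<theta> {x. infdist x C \<le> \<epsilon>} + \<eta>"
        using x[OF \<open>closed C\<close>] l[OF clE] le by linarith
      have "measure \<pi> {z. G (snd z) \<in> C} \<le> measure \<pi> ({z. fst z \<in> {x. infdist x C \<le> \<epsilon>}} \<union> {z. norm (fst z - G (snd z)) \<ge> \<epsilon>})"
      proof (intro P.finite_measure_mono sets.Un meas clE mE subsetI)
        fix z :: "'a \<times> 'a" assume "z \<in> {z. G (snd z) \<in> C}"
        then show "z \<in> {z. fst z \<in> {x. infdist x C \<le> \<epsilon>}} \<union> {z. norm (fst z - G (snd z)) \<ge> \<epsilon>}"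
          using near[of "G (snd z)" "fst z"] by auto
      qed
      also have "\<dots> \<le> measure \<pi> {z. fst z \<in> {x. infdist x C \<le> \<epsilon>}} + measure \<pi> {z. norm (fst z - G (snd z)) \<ge> \<epsilon>}"
        by (intro measure_Un_le meas clE mE)
      finally have 2: "measure \<theta> C \<le> measure \<xi> {x. infdist x C \<le> \<epsilon>} + \<eta>"
        using l[OF \<open>closed C\<close>] x[OF clE] le by linarith
      show ?thesis using 1 2 by blast
    qed
    then show ?thesis using field_le_epsilon by blast
  qed
  have "\<theta> = \<xi>"
  proof (rule measure_eq_closedI)
    show "measure \<theta> C = measure \<xi> C" if "closed C" for C
    proof (cases "C = {}")
      case False
      then show ?thesis using main[OF that False] measure_closed_nbhd_limit[OF X.finite_measure_axioms xi(2) that False]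
          measure_closed_nbhd_limit[OF L.finite_measure_axioms lam(2) that False] by (meson order_antisym)
    qed simp
  qed (use lam xi L.finite_measure_axioms X.finite_measure_axioms in auto)
  then show ?thesis by (simp add: \<theta>_def)
qed

abbreviation sq_cost :: "'a::euclidean_space \<times> 'a \<Rightarrow> ennreal" where
  "sq_cost z \<equiv> ennreal ((norm (fst z - snd z))\<^sup>2)"

lemma nn_integral_split_weight:
  assumes [measurable]: "s \<in> borel_measurable M" "H \<in> borel_measurable M" and s1: "\<And>z. s z \<le> (1 :: ennreal)"
  shows "(\<integral>\<^sup>+z. (1 - s z) * H z \<partial>M) + (\<integral>\<^sup>+z. s z * H z \<partial>M) = (\<integral>\<^sup>+z. H z \<partial>M)"
proof -
  have "(\<integral>\<^sup>+z. (1 - s z) * H z \<partial>M) + (\<integral>\<^sup>+z. s z * H z \<partial>M) = (\<integral>\<^sup>+z. (1 - s z) * H z + s z * H z \<partial>M)"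
    by (rule nn_integral_add[symmetric]) measurable
  also have "\<dots> = (\<integral>\<^sup>+z. H z \<partial>M)"
    using s1 by (intro nn_integral_cong) (simp add: diff_add_cancel_ennreal flip: distrib_right)
  finally show ?thesis .
qed

section \<open>Test functions and semiconcavity\<close>

text \<open>The exponent \<open>k\<close> makes the family stable: a derivative is a combination of
  the members with \<open>k + 2\<close> and \<open>k + 1\<close>, so all orders are treated at
  once.\<close>

definition flat_exp :: "nat \<Rightarrow> real \<Rightarrow> real" where
  "flat_exp k t = (if t > 0 then exp (- (1 / t)) / t ^ k else 0)"

text \<open>A single term of the exponential series at 1/t already dominates. The quadratic order is
  what makes the difference quotient at 0 vanish in the limit.\<close>

lemma flat_exp_bound: "\<bar>flat_exp k t\<bar> \<le> fact (k + 2) * t\<^sup>2"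
proof (cases "t > 0")
  case True
  have "(1 / t) ^ (k + 2) / fact (k + 2) \<le> exp (1 / t)"
  proof -
    have s: "(\<lambda>n. (1 / t) ^ n / fact n) sums exp (1 / t)"
      using exp_converges[of "1 / t"] by (simp add: scaleR_conv_of_real divide_inverse mult.commute)
    have "sum (\<lambda>n. (1 / t) ^ n / fact n) {k + 2} \<le> (\<Sum>n. (1 / t) ^ n / fact n)"
      using True by (intro sum_le_suminf sums_summable[OF s]) auto
    then show ?thesis using sums_unique[OF s] by simp
  qed
  moreover have "c * exp (- (1 / t)) \<le> d" if "c / d \<le> exp (1 / t)" "d > 0" for c d :: real
    using that by (simp add: exp_minus field_simps)
  ultimately have "(1 / t) ^ (k + 2) * exp (- (1 / t)) \<le> fact (k + 2)" using fact_gt_zero by blast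
  then show ?thesis using True
    by (simp add: flat_exp_def power_add field_simps power2_eq_square)
qed (simp add: flat_exp_def)

lemma flat_exp_has_derivative:
  "(flat_exp k has_field_derivative (flat_exp (k + 2) t - real k * flat_exp (k + 1) t)) (at t)"
proof -
  consider "t > 0" | "t < 0" | "t = 0" by linarith
  then show ?thesis
  proof cases
    case 1
    have aux: "t ^ n = t * t ^ (n - Suc 0)" if "n \<noteq> 0" for n
      using that by (cases n) auto
    have "((\<lambda>t. exp (- (1 / t)) / t ^ k) has_field_derivative (flat_exp (k + 2) t - real k * flat_exp (k + 1) t)) (at t)"
      using 1 by (cases k, auto intro!: derivative_eq_intros simp: flat_exp_def field_simps power2_eq_square) (use aux in blast)
    moreover have "eventually (\<lambda>s. s > 0) (nhds t)" using 1 by (simp add: eventually_nhds_in_open[of "{0<..}", simplified])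
    ultimately show ?thesis
      by (subst DERIV_cong_ev[OF refl _ refl]) (auto elim!: eventually_mono simp: flat_exp_def)
  next
    case 2
    have "((\<lambda>t. 0) has_field_derivative (flat_exp (k + 2) t - real k * flat_exp (k + 1) t)) (at t)"
      using 2 by (auto simp: flat_exp_def)
    moreover have "eventually (\<lambda>s. s < 0) (nhds t)" using 2 by (simp add: eventually_nhds_in_open[of "{..<0}", simplified])
    ultimately show ?thesis
      by (subst DERIV_cong_ev[OF refl _ refl]) (auto elim!: eventually_mono simp: flat_exp_def)
  next
    case 3
    have "(\<lambda>h. (flat_exp k (0 + h) - flat_exp k 0) / h) \<midarrow>0\<rightarrow> 0"
    proof (rule Lim_null_comparison)
      show "eventually (\<lambda>h. norm ((flat_exp k (0 + h) - flat_exp k 0) / h) \<le> fact (k + 2) * \<bar>h\<bar>) (at 0)"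
      proof (rule eventually_mono[OF eventually_neq_at_within[of 0]])
        fix h :: real assume "h \<noteq> 0"
        then show "norm ((flat_exp k (0 + h) - flat_exp k 0) / h) \<le> fact (k + 2) * \<bar>h\<bar>"
        proof -
          have "\<bar>flat_exp k h\<bar> \<le> fact (k + 2) * (\<bar>h\<bar> * \<bar>h\<bar>)"
            using flat_exp_bound[of k h] by (simp only: power2_eq_square abs_mult_self_eq)
          then have "\<bar>flat_exp k h\<bar> / \<bar>h\<bar> \<le> fact (k + 2) * \<bar>h\<bar>"
            using \<open>h \<noteq> 0\<close> by (metis mult.assoc pos_divide_le_eq zero_less_abs_iff)
          then show ?thesis by (simp only: flat_exp_def[of k 0] add_0 diff_0_right real_norm_def abs_divide if_False less_irrefl)
        qed
      qed
      show "(\<lambda>h::real. fact (k + 2) * \<bar>h\<bar>) \<midarrow>0\<rightarrow> 0" by (auto intro!: tendsto_eq_intros)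
    qed
    then have "(flat_exp k has_field_derivative 0) (at 0)" by (simp add: DERIV_def)
    then show ?thesis using 3 by (simp add: flat_exp_def)
  qed
qed

text \<open>Closure under directional derivatives gives \<open>smooth_fun\<close> for the whole class at once.\<close>

inductive bump_algebra :: "'a::euclidean_space \<Rightarrow> real \<Rightarrow> ('a \<Rightarrow> real) \<Rightarrow> bool" for a r where
  const: "bump_algebra a r (\<lambda>x. c)"
| inner: "bump_algebra a r (\<lambda>x. x \<bullet> v)"
| add: "bump_algebra a r f \<Longrightarrow> bump_algebra a r g \<Longrightarrow> bump_algebra a r (\<lambda>x. f x + g x)"
| mult: "bump_algebra a r f \<Longrightarrow> bump_algebra a r g \<Longrightarrow> bump_algebra a r (\<lambda>x. f x * g x)"
| bump: "bump_algebra a r (\<lambda>x. flat_exp k (r - (x - a) \<bullet> (x - a)))"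

lemma bump_algebra_derivative:
  assumes "bump_algebra a r f"
  shows "\<exists>F. (\<forall>x. (f has_derivative F x) (at x)) \<and> (\<forall>v. bump_algebra a r (\<lambda>x. F x v))"
  using assms
proof induction
  case (const c)
  show ?case by (intro exI[of _ "\<lambda>_ _. 0"]) (auto intro: bump_algebra.const)
next
  case (inner v)
  show ?case by (intro exI[of _ "\<lambda>_ h. h \<bullet> v"]) (auto intro!: derivative_eq_intros bump_algebra.const)
next
  case (add f g)
  then obtain F G where "\<forall>x. (f has_derivative F x) (at x)" "\<forall>v. bump_algebra a r (\<lambda>x. F x v)"
    "\<forall>x. (g has_derivative G x) (at x)" "\<forall>v. bump_algebra a r (\<lambda>x. G x v)" by blast
  then show ?case
    by (intro exI[of _ "\<lambda>x h. F x h + G x h"]) (auto intro: has_derivative_add bump_algebra.add)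
next
  case (mult f g)
  then obtain F G where "\<forall>x. (f has_derivative F x) (at x)" "\<forall>v. bump_algebra a r (\<lambda>x. F x v)"
    "\<forall>x. (g has_derivative G x) (at x)" "\<forall>v. bump_algebra a r (\<lambda>x. G x v)" by blast
  with mult.hyps show ?case
    by (intro exI[of _ "\<lambda>x h. f x * G x h + F x h * g x"])
      (auto intro!: has_derivative_mult bump_algebra.add bump_algebra.mult)
next
  case (bump k)
  let ?u = "\<lambda>x. r - (x - a) \<bullet> (x - a)"
  \<comment> \<open>The derivative of the inner function is written as an inner product with a fixed
    vector plus a constant, so that it visibly belongs to the inductive class.\<close>
  let ?F = "\<lambda>x h. (flat_exp (k + 2) (?u x) + (- real k) * flat_exp (k + 1) (?u x)) * (x \<bullet> (- 2 *\<^sub>R h) + 2 * (a \<bullet> h))"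
  have "((\<lambda>x. flat_exp k (?u x)) has_derivative ?F x) (at x)" for x
  proof -
    have 1: "(?u has_derivative (\<lambda>h. x \<bullet> (- 2 *\<^sub>R h) + 2 * (a \<bullet> h))) (at x)"
      by (auto intro!: derivative_eq_intros simp: inner_diff_left inner_diff_right inner_commute algebra_simps)
    have 2: "(flat_exp k has_derivative (\<lambda>h. (flat_exp (k + 2) (?u x) - real k * flat_exp (k + 1) (?u x)) * h)) (at (?u x))"
      using flat_exp_has_derivative[of k "?u x"] by (simp add: has_field_derivative_def)
    show ?thesis using diff_chain_at[OF 1 2] by (simp add: o_def)
  qed
  moreover have "bump_algebra a r (\<lambda>x. ?F x v)" for v
    by (intro bump_algebra.intros)
  ultimately show ?case by (intro exI[of _ ?F]) blast
qed

lemma dirderiv_eqI: "(f has_derivative F) (at x) \<Longrightarrow> dirderiv v f x = F v"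
  unfolding dirderiv_def using frechet_derivative_at by metis

lemma bump_algebra_dirderiv: "bump_algebra a r f \<Longrightarrow> bump_algebra a r (dirderiv v f)"
proof -
  assume "bump_algebra a r f"
  then obtain F where "\<And>x. (f has_derivative F x) (at x)" "\<And>v. bump_algebra a r (\<lambda>x. F x v)"
    using bump_algebra_derivative by blast
  moreover from this have "dirderiv v f = (\<lambda>x. F x v)" using dirderiv_eqI by blast
  ultimately show ?thesis by simp
qed

lemma bump_algebra_smooth: assumes "bump_algebra a r f" shows "smooth_fun f"
  unfolding smooth_fun_def
proof (intro allI)
  fix vs x
  have "bump_algebra a r (iter_dirderiv vs f)"
    by (induction vs) (use assms bump_algebra_dirderiv in auto)
  then show "iter_dirderiv vs f differentiable (at x)"
    using bump_algebra_derivative unfolding differentiable_def by blast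
qed

definition bump_fun :: "'a::euclidean_space \<Rightarrow> real \<Rightarrow> 'a \<Rightarrow> real" where
  "bump_fun a r x = flat_exp 0 (r\<^sup>2 - (x - a) \<bullet> (x - a))"

lemma bump_fun_nonneg: "0 \<le> bump_fun a r x"
  by (simp add: bump_fun_def flat_exp_def)

lemma bump_fun_pos_iff: assumes "r > 0" shows "0 < bump_fun a r x \<longleftrightarrow> x \<in> ball a r"
proof -
  have "0 < bump_fun a r x \<longleftrightarrow> (norm (x - a))\<^sup>2 < r\<^sup>2"
    by (simp add: bump_fun_def flat_exp_def dot_square_norm)
  also have "\<dots> \<longleftrightarrow> norm (x - a) < r"
    using assms by (metis less_imp_le norm_ge_zero power2_less_imp_less power_strict_mono pos2)
  finally show ?thesis by (simp add: dist_norm norm_minus_commute)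
qed

lemma bump_fun_test: assumes "r > 0" shows "test_fun (bump_fun a r)"
proof -
  have "bump_algebra a (r\<^sup>2) (bump_fun a r)"
    unfolding bump_fun_def by (rule bump_algebra.bump)
  moreover have "{x. bump_fun a r x \<noteq> 0} = ball a r"
  proof -
    have "bump_fun a r x \<noteq> 0 \<longleftrightarrow> x \<in> ball a r" for x
      using bump_fun_pos_iff[OF assms, of a x] bump_fun_nonneg[of a r x] by linarith
    then show ?thesis by blast
  qed
  ultimately show ?thesis using bump_algebra_smooth by (auto simp: test_fun_def)
qed

text \<open>A translated bump is again a bump, so the Hessian bound applies at every point of a line
  without a separate proof that test functions are stable under translation.\<close>

lemma bump_fun_translate: "bump_fun (a + c) r = (\<lambda>x. bump_fun a r (x - c))"
  by (simp add: bump_fun_def fun_eq_iff algebra_simps)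

lemma dirderiv_translate:
  assumes "\<And>x. f differentiable (at x)"
  shows "dirderiv v (\<lambda>x. f (x - c)) = (\<lambda>x. dirderiv v f (x - c))"
proof
  fix x
  obtain F where F: "(f has_derivative F) (at (x - c))" using assms unfolding differentiable_def by blast
  have "((\<lambda>x. x - c) has_derivative (\<lambda>h. h)) (at x)" by (auto intro!: derivative_eq_intros)
  from diff_chain_at[OF this F] have "((\<lambda>x. f (x - c)) has_derivative F) (at x)" by (simp add: o_def)
  from dirderiv_eqI[OF this] dirderiv_eqI[OF F]
  show "dirderiv v (\<lambda>x. f (x - c)) x = dirderiv v f (x - c)" by simp
qed

section \<open>Derivatives of integrals against moving test functions\<close>

lemma test_fun_diff:
  assumes "test_fun \<eta>"
  shows "\<eta> differentiable (at x)" "dirderiv v \<eta> differentiable (at x)" "dirderiv w (dirderiv v \<eta>) differentiable (at x)"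
  using assms[unfolded test_fun_def smooth_fun_def]
  by (metis iter_dirderiv.simps)+

lemma dirderiv_support:
  assumes "closed C" "\<And>x. x \<notin> C \<Longrightarrow> f x = 0" "x \<notin> C"
  shows "dirderiv v f x = 0"
proof -
  have "((\<lambda>_. 0) has_derivative (\<lambda>_. 0)) (at x)" by simp
  then have "(f has_derivative (\<lambda>_. 0)) (at x)"
    by (rule has_derivative_transform_within_open[of _ _ _ _ "- C"]) (use assms in auto)
  then show ?thesis using dirderiv_eqI by fastforce
qed

text \<open>\<phi> is only continuous, so the derivative has to fall on \<theta>. For s within
  distance 1 of s0 all translated supports lie in one compact sum set; on a box containing it the
  integral can be differentiated under the integral sign.\<close>

lemma convolution_has_derivative:
  fixes \<phi> \<theta> :: "'a::euclidean_space \<Rightarrow> real"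
  assumes cphi: "continuous_on UNIV \<phi>" and d: "\<And>x. \<theta> differentiable (at x)"
    and d': "continuous_on UNIV (dirderiv v \<theta>)"
    and C: "compact C" "\<And>x. x \<notin> C \<Longrightarrow> \<theta> x = 0"
  shows "((\<lambda>s. \<integral>x. \<phi> x * \<theta> (x - s *\<^sub>R v) \<partial>lborel) has_field_derivative
     - (\<integral>x. \<phi> x * dirderiv v \<theta> (x - s0 *\<^sub>R v) \<partial>lborel)) (at s0)"
proof -
  define K where "K = (\<lambda>(c, s). c + s *\<^sub>R v) ` (C \<times> cball s0 1)"
  have "compact K" unfolding K_def
    by (intro compact_continuous_image continuous_intros compact_Times C compact_cball) (auto simp: case_prod_unfold intro!: continuous_intros)
  then obtain b where b: "K \<subseteq> cbox (- b) b" using bounded_subset_cbox_symmetric compact_imp_bounded by metis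
  have z: "x - s *\<^sub>R v \<notin> C" if "x \<notin> cbox (- b) b" "s \<in> ball s0 1" for x s
  proof
    assume "x - s *\<^sub>R v \<in> C"
    then have "x \<in> K" unfolding K_def using that(2) by (auto intro!: image_eqI[of _ _ "(x - s *\<^sub>R v, s)"])
    then show False using b that by blast
  qed
  have ct: "continuous_on UNIV \<theta>" using d by (simp add: continuous_on_eq_continuous_at differentiable_imp_continuous_within)
  have eq: "(\<integral>x. \<phi> x * F (x - s *\<^sub>R v) \<partial>lborel) = integral (cbox (- b) b) (\<lambda>x. \<phi> x * F (x - s *\<^sub>R v))"
    if F: "continuous_on UNIV F" "\<And>x. x \<notin> C \<Longrightarrow> F x = 0" and s: "s \<in> ball s0 1" for F s
  proof -
    have c: "continuous_on (cbox (- b) b) (\<lambda>x. \<phi> x * F (x - s *\<^sub>R v))"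
      by (intro continuous_intros continuous_on_compose2[OF F(1)] continuous_on_subset[OF cphi]) auto
    have "(\<integral>x. \<phi> x * F (x - s *\<^sub>R v) \<partial>lborel) = set_lebesgue_integral lborel (cbox (- b) b) (\<lambda>x. \<phi> x * F (x - s *\<^sub>R v))"
      unfolding set_lebesgue_integral_def using z[OF _ s] F(2) by (intro Bochner_Integration.integral_cong) (auto simp: indicator_def)
    also have "\<dots> = integral (cbox (- b) b) (\<lambda>x. \<phi> x * F (x - s *\<^sub>R v))"
      by (rule set_borel_integral_eq_integral(2)) (use borel_integrable_compact[OF compact_cbox c] in \<open>simp add: set_integrable_def\<close>)
    finally show ?thesis .
  qed
  have line: "((\<lambda>s. \<phi> x * \<theta> (x - s *\<^sub>R v)) has_field_derivative \<phi> x * (- dirderiv v \<theta> (x - s *\<^sub>R v))) (at s within U)" for x s U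
  proof -
    obtain F where F: "(\<theta> has_derivative F) (at (x - s *\<^sub>R v))" using d unfolding differentiable_def by blast
    have 1: "((\<lambda>s. x - s *\<^sub>R v) has_derivative (\<lambda>h. - (h *\<^sub>R v))) (at s)" by (auto intro!: derivative_eq_intros)
    have "h * - dirderiv v \<theta> (x - s *\<^sub>R v) = F (- (h *\<^sub>R v))" for h
      using dirderiv_eqI[OF F, of v] has_derivative_linear[OF F] by (simp add: linear_neg linear_cmul)
    then have "((\<lambda>s. \<theta> (x - s *\<^sub>R v)) has_field_derivative - dirderiv v \<theta> (x - s *\<^sub>R v)) (at s)"
      using diff_chain_at[OF 1 F] by (intro has_derivative_imp_has_field_derivative) (simp_all add: o_def)
    then show ?thesis by (intro DERIV_cmult) (rule has_field_derivative_at_within)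
  qed
  have wi: "at s0 within ball s0 1 = at s0" by (rule at_within_open) auto
  have "((\<lambda>s. integral (cbox (- b) b) (\<lambda>x. \<phi> x * \<theta> (x - s *\<^sub>R v))) has_field_derivative
      integral (cbox (- b) b) (\<lambda>x. \<phi> x * - dirderiv v \<theta> (x - s0 *\<^sub>R v))) (at s0 within ball s0 1)"
  proof (rule leibniz_rule_field_derivative)
    show "(\<lambda>x. \<phi> x * \<theta> (x - s *\<^sub>R v)) integrable_on cbox (- b) b" for s
      by (intro integrable_continuous continuous_intros continuous_on_compose2[OF ct] continuous_on_subset[OF cphi]) auto
    show "continuous_on (ball s0 1 \<times> cbox (- b) b) (\<lambda>(s, x). \<phi> x * - dirderiv v \<theta> (x - s *\<^sub>R v))"
      unfolding case_prod_unfold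
      by (intro continuous_intros continuous_on_compose2[OF d'] continuous_on_compose2[OF cphi]) auto
  qed (use line in auto)
  moreover have "integral (cbox (- b) b) (\<lambda>x. \<phi> x * - dirderiv v \<theta> (x - s0 *\<^sub>R v)) = - (\<integral>x. \<phi> x * dirderiv v \<theta> (x - s0 *\<^sub>R v) \<partial>lborel)"
    using eq[OF d' dirderiv_support[OF compact_imp_closed[OF C(1)] C(2)], of s0] by simp
  ultimately have "((\<lambda>s. integral (cbox (- b) b) (\<lambda>x. \<phi> x * \<theta> (x - s *\<^sub>R v))) has_field_derivative
      - (\<integral>x. \<phi> x * dirderiv v \<theta> (x - s0 *\<^sub>R v) \<partial>lborel)) (at s0)"
    by (simp only: wi)
  then show ?thesis
    by (rule has_field_derivative_transform_within_open[of _ _ _ "ball s0 1"]) (use eq[OF ct C(2)] in auto)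
qed

lemma lborel_translate:
  fixes f :: "'a::euclidean_space \<Rightarrow> real"
  assumes "f \<in> borel_measurable borel"
  shows "(\<integral>x. f (x + c) \<partial>lborel) = (\<integral>x. f x \<partial>lborel)"
  using integral_distr[of "(+) c" lborel borel f] assms lborel_distr_plus[of c] by (simp add: add.commute)

text \<open>Along a line, \<open>\<integral> \<phi>(x) \<eta>(x - s v) dx\<close> has second derivative \<open>\<integral> \<phi> \<partial>\<^sub>v\<partial>\<^sub>v\<eta>(x - s v) dx\<close>,
  so the distributional bound turns into a bound on the second derivative of a function of \<open>s\<close>.\<close>

lemma test_convolution_derivs:
  fixes \<phi> :: "'a::euclidean_space \<Rightarrow> real"
  assumes c: "continuous_on UNIV \<phi>" and t: "test_fun \<eta>"
  shows "((\<lambda>s. \<integral>x. \<phi> x * \<eta> (x - s *\<^sub>R v) \<partial>lborel) has_field_derivative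
     - (\<integral>x. \<phi> x * dirderiv v \<eta> (x - s0 *\<^sub>R v) \<partial>lborel)) (at s0)"
    and "((\<lambda>s. - (\<integral>x. \<phi> x * dirderiv v \<eta> (x - s *\<^sub>R v) \<partial>lborel)) has_field_derivative
     (\<integral>x. \<phi> x * dirderiv v (dirderiv v \<eta>) (x - s0 *\<^sub>R v) \<partial>lborel)) (at s0)"
proof -
  have cont: "continuous_on UNIV f" if "\<And>x. f differentiable (at x)" for f :: "'a \<Rightarrow> real"
    using that by (simp add: continuous_on_eq_continuous_at differentiable_imp_continuous_within)
  let ?C = "closure {x. \<eta> x \<noteq> 0}"
  have C: "compact ?C" "\<And>x. x \<notin> ?C \<Longrightarrow> \<eta> x = 0"
    using t closure_subset[of "{x. \<eta> x \<noteq> 0}"] by (auto simp: test_fun_def)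
  show "((\<lambda>s. \<integral>x. \<phi> x * \<eta> (x - s *\<^sub>R v) \<partial>lborel) has_field_derivative
     - (\<integral>x. \<phi> x * dirderiv v \<eta> (x - s0 *\<^sub>R v) \<partial>lborel)) (at s0)"
    by (rule convolution_has_derivative[OF c test_fun_diff(1)[OF t] cont[OF test_fun_diff(2)[OF t]] C])
  have "((\<lambda>s. \<integral>x. \<phi> x * dirderiv v \<eta> (x - s *\<^sub>R v) \<partial>lborel) has_field_derivative
     - (\<integral>x. \<phi> x * dirderiv v (dirderiv v \<eta>) (x - s0 *\<^sub>R v) \<partial>lborel)) (at s0)"
    by (rule convolution_has_derivative[OF c test_fun_diff(2)[OF t] cont[OF test_fun_diff(3)[OF t]] C(1)
          dirderiv_support[OF closed_closure C(2)]])
  from DERIV_minus[OF this]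
  show "((\<lambda>s. - (\<integral>x. \<phi> x * dirderiv v \<eta> (x - s *\<^sub>R v) \<partial>lborel)) has_field_derivative
     (\<integral>x. \<phi> x * dirderiv v (dirderiv v \<eta>) (x - s0 *\<^sub>R v) \<partial>lborel)) (at s0)" by simp
qed

lemma integrable_times_test:
  fixes \<phi> :: "'a::euclidean_space \<Rightarrow> real"
  assumes c: "continuous_on UNIV \<phi>" and t: "test_fun \<eta>"
  shows "integrable lborel (\<lambda>x. \<phi> x * \<eta> x)"
proof -
  have "continuous_on UNIV \<eta>"
    using test_fun_diff(1)[OF t] by (simp add: continuous_on_eq_continuous_at differentiable_imp_continuous_within)
  then have "integrable lborel (\<lambda>x. indicator (closure {x. \<eta> x \<noteq> 0}) x *\<^sub>R (\<phi> x * \<eta> x))"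
    using t c by (intro borel_integrable_compact continuous_intros) (auto simp: test_fun_def intro: continuous_on_subset)
  moreover have "indicator (closure {x. \<eta> x \<noteq> 0}) x *\<^sub>R (\<phi> x * \<eta> x) = \<phi> x * \<eta> x" for x
    using closure_subset[of "{x. \<eta> x \<noteq> 0}"] by (auto simp: indicator_def)
  ultimately show ?thesis by (simp only:)
qed

lemma test_convolution_shift:
  fixes \<phi> :: "'a::euclidean_space \<Rightarrow> real"
  assumes c: "continuous_on UNIV \<phi>" and t: "test_fun \<eta>"
  shows "(\<integral>x. \<phi> x * \<eta> (x - s *\<^sub>R v) \<partial>lborel) = (\<integral>x. \<phi> (x + s *\<^sub>R v) * \<eta> x \<partial>lborel)"
proof -
  have "continuous_on UNIV \<eta>"
    using test_fun_diff(1)[OF t] by (simp add: continuous_on_eq_continuous_at differentiable_imp_continuous_within)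
  then have "continuous_on UNIV (\<lambda>x. \<eta> (x - s *\<^sub>R v))"
    by (rule continuous_on_compose2) (auto intro!: continuous_intros)
  then have "(\<lambda>x. \<phi> x * \<eta> (x - s *\<^sub>R v)) \<in> borel_measurable borel"
    by (intro borel_measurable_continuous_onI continuous_intros c)
  from lborel_translate[OF this, of "s *\<^sub>R v"] show ?thesis by simp
qed

section \<open>Semiconcavity: the distributional and the pointwise form\<close>

lemma half_norm_sq_combination:
  fixes x y :: "'a::real_inner"
  shows "(norm ((1 - t) *\<^sub>R x + t *\<^sub>R y))\<^sup>2 = (1 - t) * (norm x)\<^sup>2 + t * (norm y)\<^sup>2 - t * (1 - t) * (norm (y - x))\<^sup>2"
  unfolding power2_norm_eq_inner
  by (simp add: inner_add_left inner_add_right inner_diff_left inner_diff_right inner_commute) algebra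

text \<open>Averaging \<phi> against a bump translated along a segment gives a C^2 function of one
  variable whose second derivative is controlled. Its values at 0, t and 1 show that the convexity
  defect \<open>\<Phi>\<close> has a nonnegative integral against every bump centred at y. Since
  \<open>\<Phi>\<close> is continuous, a narrow bump would detect a negative value at y.\<close>

lemma hess_le_id_imp_convex:
  fixes \<phi> :: "'a::euclidean_space \<Rightarrow> real"
  assumes c: "continuous_on UNIV \<phi>" and h: "hess_le_id \<phi>"
  shows "convex_on UNIV (\<lambda>x. (norm x)\<^sup>2 / 2 - \<phi> x)"
proof (rule convex_onI)
  fix t :: real and y z :: 'a
  assume t: "0 < t" "t < 1"
  define v where "v = z - y"
  \<comment> \<open>The convexity defect of |.|^2/2 - \<phi> on the segment from x to x + v, as a
    function of x; the last term is the defect of the quadratic part.\<close>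
  define \<Phi> where "\<Phi> x = \<phi> (x + t *\<^sub>R v) - (1 - t) * \<phi> x - t * \<phi> (x + v) + (norm v)\<^sup>2 * (t * (1 - t) / 2)" for x
  have c': "continuous_on UNIV (\<lambda>x. \<phi> (x + d))" for d
    by (intro continuous_on_compose2[OF c] continuous_intros) auto
  have cP: "continuous_on UNIV \<Phi>" unfolding \<Phi>_def by (intro continuous_intros c c')
  have pos: "0 \<le> (\<integral>x. \<Phi> x * bump_fun y r x \<partial>lborel)" if r: "r > 0" for r
  proof -
    let ?\<eta> = "bump_fun y r"
    have test: "test_fun ?\<eta>" by (rule bump_fun_test[OF r])
    define m where "m = (\<integral>x. ?\<eta> x \<partial>lborel)"
    define g where "g s = (\<integral>x. \<phi> x * ?\<eta> (x - s *\<^sub>R v) \<partial>lborel)" for s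
    define g1 where "g1 s = - (\<integral>x. \<phi> x * dirderiv v ?\<eta> (x - s *\<^sub>R v) \<partial>lborel)" for s
    define g2 where "g2 s = (\<integral>x. \<phi> x * dirderiv v (dirderiv v ?\<eta>) (x - s *\<^sub>R v) \<partial>lborel)" for s
    have d1: "(g has_field_derivative g1 s) (at s)" and d2: "(g1 has_field_derivative g2 s) (at s)" for s
      using test_convolution_derivs[OF c test] by (auto simp: g_def[abs_def] g1_def[abs_def] g2_def)
    have g2: "g2 s \<le> (norm v)\<^sup>2 * m" for s
    proof -
      let ?\<eta>s = "bump_fun (y + s *\<^sub>R v) r"
      have e: "?\<eta>s = (\<lambda>x. ?\<eta> (x - s *\<^sub>R v))" by (rule bump_fun_translate)
      have "dirderiv v ?\<eta>s = (\<lambda>x. dirderiv v ?\<eta> (x - s *\<^sub>R v))"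
        unfolding e by (rule dirderiv_translate[OF test_fun_diff(1)[OF test]])
      then have e2: "dirderiv v (dirderiv v ?\<eta>s) = (\<lambda>x. dirderiv v (dirderiv v ?\<eta>) (x - s *\<^sub>R v))"
        using dirderiv_translate[OF test_fun_diff(2)[OF test]] by simp
      have "(\<integral>x. \<phi> x * dirderiv v (dirderiv v ?\<eta>s) x \<partial>lborel) \<le> (v \<bullet> v) * (\<integral>x. ?\<eta>s x \<partial>lborel)"
        using h bump_fun_test[OF r] bump_fun_nonneg unfolding hess_le_id_def by blast
      moreover have "(\<integral>x. ?\<eta>s x \<partial>lborel) = m"
        using test_convolution_shift[of "\<lambda>_. 1" ?\<eta> s v] test unfolding e m_def by simp
      ultimately show ?thesis unfolding g2_def e2 by (simp add: power2_norm_eq_inner)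
    qed
    have "convex_on UNIV (\<lambda>s. (norm v)\<^sup>2 * m * s\<^sup>2 / 2 - g s)"
    proof (rule f''_ge0_imp_convex)
      show "((\<lambda>s. (norm v)\<^sup>2 * m * s\<^sup>2 / 2 - g s) has_field_derivative ((norm v)\<^sup>2 * m * s - g1 s)) (at s)" for s
        by (auto intro!: derivative_eq_intros d1)
      show "((\<lambda>s. (norm v)\<^sup>2 * m * s - g1 s) has_field_derivative ((norm v)\<^sup>2 * m - g2 s)) (at s)" for s
        by (auto intro!: derivative_eq_intros d2)
    qed (use g2 in auto)
    from convex_onD[OF this, of t 0 1] t
    have "(norm v)\<^sup>2 * m * t\<^sup>2 / 2 - g t \<le> (1 - t) * (- g 0) + t * ((norm v)\<^sup>2 * m / 2 - g 1)" by simp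
    then have le: "0 \<le> g t - (1 - t) * g 0 - t * g 1 + (norm v)\<^sup>2 * (t * (1 - t) / 2) * m"
      by (simp add: algebra_simps power2_eq_square) (simp add: field_simps)
    have gs: "g s = (\<integral>x. \<phi> (x + s *\<^sub>R v) * ?\<eta> x \<partial>lborel)" for s
      unfolding g_def by (rule test_convolution_shift[OF c test])
    have i: "integrable lborel (\<lambda>x. \<phi> (x + d) * ?\<eta> x)" for d
      by (rule integrable_times_test[OF c' test])
    have i1: "integrable lborel ?\<eta>" using integrable_times_test[of "\<lambda>_. 1", OF _ test] by simp
    have "(\<integral>x. \<Phi> x * ?\<eta> x \<partial>lborel) = (\<integral>x. \<phi> (x + t *\<^sub>R v) * ?\<eta> x - (1 - t) * (\<phi> (x + 0) * ?\<eta> x) - t * (\<phi> (x + v) * ?\<eta> x) + (norm v)\<^sup>2 * (t * (1 - t) / 2) * ?\<eta> x \<partial>lborel)"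
      by (intro Bochner_Integration.integral_cong refl) (simp add: \<Phi>_def algebra_simps)
    also have "\<dots> = (\<integral>x. \<phi> (x + t *\<^sub>R v) * ?\<eta> x \<partial>lborel) - (1 - t) * (\<integral>x. \<phi> (x + 0) * ?\<eta> x \<partial>lborel) - t * (\<integral>x. \<phi> (x + v) * ?\<eta> x \<partial>lborel) + (norm v)\<^sup>2 * (t * (1 - t) / 2) * m"
      unfolding m_def
      by (subst Bochner_Integration.integral_add Bochner_Integration.integral_diff,
          (intro Bochner_Integration.integrable_diff integrable_mult_right i i1)+)+ simp
    also have "\<dots> = g t - (1 - t) * g 0 - t * g 1 + (norm v)\<^sup>2 * (t * (1 - t) / 2) * m"
      using gs[of t] gs[of 0] gs[of 1] by simp
    finally show ?thesis using le by simp
  qed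
  have "0 \<le> \<Phi> y"
  proof (rule ccontr)
    assume "\<not> 0 \<le> \<Phi> y"
    then have neg: "\<Phi> y < 0" by simp
    have "open {x. \<Phi> x < \<Phi> y / 2}" by (intro open_Collect_less cP continuous_intros)
    moreover have "y \<in> {x. \<Phi> x < \<Phi> y / 2}" using neg by simp
    ultimately obtain r where r: "r > 0" "ball y r \<subseteq> {x. \<Phi> x < \<Phi> y / 2}" by (meson openE)
    let ?\<eta> = "bump_fun y r"
    have test: "test_fun ?\<eta>" by (rule bump_fun_test[OF r(1)])
    have i1: "integrable lborel ?\<eta>" using integrable_times_test[of "\<lambda>_. 1", OF _ test] by simp
    have "\<Phi> x * ?\<eta> x \<le> \<Phi> y / 2 * ?\<eta> x" for x
    proof (cases "x \<in> ball y r")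
      case True
      then have "\<Phi> x \<le> \<Phi> y / 2" using r(2) by fastforce
      then show ?thesis using bump_fun_nonneg by (rule mult_right_mono)
    next
      case False
      then have "?\<eta> x = 0" using bump_fun_pos_iff[OF r(1), of y x] bump_fun_nonneg[of y r x] by linarith
      then show ?thesis by simp
    qed
    then have "(\<integral>x. \<Phi> x * ?\<eta> x \<partial>lborel) \<le> (\<integral>x. \<Phi> y / 2 * ?\<eta> x \<partial>lborel)"
      using integrable_times_test[OF cP test] i1 by (intro integral_mono) auto
    with pos[OF r(1)] have "0 \<le> \<Phi> y / 2 * (\<integral>x. ?\<eta> x \<partial>lborel)" by simp
    then have "(\<integral>x. ?\<eta> x \<partial>lborel) \<le> 0" using neg by (simp add: mult_le_0_iff zero_le_mult_iff)
    moreover have "0 \<le> (\<integral>x. ?\<eta> x \<partial>lborel)" using bump_fun_nonneg by (intro integral_nonneg_AE) auto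
    ultimately have "(\<integral>x. ?\<eta> x \<partial>lborel) = 0" by simp
    then have "AE x in lborel. ?\<eta> x = 0"
      using integral_nonneg_eq_0_iff_AE[OF i1] bump_fun_nonneg by auto
    then have "AE x in lborel. x \<notin> ball y r"
    proof eventually_elim
      case (elim x)
      then show ?case using bump_fun_pos_iff[OF r(1), of y x] by auto
    qed
    then have "emeasure lborel (ball y r) = 0"
      by (subst (asm) AE_iff_measurable[of "ball y r"]) auto
    then show False using content_ball_pos[OF r(1), of y] by (simp add: measure_def)
  qed
  moreover have "(norm (y + t *\<^sub>R v))\<^sup>2 = (1 - t) * (norm y)\<^sup>2 + t * (norm z)\<^sup>2 - t * (1 - t) * (norm v)\<^sup>2"
    using half_norm_sq_combination[of t y z] by (simp add: v_def algebra_simps)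
  moreover have "(1 - t) *\<^sub>R y + t *\<^sub>R z = y + t *\<^sub>R v" by (simp add: v_def algebra_simps)
  moreover have "N / 2 - w \<le> (1 - t) * (Y / 2 - a) + t * (Z / 2 - b)"
    if "0 \<le> w - (1 - t) * a - t * b + V * (t * (1 - t) / 2)" "N = (1 - t) * Y + t * Z - t * (1 - t) * V" for N w Y Z V a b :: real
    using that(1) unfolding that(2) by (simp add: field_simps)
  ultimately show "(norm ((1 - t) *\<^sub>R y + t *\<^sub>R z))\<^sup>2 / 2 - \<phi> ((1 - t) *\<^sub>R y + t *\<^sub>R z)
      \<le> (1 - t) * ((norm y)\<^sup>2 / 2 - \<phi> y) + t * ((norm z)\<^sup>2 / 2 - \<phi> z)"
    by (simp add: \<Phi>_def v_def)
qed simp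

text \<open>Midpoint convexity, integrated against the test function, makes the corrected symmetric
  second difference \<open>D\<close> nonpositive. \<open>D\<close> and its derivative vanish at 0;
  if the distributional bound failed, that derivative would increase through 0 and \<open>D\<close>
  would become positive at once.\<close>

lemma convex_imp_hess_le_id:
  fixes \<phi> :: "'a::euclidean_space \<Rightarrow> real"
  assumes cv: "convex_on UNIV (\<lambda>x. (norm x)\<^sup>2 / 2 - \<phi> x)"
  shows "continuous_on UNIV \<phi>" "hess_le_id \<phi>"
proof -
  have "continuous_on UNIV (\<lambda>x. (norm x)\<^sup>2 / 2 - ((norm x)\<^sup>2 / 2 - \<phi> x))"
    by (intro continuous_intros convex_on_continuous cv) auto
  then show c: "continuous_on UNIV \<phi>" by simp
  have c': "continuous_on UNIV (\<lambda>x. \<phi> (x + d))" for d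
    by (intro continuous_on_compose2[OF c] continuous_intros) auto
  show "hess_le_id \<phi>"
    unfolding hess_le_id_def
  proof (intro allI impI)
    fix \<eta> :: "'a \<Rightarrow> real" and v :: 'a
    assume test: "test_fun \<eta>" and nn: "\<forall>x. 0 \<le> \<eta> x"
    define m where "m = (\<integral>x. \<eta> x \<partial>lborel)"
    define g where "g s = (\<integral>x. \<phi> x * \<eta> (x - s *\<^sub>R v) \<partial>lborel)" for s
    define g1 where "g1 s = - (\<integral>x. \<phi> x * dirderiv v \<eta> (x - s *\<^sub>R v) \<partial>lborel)" for s
    define L where "L = (\<integral>x. \<phi> x * dirderiv v (dirderiv v \<eta>) x \<partial>lborel)"
    have d1: "(g has_field_derivative g1 s) (at s)" and d2: "(g1 has_field_derivative L) (at 0)" for s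
      using test_convolution_derivs[OF c test, of v s] test_convolution_derivs(2)[OF c test, of v 0]
      by (auto simp: g_def[abs_def] g1_def[abs_def] L_def)
    have i: "integrable lborel (\<lambda>x. \<phi> (x + d) * \<eta> x)" for d
      by (rule integrable_times_test[OF c' test])
    have i1: "integrable lborel \<eta>" using integrable_times_test[of "\<lambda>_. 1", OF _ test] by simp
    define D where "D s = g s + g (- s) - 2 * g 0 - (norm v)\<^sup>2 * m * s\<^sup>2" for s
    have D: "D s \<le> 0" for s
    proof -
      have gs: "g s = (\<integral>x. \<phi> (x + s *\<^sub>R v) * \<eta> x \<partial>lborel)" for s
        unfolding g_def by (rule test_convolution_shift[OF c test])
      have "\<phi> (x + s *\<^sub>R v) + \<phi> (x + (- s) *\<^sub>R v) \<le> 2 * \<phi> (x + 0) + (norm v)\<^sup>2 * s\<^sup>2" for x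
      proof -
        have mid: "(1 - 1/2) *\<^sub>R (x + s *\<^sub>R v) + (1/2) *\<^sub>R (x - s *\<^sub>R v) = x"
          by (simp add: algebra_simps flip: scaleR_left_distrib)
        have "(norm x)\<^sup>2 / 2 - \<phi> x \<le> (1 - 1/2) * ((norm (x + s *\<^sub>R v))\<^sup>2 / 2 - \<phi> (x + s *\<^sub>R v)) + 1/2 * ((norm (x - s *\<^sub>R v))\<^sup>2 / 2 - \<phi> (x - s *\<^sub>R v))"
          using convex_onD[OF cv, of "1/2" "x + s *\<^sub>R v" "x - s *\<^sub>R v"] unfolding mid by simp
        moreover have "(norm (x + s *\<^sub>R v))\<^sup>2 + (norm (x - s *\<^sub>R v))\<^sup>2 = 2 * (norm x)\<^sup>2 + 2 * ((norm v)\<^sup>2 * s\<^sup>2)"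
          unfolding power2_norm_eq_inner by (simp add: inner_add_left inner_add_right inner_diff_left inner_diff_right power2_eq_square inner_commute algebra_simps)
        ultimately show ?thesis by (simp add: field_simps)
      qed
      then have "\<phi> (x + s *\<^sub>R v) * \<eta> x + \<phi> (x + (- s) *\<^sub>R v) * \<eta> x \<le> 2 * (\<phi> (x + 0) * \<eta> x) + (norm v)\<^sup>2 * s\<^sup>2 * \<eta> x" for x
        using mult_right_mono[OF _ nn[rule_format, of x]] by (metis distrib_right mult.assoc)
      then have "(\<integral>x. \<phi> (x + s *\<^sub>R v) * \<eta> x + \<phi> (x + (- s) *\<^sub>R v) * \<eta> x \<partial>lborel) \<le> (\<integral>x. 2 * (\<phi> (x + 0) * \<eta> x) + (norm v)\<^sup>2 * s\<^sup>2 * \<eta> x \<partial>lborel)"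
        by (intro integral_mono Bochner_Integration.integrable_add i integrable_mult_right i1)
      also have "(\<integral>x. \<phi> (x + s *\<^sub>R v) * \<eta> x + \<phi> (x + (- s) *\<^sub>R v) * \<eta> x \<partial>lborel) = g s + g (- s)"
        unfolding gs by (intro Bochner_Integration.integral_add i)
      also have "(\<integral>x. 2 * (\<phi> (x + 0) * \<eta> x) + (norm v)\<^sup>2 * s\<^sup>2 * \<eta> x \<partial>lborel) = 2 * g 0 + (norm v)\<^sup>2 * s\<^sup>2 * m"
        unfolding gs[of 0] m_def by (subst Bochner_Integration.integral_add) (auto intro!: i i1 integrable_mult_right simp: i[of 0, simplified])
      finally show ?thesis by (simp add: D_def algebra_simps)
    qed
    show "L \<le> (v \<bullet> v) * m"
    proof (rule ccontr)
      assume "\<not> L \<le> (v \<bullet> v) * m"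
      then have gt: "L > (norm v)\<^sup>2 * m" by (simp add: power2_norm_eq_inner)
      define D1 where "D1 s = g1 s - g1 (- s) - 2 * (norm v)\<^sup>2 * m * s" for s
      have DD: "(D has_field_derivative D1 s) (at s)" for s
        unfolding D_def[abs_def] D1_def by (auto intro!: derivative_eq_intros d1 DERIV_chain2[OF d1])
      have "((\<lambda>s. g1 (- s)) has_field_derivative L * (- 1)) (at 0)"
        by (rule DERIV_chain2[of g1]) (auto intro!: derivative_eq_intros d2)
      then have "(D1 has_field_derivative (2 * L - 2 * (norm v)\<^sup>2 * m)) (at 0)"
        unfolding D1_def[abs_def] by (auto intro!: derivative_eq_intros d2)
      from DERIV_pos_inc_right[OF this] gt obtain d where d: "d > 0" "\<And>h. 0 < h \<Longrightarrow> h < d \<Longrightarrow> D1 0 < D1 (0 + h)" by auto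
      have "D 0 < D (d / 2)"
      proof (rule DERIV_pos_imp_increasing_open[of 0 "d / 2" D])
        show "\<exists>y. (D has_field_derivative y) (at x) \<and> 0 < y" if "0 < x" "x < d / 2" for x
          using DD[of x] d(2)[of x] that by (auto simp: D1_def)
        show "continuous_on {0..d / 2} D" by (rule DERIV_continuous_on) (rule has_field_derivative_at_within[OF DD])
      qed (use d in auto)
      moreover have "D 0 = 0" by (simp add: D_def)
      ultimately show False using D[of "d / 2"] by simp
    qed
  qed
qed

section \<open>Almost everywhere differentiability of convex functions\<close>

text \<open>By translation invariance the measure of N equals the average over t in [0,1] of the
  measures of its translates by t b. Exchanging the integrals leaves the lengths of the sections of
  N by lines, which are 0. No decomposition of the space along b is involved.\<close>

lemma null_set_of_countable_lines:
  fixes N :: "'a::euclidean_space set"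
  assumes N[measurable]: "N \<in> sets borel" and c: "\<And>y. countable {t. y + t *\<^sub>R b \<in> N}"
  shows "N \<in> null_sets lborel"
proof -
  have sf: "pair_sigma_finite (lborel :: 'a measure) (lborel :: real measure)"
    by (simp add: pair_sigma_finite_def lborel.sigma_finite_measure_axioms)
  have meas: "(\<lambda>(x, t). indicator {0..1::real} t * indicator N (x + t *\<^sub>R b) :: ennreal) \<in> borel_measurable (lborel \<Otimes>\<^sub>M lborel)"
    by measurable
  have "(\<integral>\<^sup>+x. indicator N (x + t *\<^sub>R b) \<partial>lborel) = emeasure lborel N" for t
    using nn_integral_distr[of "(+) (t *\<^sub>R b)" lborel borel "indicator N :: 'a \<Rightarrow> ennreal"] lborel_distr_plus[of "t *\<^sub>R b"] N
    by (simp add: add.commute)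
  then have "emeasure lborel N = (\<integral>\<^sup>+t. indicator {0..1::real} t * (\<integral>\<^sup>+x. indicator N (x + t *\<^sub>R b) \<partial>lborel) \<partial>lborel)"
    by (simp add: mult.commute[of "indicator _ _"] nn_integral_cmult_indicator)
  also have "\<dots> = (\<integral>\<^sup>+t. (\<integral>\<^sup>+x. indicator {0..1::real} t * indicator N (x + t *\<^sub>R b) \<partial>lborel) \<partial>lborel)"
    by (intro nn_integral_cong nn_integral_cmult[symmetric]) measurable
  also have "\<dots> = (\<integral>\<^sup>+x. (\<integral>\<^sup>+t. indicator {0..1::real} t * indicator N (x + t *\<^sub>R b) \<partial>lborel) \<partial>lborel)"
    using pair_sigma_finite.Fubini[OF sf meas] by simp
  also have "\<dots> = (\<integral>\<^sup>+x. 0 \<partial>(lborel :: 'a measure))"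
  proof (rule nn_integral_cong)
    fix x :: 'a
    have nl: "{t. x + t *\<^sub>R b \<in> N} \<in> null_sets lborel" using c by (rule countable_imp_null_set_lborel)
    have "(\<integral>\<^sup>+t. indicator {0..1::real} t * indicator N (x + t *\<^sub>R b) \<partial>lborel) = (\<integral>\<^sup>+t. 0 \<partial>(lborel :: real measure))"
      by (rule nn_integral_cong_AE, rule AE_mp[OF AE_not_in[OF nl]]) (auto simp: indicator_def)
    then show "(\<integral>\<^sup>+t. indicator {0..1::real} t * indicator N (x + t *\<^sub>R b) \<partial>lborel) = 0" by simp
  qed
  finally show ?thesis using N by (simp add: null_sets_def)
qed

section \<open>Convex functions of one variable: slopes, kinks and derivatives\<close>

lemma convex_slope_mono:
  fixes f :: "real \<Rightarrow> real"
  assumes f: "convex_on I f" and I: "t \<in> I" "t + r \<in> I" "t + s \<in> I" and rs: "r \<le> s" "r \<noteq> 0" "s \<noteq> 0"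
  shows "(f (t + r) - f t) / r \<le> (f (t + s) - f t) / s"
proof -
  consider "r = s" | "0 < r" "r < s" | "r < 0" "0 < s" | "r < s" "s < 0" using rs by linarith
  then show ?thesis
  proof cases
    case 2
    have "(f t - f (t + r)) / (t - (t + r)) \<le> (f t - f (t + s)) / (t - (t + s))"
      using convex_on_slope_le(1)[OF f, of t "t + s" "t + r"] I 2 by simp
    then show ?thesis using 2 by (simp add: field_simps)
  next
    case 3
    have "(f (t + r) - f t) / ((t + r) - t) \<le> (f (t + r) - f (t + s)) / ((t + r) - (t + s))"
      "(f (t + r) - f (t + s)) / ((t + r) - (t + s)) \<le> (f t - f (t + s)) / (t - (t + s))"
      using convex_on_slope_le[OF f, of "t + r" "t + s" t] I 3 by simp_all
    then have "(f (t + r) - f t) / ((t + r) - t) \<le> (f t - f (t + s)) / (t - (t + s))" by (rule order_trans)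
    then show ?thesis using 3 by (simp add: field_simps)
  next
    case 4
    have "(f (t + r) - f t) / ((t + r) - t) \<le> (f (t + s) - f t) / ((t + s) - t)"
      using convex_on_slope_le(2)[OF f, of "t + r" t "t + s"] I 4 by simp
    then show ?thesis by simp
  qed auto
qed

text \<open>A fixed countable sequence of increments, so that the limits taken along it define
  measurable sets and functions. It serves again as the slack of the nearly optimal
  couplings.\<close>

definition step :: "nat \<Rightarrow> real" where "step n = inverse (real (Suc n))"

lemma step_pos: "0 < step n" and step_tendsto: "step \<longlonglongrightarrow> 0"
  using LIMSEQ_inverse_real_of_nat by (simp_all add: step_def[abs_def])

lemma step_eventually: "0 < d \<Longrightarrow> \<forall>\<^sub>F n in sequentially. step n < d"
  using step_tendsto order_tendstoD(2) by blast

text \<open>Right slope minus left slope. Because only one division by the increment occurs, for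
  convex functions its limit is the jump of the derivative at t.\<close>

definition second_diff :: "(real \<Rightarrow> real) \<Rightarrow> real \<Rightarrow> nat \<Rightarrow> real" where
  "second_diff f t n = (f (t + step n) - f t) / step n - (f (t + - step n) - f t) / (- step n)"

lemma open_step_eventually:
  assumes "open I" "(t::real) \<in> I"
  shows "\<forall>\<^sub>F n in sequentially. t + step n \<in> I \<and> t + - step n \<in> I"
proof -
  obtain d where d: "d > 0" "ball t d \<subseteq> I" using assms by (meson openE)
  show ?thesis using step_eventually[OF d(1)]
  proof eventually_elim
    case (elim n)
    have "t + step n \<in> ball t d" "t + - step n \<in> ball t d" using elim step_pos[of n] by (auto simp: dist_real_def)
    then show ?case using d(2) by blast
  qed
qed

text \<open>If the second differences at \<open>t\<close> do not vanish, some rational slope lies strictly between the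
  one-sided derivatives, so \<open>t\<close> is a strict minimizer of \<open>f - r \<cdot> id\<close>; each \<open>r\<close> has at most one such \<open>t\<close>.\<close>

lemma convex_kinks_countable:
  fixes f :: "real \<Rightarrow> real"
  assumes f: "convex_on I f" and I: "open I"
  shows "countable {t \<in> I. \<not> second_diff f t \<longlonglongrightarrow> 0}" (is "countable ?S")
proof -
  define strict where "strict r t \<longleftrightarrow> t \<in> I \<and> (\<forall>s\<in>I. s \<noteq> t \<longrightarrow> f s > f t + r * (s - t))" for r t
  have ex: "\<exists>r\<in>\<rat>. strict r t" if t: "t \<in> ?S" for t
  proof -
    have tI: "t \<in> I" and nl: "\<not> second_diff f t \<longlonglongrightarrow> 0" using t by auto
    then obtain c where c: "c > 0" "\<And>N. \<exists>n\<ge>N. c \<le> \<bar>second_diff f t n\<bar>"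
      by (auto simp: LIMSEQ_def dist_real_def not_less)
    let ?m = "\<lambda>s. (f (t + s) - f t) / s"
    \<comment> \<open>Slopes are monotone, and the slopes at arbitrarily small increments still
      differ by c; the same c therefore separates every left slope from every right slope.\<close>
    have gap: "?m (- s') + c \<le> ?m s" if s: "s > 0" "s' > 0" "t + s \<in> I" "t + - s' \<in> I" for s s'
    proof -
      obtain N where N: "\<And>n. n \<ge> N \<Longrightarrow> t + step n \<in> I \<and> t + - step n \<in> I \<and> step n < s \<and> step n < s'"
        using eventually_conj[OF open_step_eventually[OF I tI] eventually_conj[OF step_eventually[OF s(1)] step_eventually[OF s(2)]]]
        by (auto simp: eventually_sequentially)
      obtain n where n: "n \<ge> N" "c \<le> \<bar>second_diff f t n\<bar>" using c(2) by blast
      note Nn = N[OF n(1)] step_pos[of n]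
      have "?m (- step n) \<le> ?m (step n)" using convex_slope_mono[OF f tI, of "- step n" "step n"] Nn by simp
      moreover have "?m (step n) \<le> ?m s" using convex_slope_mono[OF f tI, of "step n" s] Nn s by simp
      moreover have "?m (- s') \<le> ?m (- step n)" using convex_slope_mono[OF f tI, of "- s'" "- step n"] Nn s by simp
      ultimately show ?thesis using n(2) unfolding second_diff_def by linarith
    qed
    obtain n0 where n0: "t + step n0 \<in> I" "t + - step n0 \<in> I"
      using open_step_eventually[OF I tI] by (auto simp: eventually_sequentially)
    \<comment> \<open>\<open>Sup A\<close> is the left derivative, and all right slopes are at least
      \<open>Sup A + c\<close>; this leaves room for a rational strictly in between.\<close>
    define A where "A = {?m (- s) |s. s > 0 \<and> t + - s \<in> I}"
    have A: "A \<noteq> {}" "bdd_above A" unfolding A_def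
      using n0 step_pos gap[OF step_pos _ n0(1)] c(1) by (auto intro!: bdd_aboveI[of _ "?m (step n0)"]) (smt (verit))
    have "Sup A < Sup A + c" using c by simp
    then obtain r where r: "r \<in> \<rat>" "Sup A < r" "r < Sup A + c" using Rats_dense_in_real by blast
    have "f s > f t + r * (s - t)" if s: "s \<in> I" "s \<noteq> t" for s
    proof (cases "s < t")
      case True
      then have "?m (- (t - s)) \<in> A" unfolding A_def using s by (intro CollectI exI[of _ "t - s"]) auto
      then have "?m (s - t) \<in> A" by (simp only: minus_diff_eq)
      then have "?m (s - t) < r" using cSup_upper[OF _ A(2)] r(2) by fastforce
      then show ?thesis using True by (simp add: field_simps)
    next
      case False
      then have pos: "s - t > 0" using s by simp
      have "Sup A + c \<le> ?m (s - t)"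
      proof -
        have "Sup A \<le> ?m (s - t) - c"
        proof (rule cSup_least[OF A(1)])
          fix x assume "x \<in> A"
          then show "x \<le> ?m (s - t) - c" unfolding A_def using gap[OF pos] s(1) by force
        qed
        then show ?thesis by simp
      qed
      then have "r < ?m (s - t)" using r(3) by linarith
      then show ?thesis using pos by (simp add: field_simps)
    qed
    then show ?thesis using r(1) tI by (auto simp: strict_def)
  qed
  have uniq: "t = t'" if "strict r t" "strict r t'" for r t t'
  proof (rule ccontr)
    assume "t \<noteq> t'"
    then have "f t' > f t + r * (t' - t)" "f t > f t' + r * (t - t')" using that by (auto simp: strict_def)
    then show False by (simp add: algebra_simps)
  qed
  have "?S \<subseteq> (\<lambda>r. THE t. strict r t) ` \<rat>"
  proof
    fix t assume "t \<in> ?S"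
    then obtain r where "r \<in> \<rat>" "strict r t" using ex by blast
    then show "t \<in> (\<lambda>r. THE t. strict r t) ` \<rat>" using uniq by (auto intro!: image_eqI[of _ _ r] the_equality[symmetric])
  qed
  then show ?thesis by (rule countable_subset) (intro countable_image countable_rat)
qed

text \<open>For |s| below \<open>step n\<close> every slope, and also the right derivative
  \<open>D\<close>, lies between the left and the right slope at \<open>step n\<close>, whose
  difference tends to 0.\<close>

lemma convex_differentiable_of_second_diff:
  fixes f :: "real \<Rightarrow> real"
  assumes f: "convex_on I f" and I: "open I" "t \<in> I" and l: "second_diff f t \<longlonglongrightarrow> 0"
  shows "\<exists>D. (f has_field_derivative D) (at t)"
proof -
  let ?m = "\<lambda>s. (f (t + s) - f t) / s"
  define A where "A = {?m s |s. s > 0 \<and> t + s \<in> I}"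
  obtain n0 where n0: "t + step n0 \<in> I" "t + - step n0 \<in> I"
    using open_step_eventually[OF I] by (auto simp: eventually_sequentially)
  have low: "?m (- step n) \<le> x" if "x \<in> A" "t + - step n \<in> I" for x n
    using that convex_slope_mono[OF f I(2) that(2)] step_pos[of n] unfolding A_def by (smt (verit) mem_Collect_eq)
  have A: "A \<noteq> {}" using n0 step_pos by (auto simp: A_def)
  have A': "bdd_below A" using low[OF _ n0(2)] by (rule bdd_belowI)
  define D where "D = Inf A"
  have "\<exists>d>0. \<forall>s. s \<noteq> 0 \<and> norm (s - 0) < d \<longrightarrow> norm (?m s - D) < e" if e: "e > 0" for e
  proof -
    have "\<forall>\<^sub>F n in sequentially. \<bar>second_diff f t n\<bar> < e"
      using l e by (simp add: tendsto_iff dist_real_def)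
    then obtain n where n: "\<bar>second_diff f t n\<bar> < e" "t + step n \<in> I" "t + - step n \<in> I"
      using eventually_conj[OF _ open_step_eventually[OF I]] by (metis (no_types, lifting) eventually_sequentially le_refl)
    have D: "?m (- step n) \<le> D" "D \<le> ?m (step n)"
      unfolding D_def using cInf_greatest[OF A low[OF _ n(3)]] cInf_lower[OF _ A', of "?m (step n)"] n(2) step_pos[of n]
      by (auto simp: A_def)
    have cI: "convex I" using f by (simp add: convex_on_def)
    have "norm (?m s - D) < e" if s: "s \<noteq> 0" "\<bar>s\<bar> < step n" for s
    proof -
      have "t + s \<in> closed_segment (t + - step n) (t + step n)" using s by (auto simp: closed_segment_eq_real_ivl)
      then have sI: "t + s \<in> I" using closed_segment_subset[OF n(3,2) cI] by blast
      have "?m (- step n) \<le> ?m s" "?m s \<le> ?m (step n)"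
        using convex_slope_mono[OF f I(2) n(3) sI] convex_slope_mono[OF f I(2) sI n(2)] s step_pos[of n] by auto
      then show ?thesis using D n(1) unfolding second_diff_def real_norm_def by linarith
    qed
    then show ?thesis using step_pos[of n] by (intro exI[of _ "step n"]) auto
  qed
  then have "(\<lambda>s. ?m s) \<midarrow>0\<rightarrow> D" by (intro LIM_I) blast
  then show ?thesis unfolding DERIV_def by blast
qed

text \<open>With n the dimension, y + h is the average of the n points obtained from y by moving n
  (h . b) along each axis b. Jensen's inequality then bounds the remainder \<open>r h\<close> from
  above by one-variable remainders, which is why the radii are divided by n. Midpoint convexity
  gives r(h) + r(-h) \<ge> 0, so the upper bound at -h is a lower bound at h.\<close>

lemma convex_frechet_of_partials:
  fixes g :: "'a::euclidean_space \<Rightarrow> real"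
  assumes U: "open U" "y \<in> U" and g: "convex_on U g"
    and d: "\<And>b. b \<in> Basis \<Longrightarrow> ((\<lambda>t. g (y + t *\<^sub>R b)) has_field_derivative D b) (at 0)"
  shows "(g has_derivative (\<lambda>h. (\<Sum>b\<in>Basis. D b *\<^sub>R b) \<bullet> h)) (at y)"
  unfolding has_derivative_at_alt
proof (intro conjI allI impI)
  show "bounded_linear ((\<bullet>) (\<Sum>b\<in>Basis. D b *\<^sub>R b))" by (rule bounded_linear_inner_right)
  fix e :: real assume e: "e > 0"
  define G where "G = (\<Sum>b\<in>Basis. D b *\<^sub>R b)"
  define r where "r h = g (y + h) - g y - G \<bullet> h" for h
  have GB: "G \<bullet> b = D b" if "b \<in> Basis" for b using that by (simp add: G_def inner_sum_left inner_Basis if_distrib cong: if_cong)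
  define n where "n = real (DIM('a))"
  have n: "n \<ge> 1" by (simp add: n_def Suc_leI)
  have "\<exists>d>0. \<forall>t. \<bar>t\<bar> < d \<longrightarrow> \<bar>r (t *\<^sub>R b)\<bar> \<le> e / n * \<bar>t\<bar>" if b: "b \<in> Basis" for b
  proof -
    have "e / n > 0" using e n by simp
    moreover have "((\<lambda>t. g (y + t *\<^sub>R b)) has_derivative (\<lambda>t. D b * t)) (at 0)"
      using d[OF b] by (simp add: has_field_derivative_def)
    ultimately obtain d where "d > 0" "\<And>t. norm (t - 0) < d \<Longrightarrow> norm (g (y + t *\<^sub>R b) - g (y + 0 *\<^sub>R b) - D b * (t - 0)) \<le> e / n * norm (t - 0)"
      unfolding has_derivative_at_alt by blast
    then show ?thesis using GB[OF b] by (intro exI[of _ d]) (auto simp: r_def mult.commute)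
  qed
  then obtain \<delta> where dl: "\<And>b. b \<in> Basis \<Longrightarrow> \<delta> b > 0" "\<And>b t. b \<in> Basis \<Longrightarrow> \<bar>t\<bar> < \<delta> b \<Longrightarrow> \<bar>r (t *\<^sub>R b)\<bar> \<le> e / n * \<bar>t\<bar>"
    by metis
  obtain \<rho> where rho: "\<rho> > 0" "ball y \<rho> \<subseteq> U" using U by (meson openE)
  define m where "m = min \<rho> (Min (\<delta> ` Basis)) / n"
  have m: "m > 0" "n * m \<le> \<rho>" "\<And>b. b \<in> Basis \<Longrightarrow> n * m \<le> \<delta> b"
    using rho(1) dl(1) n by (auto simp: m_def intro: min.coboundedI2 Min_le)
  have up: "r h \<le> e * norm h" and inU: "y + h \<in> U" if h: "norm h < m" for h
  proof -
    have hb: "\<bar>n * (h \<bullet> b)\<bar> < n * m" if "b \<in> Basis" for b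
      using Basis_le_norm[OF that, of h] h n by (simp add: abs_mult)
    have inUb: "y + (n * (h \<bullet> b)) *\<^sub>R b \<in> U" if "b \<in> Basis" for b
      using hb[OF that] m(2) that rho(2) by (auto intro!: subsetD[OF rho(2)] simp: dist_norm)
    show "y + h \<in> U"
    proof (rule subsetD[OF rho(2)])
      have "m \<le> n * m" using n m(1) by simp
      then show "y + h \<in> ball y \<rho>" using h m(2) by (simp add: dist_norm)
    qed
    have s1: "(\<Sum>b\<in>Basis. (1 / n) *\<^sub>R (y + (n * (h \<bullet> b)) *\<^sub>R b)) = y + h"
    proof -
      have "(\<Sum>b\<in>Basis. (1 / n) *\<^sub>R (y + (n * (h \<bullet> b)) *\<^sub>R b)) = (\<Sum>b\<in>(Basis::'a set). (1 / n) *\<^sub>R y) + (\<Sum>b\<in>Basis. (h \<bullet> b) *\<^sub>R b)"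
        using n by (simp add: scaleR_add_right sum.distrib)
      also have "\<dots> = y + h" using n by (simp add: sum_constant_scaleR n_def euclidean_representation)
      finally show ?thesis .
    qed
    have "g (y + h) \<le> (\<Sum>b\<in>Basis. (1 / n) * g (y + (n * (h \<bullet> b)) *\<^sub>R b))"
      using convex_on_sum[OF _ _ g, of Basis "\<lambda>_. 1 / n" "\<lambda>b. y + (n * (h \<bullet> b)) *\<^sub>R b"] inUb n unfolding s1 by (simp add: n_def)
    also have "\<dots> = (\<Sum>b\<in>Basis. (1 / n) * (r ((n * (h \<bullet> b)) *\<^sub>R b) + g y) + D b * (h \<bullet> b))"
      using n by (intro sum.cong refl) (simp add: r_def GB field_simps)
    also have "\<dots> \<le> (\<Sum>b\<in>(Basis::'a set). (1 / n) * (e * norm h + g y) + D b * (h \<bullet> b))"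
    proof (intro sum_mono add_right_mono mult_left_mono)
      fix b :: 'a assume b: "b \<in> Basis"
      have "\<bar>r ((n * (h \<bullet> b)) *\<^sub>R b)\<bar> \<le> e / n * \<bar>n * (h \<bullet> b)\<bar>" by (rule dl(2)[OF b]) (use hb[OF b] m(3)[OF b] in linarith)
      also have "\<dots> = e * \<bar>h \<bullet> b\<bar>" using n by (simp add: abs_mult)
      also have "\<dots> \<le> e * norm h" using Basis_le_norm[OF b, of h] e by simp
      finally show "r ((n * (h \<bullet> b)) *\<^sub>R b) \<le> e * norm h" by simp
    qed (use n in auto)
    also have "\<dots> = e * norm h + g y + G \<bullet> h"
    proof -
      have "G \<bullet> h = (\<Sum>b\<in>Basis. D b * (h \<bullet> b))" by (simp add: G_def inner_sum_left inner_commute[of h])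
      then show ?thesis using n by (simp add: sum.distrib n_def)
    qed
    finally show "r h \<le> e * norm h" by (simp add: r_def)
  qed
  have low: "- (e * norm h) \<le> r h" if h: "norm h < m" for h
  proof -
    have mid: "(1 - 1/2) *\<^sub>R (y + h) + (1/2) *\<^sub>R (y + - h) = y" by (simp add: algebra_simps flip: scaleR_left_distrib)
    have "g y \<le> (1 - 1/2) * g (y + h) + 1/2 * g (y + - h)"
      using convex_onD[OF g, of "1/2" "y + h" "y + - h"] inU[of h] inU[of "- h"] h unfolding mid by simp
    then have "0 \<le> r h + r (- h)" by (simp add: r_def)
    then show ?thesis using up[of "- h"] h by simp
  qed
  show "\<exists>d>0. \<forall>z. norm (z - y) < d \<longrightarrow> norm (g z - g y - G \<bullet> (z - y)) \<le> e * norm (z - y)"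
  proof (intro exI[of _ m] conjI allI impI)
    fix z assume "norm (z - y) < m"
    then show "norm (g z - g y - G \<bullet> (z - y)) \<le> e * norm (z - y)" using up[of "z - y"] low[of "z - y"] by (simp add: r_def abs_le_iff)
  qed (rule m)
qed

lemma convex_on_line:
  assumes "convex_on U g"
  shows "convex_on {t. y + t *\<^sub>R b \<in> U} (\<lambda>t. g (y + t *\<^sub>R b))"
proof (rule convex_onI)
  have e: "y + ((1 - u) *\<^sub>R s + u *\<^sub>R t) *\<^sub>R b = (1 - u) *\<^sub>R (y + s *\<^sub>R b) + u *\<^sub>R (y + t *\<^sub>R b)" for u s t
    by (simp add: algebra_simps)
  show "g (y + ((1 - u) *\<^sub>R s + u *\<^sub>R t) *\<^sub>R b) \<le> (1 - u) * g (y + s *\<^sub>R b) + u * g (y + t *\<^sub>R b)"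
    if "0 < u" "u < 1" "s \<in> {t. y + t *\<^sub>R b \<in> U}" "t \<in> {t. y + t *\<^sub>R b \<in> U}" for u s t
    unfolding e using that by (intro convex_onD[OF assms]) auto
  have "convex U" using assms by (simp add: convex_on_def)
  then show "convex {t. y + t *\<^sub>R b \<in> U}"
  proof (intro convexI)
    fix s t u v :: real
    assume *: "s \<in> {t. y + t *\<^sub>R b \<in> U}" "t \<in> {t. y + t *\<^sub>R b \<in> U}" "0 \<le> u" "0 \<le> v" "u + v = 1"
    then have "y + ((1 - v) *\<^sub>R s + v *\<^sub>R t) *\<^sub>R b \<in> U"
      unfolding e using \<open>convex U\<close> by (auto simp: convex_alt)
    moreover have "u = 1 - v" using * by simp
    ultimately show "u *\<^sub>R s + v *\<^sub>R t \<in> {t. y + t *\<^sub>R b \<in> U}" by simp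
  qed
qed

theorem convex_differentiable_AE:
  fixes g :: "'a::euclidean_space \<Rightarrow> real"
  assumes U: "open U" and g: "convex_on U g"
  obtains G N where "G \<in> borel_measurable borel" "N \<in> null_sets lborel"
    "\<And>y. y \<in> U - N \<Longrightarrow> (g has_derivative (\<lambda>h. G y \<bullet> h)) (at y)"
proof -
  \<comment> \<open>Cut off outside U to have a function that is Borel on the whole space. As U is
    open, the small difference quotients at its points do not see the cut.\<close>
  define h where "h y = indicator U y *\<^sub>R g y" for y
  have hm[measurable]: "h \<in> borel_measurable borel" unfolding h_def
    using U g by (intro borel_measurable_continuous_on_indicator convex_on_continuous) auto
  define sd where "sd b n y = (h (y + step n *\<^sub>R b) - h y) / step n - (h (y + (- step n) *\<^sub>R b) - h y) / (- step n)" for b n and y :: 'a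
  have [measurable]: "sd b n \<in> borel_measurable borel" for b n unfolding sd_def by measurable
  define N where "N b = {y \<in> U. \<not> (\<lambda>n. sd b n y) \<longlonglongrightarrow> 0}" for b
  \<comment> \<open>Convergence is expressed with countable quantifiers only, from which the
    measurability of \<open>N b\<close> can be read off.\<close>
  have lim_iff: "X \<longlonglongrightarrow> 0 \<longleftrightarrow> (\<forall>k. \<exists>m. \<forall>n. n \<ge> m \<longrightarrow> \<bar>X n\<bar> < step k)" for X :: "nat \<Rightarrow> real"
  proof
    show "X \<longlonglongrightarrow> 0 \<Longrightarrow> \<forall>k. \<exists>m. \<forall>n. n \<ge> m \<longrightarrow> \<bar>X n\<bar> < step k" using step_pos by (auto simp: LIMSEQ_def dist_real_def)
    assume *: "\<forall>k. \<exists>m. \<forall>n. n \<ge> m \<longrightarrow> \<bar>X n\<bar> < step k"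
    show "X \<longlonglongrightarrow> 0"
    proof (rule LIMSEQ_I)
      fix r :: real assume "0 < r"
      then obtain k where "step k < r" using step_eventually by (auto simp: eventually_sequentially)
      then show "\<exists>no. \<forall>n\<ge>no. norm (X n - 0) < r" using * by (metis diff_zero order_less_trans real_norm_def)
    qed
  qed
  have N: "N b \<in> sets borel" for b
  proof -
    have [measurable]: "U \<in> sets borel" using U by simp
    have "Measurable.pred borel (\<lambda>y. y \<in> U \<and> \<not> (\<forall>k. \<exists>m. \<forall>n. n \<ge> m \<longrightarrow> \<bar>sd b n y\<bar> < step k))" by measurable
    then show ?thesis unfolding N_def lim_iff by (simp add: pred_def)
  qed
  have I: "open {t. y + t *\<^sub>R b \<in> U}" for y b
    using open_vimage[OF U, of "\<lambda>t. y + t *\<^sub>R b"] by (simp add: continuous_intros vimage_def)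
  have sd_eq: "(\<lambda>n. sd b n (y + t *\<^sub>R b)) \<longlonglongrightarrow> 0 \<longleftrightarrow> second_diff (\<lambda>t. g (y + t *\<^sub>R b)) t \<longlonglongrightarrow> 0" if "y + t *\<^sub>R b \<in> U" for y t b
  proof (rule tendsto_cong)
    show "\<forall>\<^sub>F n in sequentially. sd b n (y + t *\<^sub>R b) = second_diff (\<lambda>t. g (y + t *\<^sub>R b)) t n"
      using open_step_eventually[OF I[of y b], of t, simplified, OF that]
      by eventually_elim (use that in \<open>simp add: sd_def second_diff_def h_def algebra_simps\<close>)
  qed
  have null: "N b \<in> null_sets lborel" for b
  proof (rule null_set_of_countable_lines[OF N])
    fix y
    have "{t. y + t *\<^sub>R b \<in> N b} = {t \<in> {t. y + t *\<^sub>R b \<in> U}. \<not> second_diff (\<lambda>t. g (y + t *\<^sub>R b)) t \<longlonglongrightarrow> 0}"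
      unfolding N_def using sd_eq by blast
    then show "countable {t. y + t *\<^sub>R b \<in> N b}" using convex_kinks_countable[OF convex_on_line[OF g] I] by simp
  qed
  \<comment> \<open>\<open>lim\<close> is taken at every point, whether or not the limit exists,
    which makes \<open>G\<close> Borel everywhere; off the exceptional set in U it is the vector of
    partial derivatives.\<close>
  define G where "G y = (\<Sum>b\<in>Basis. lim (\<lambda>n. (h (y + step n *\<^sub>R b) - h y) / step n) *\<^sub>R b)" for y :: 'a
  have Gm: "G \<in> borel_measurable borel" unfolding G_def by measurable
  have der: "(g has_derivative (\<lambda>h. G y \<bullet> h)) (at y)" if y: "y \<in> U - (\<Union>b\<in>Basis. N b)" for y
  proof -
    have "\<exists>D. ((\<lambda>t. g (y + t *\<^sub>R b)) has_field_derivative D) (at 0)" if b: "b \<in> Basis" for b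
    proof -
      have "y + 0 *\<^sub>R b \<in> U" "(\<lambda>n. sd b n (y + 0 *\<^sub>R b)) \<longlonglongrightarrow> 0" using y b by (auto simp: N_def)
      then show ?thesis
        using convex_differentiable_of_second_diff[OF convex_on_line[OF g] I] sd_eq by blast
    qed
    then obtain D where D: "\<And>b. b \<in> Basis \<Longrightarrow> ((\<lambda>t. g (y + t *\<^sub>R b)) has_field_derivative D b) (at 0)" by metis
    have "lim (\<lambda>n. (h (y + step n *\<^sub>R b) - h y) / step n) = D b" if b: "b \<in> Basis" for b
    proof (rule limI)
      have "(\<lambda>n. (g (y + (0 + step n) *\<^sub>R b) - g (y + 0 *\<^sub>R b)) / step n) \<longlonglongrightarrow> D b"
      proof -
        have "(\<lambda>s. (g (y + (0 + s) *\<^sub>R b) - g (y + 0 *\<^sub>R b)) / s) \<midarrow>0\<rightarrow> D b" using D[OF b] unfolding DERIV_def .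
        moreover have "(\<forall>n. step n \<noteq> 0) \<and> step \<longlonglongrightarrow> 0" using step_tendsto less_imp_neq[OF step_pos] by simp
        ultimately show ?thesis using LIMSEQ_SEQ_conv[THEN iffD2, THEN spec, THEN mp] by blast
      qed
      moreover have "\<forall>\<^sub>F n in sequentially. (g (y + (0 + step n) *\<^sub>R b) - g (y + 0 *\<^sub>R b)) / step n = (h (y + step n *\<^sub>R b) - h y) / step n"
        using open_step_eventually[OF I[of y b], of 0, simplified] y
        by (auto elim!: eventually_mono simp: h_def)
      ultimately show "(\<lambda>n. (h (y + step n *\<^sub>R b) - h y) / step n) \<longlonglongrightarrow> D b" by (rule Lim_transform_eventually)
    qed
    then have "G y = (\<Sum>b\<in>Basis. D b *\<^sub>R b)" unfolding G_def by simp
    then show ?thesis using convex_frechet_of_partials[OF U _ g D] y by simp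
  qed
  have "(\<Union>b\<in>Basis. N b) \<in> null_sets lborel" using null by (intro null_sets_UN') (auto intro: countable_finite)
  then show ?thesis using that Gm der by blast
qed

section \<open>Legendre transforms and gradients\<close>

lemma legendre_ge: "ereal (x \<bullet> y - \<phi> x) \<le> legendre \<phi> y"
  unfolding legendre_def by (rule SUP_upper) simp

lemma legendre_lsc: "lsc_fun (legendre \<phi>)"
  unfolding lsc_fun_def le_Liminf_iff
proof (intro allI impI)
  fix x c assume "c < legendre \<phi> x"
  then obtain a where a: "c < ereal (a \<bullet> x - \<phi> a)" unfolding legendre_def less_SUP_iff by blast
  have "((\<lambda>y. ereal (a \<bullet> y - \<phi> a)) \<longlongrightarrow> ereal (a \<bullet> x - \<phi> a)) (at x)"
    by (intro tendsto_intros)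
  then have "\<forall>\<^sub>F y in at x. c < ereal (a \<bullet> y - \<phi> a)" using a by (rule order_tendstoD)
  then show "\<forall>\<^sub>F y in at x. c < legendre \<phi> y"
    by eventually_elim (use legendre_ge less_le_trans in blast)
qed

lemma legendre_convex: "convex_ext (legendre \<phi>)"
  unfolding convex_ext_def
proof (intro allI impI)
  fix x y :: 'a and t :: real assume t: "0 \<le> t \<and> t \<le> 1"
  show "legendre \<phi> ((1 - t) *\<^sub>R x + t *\<^sub>R y) \<le> ereal (1 - t) * legendre \<phi> x + ereal t * legendre \<phi> y"
    unfolding legendre_def[of \<phi> "(1 - t) *\<^sub>R x + t *\<^sub>R y"]
  proof (rule SUP_least)
    fix a
    have "ereal (a \<bullet> ((1 - t) *\<^sub>R x + t *\<^sub>R y) - \<phi> a) = ereal (1 - t) * ereal (a \<bullet> x - \<phi> a) + ereal t * ereal (a \<bullet> y - \<phi> a)"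
      by (simp add: inner_add_right algebra_simps)
    also have "\<dots> \<le> ereal (1 - t) * legendre \<phi> x + ereal t * legendre \<phi> y"
      using t by (intro add_mono ereal_mult_left_mono legendre_ge) auto
    finally show "ereal (a \<bullet> ((1 - t) *\<^sub>R x + t *\<^sub>R y) - \<phi> a) \<le> ereal (1 - t) * legendre \<phi> x + ereal t * legendre \<phi> y" .
  qed
qed

lemma convex_expansion_legendre:
  fixes \<phi> :: "'a::euclidean_space \<Rightarrow> real"
  assumes "convex_on UNIV (\<lambda>x. (norm x)\<^sup>2 / 2 - \<phi> x)" "legendre \<phi> y0 \<noteq> \<infinity>"
  shows "convex_expansion (legendre \<phi>)"
  unfolding convex_expansion_def proper_fun_def
proof (intro conjI allI exI)
  show "legendre \<phi> x \<noteq> - \<infinity>" for x using legendre_ge[of 0 x \<phi>] by auto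
qed (use assms convex_imp_hess_le_id legendre_lsc legendre_convex in auto)

text \<open>Frechet differentiability makes approximate maximizers of \<open>x \<mapsto> x \<bullet> z - \<phi> x\<close>, for \<open>z\<close> near \<open>y\<close>,
  converge to the gradient at \<open>y\<close>.\<close>

lemma approx_maximizer_near_gradient:
  fixes \<phi> :: "'a::euclidean_space \<Rightarrow> real"
  assumes g: "has_gradient (legendre \<phi>) y g" and e: "\<epsilon> > 0"
  obtains \<delta> where "\<delta> > 0"
    "\<And>z x. norm (z - y) < \<delta> \<Longrightarrow> legendre \<phi> z \<le> ereal (x \<bullet> z - \<phi> x + \<delta>) \<Longrightarrow> norm (x - g) < \<epsilon>"
proof -
  define p where "p z = real_of_ereal (legendre \<phi> z)" for z
  have "\<forall>\<^sub>F z in nhds y. \<bar>legendre \<phi> z\<bar> \<noteq> \<infinity>" using g by (simp add: has_gradient_def)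
  then obtain r0 where r0: "r0 > 0" "\<And>z. dist z y < r0 \<Longrightarrow> \<bar>legendre \<phi> z\<bar> \<noteq> \<infinity>"
    unfolding eventually_nhds_metric by blast
  have pe: "legendre \<phi> z = ereal (p z)" if "norm (z - y) < r0" for z
    using r0(2)[of z] that by (simp add: p_def ereal_real' dist_norm)
  have "(p has_derivative (\<lambda>h. g \<bullet> h)) (at y)" using g by (simp add: has_gradient_def p_def[abs_def])
  then obtain d where d: "d > 0" "\<And>w. norm (w - y) < d \<Longrightarrow> \<bar>p w - p y - g \<bullet> (w - y)\<bar> \<le> \<epsilon> / 8 * norm (w - y)"
    unfolding has_derivative_at_alt using e by (metis real_norm_def zero_less_divide_iff zero_less_numeral)
  define r where "r = min d r0 / 4"
  have r: "r > 0" "2 * r < d" "2 * r < r0" using d(1) r0(1) by (auto simp: r_def min_def)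
  \<comment> \<open>The Taylor errors at w and z are at most 2 r \<epsilon>/8 and r \<epsilon>/8,
    and the slack of the maximizer is at most r \<epsilon>/8; together they stay within r
    \<epsilon>/2.\<close>
  define \<delta> where "\<delta> = min r (\<epsilon> / 8 * r)"
  have dl: "\<delta> > 0" "\<delta> \<le> r" "\<delta> \<le> \<epsilon> / 8 * r" using r e by (auto simp: \<delta>_def)
  have "norm (x - g) < \<epsilon>" if z: "norm (z - y) < \<delta>" and le: "legendre \<phi> z \<le> ereal (x \<bullet> z - \<phi> x + \<delta>)" for z x
  proof (cases "x = g")
    case False
    \<comment> \<open>The transform is tested a distance r away from z in the direction of x - g,
      where the affine minorant given by x exceeds the first order expansion by about r |x -
      g|.\<close>
    define u where "u = (1 / norm (x - g)) *\<^sub>R (x - g)"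
    have nu: "norm u = 1" using False by (simp add: u_def)
    have xu: "(x - g) \<bullet> u = norm (x - g)" using False by (simp add: u_def dot_square_norm power2_eq_square)
    define w where "w = z + r *\<^sub>R u"
    have zy: "norm (z - y) \<le> r" using z dl by simp
    have "norm (w - y) \<le> norm (z - y) + norm (r *\<^sub>R u)" unfolding w_def using norm_triangle_ineq[of "z - y" "r *\<^sub>R u"] by (simp add: algebra_simps)
    then have wy: "norm (w - y) \<le> 2 * r" using zy nu r by simp
    have "\<bar>p w - p y - g \<bullet> (w - y)\<bar> \<le> \<epsilon> / 8 * norm (w - y)" using d(2) wy r by simp
    also have "\<dots> \<le> \<epsilon> / 8 * (2 * r)" using wy e by (intro mult_left_mono) auto
    finally have 1: "p w \<le> p y + g \<bullet> (w - y) + \<epsilon> / 8 * (2 * r)" by linarith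
    have "\<bar>p z - p y - g \<bullet> (z - y)\<bar> \<le> \<epsilon> / 8 * norm (z - y)" using d(2) zy r by simp
    also have "\<dots> \<le> \<epsilon> / 8 * r" using zy e by (intro mult_left_mono) auto
    finally have 2: "p z \<ge> p y + g \<bullet> (z - y) - \<epsilon> / 8 * r" by linarith
    have 3: "x \<bullet> w - \<phi> x \<le> p w" using legendre_ge[of x w \<phi>] pe[of w] wy r by simp
    have 4: "p z \<le> x \<bullet> z - \<phi> x + \<delta>" using le pe[of z] zy r by simp
    have "r * norm (x - g) = (x \<bullet> w - x \<bullet> z) - (g \<bullet> (w - y) - g \<bullet> (z - y))"
      unfolding xu[symmetric] w_def by (simp add: algebra_simps inner_add_right inner_diff_left inner_diff_right)
    also have "\<dots> \<le> r * (\<epsilon> / 2)" using 1 2 3 4 dl(3) by (simp add: field_simps)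
    finally have "norm (x - g) \<le> \<epsilon> / 2" using r(1) by simp
    then show ?thesis using e by simp
  qed (use e in simp)
  then show ?thesis using that dl(1) by blast
qed

text \<open>Every maximizing sequence of x . y - \<phi>(x) converges to the gradient, so by
  continuity of \<phi> the supremum is attained there.\<close>

lemma fenchel_equality_at_gradient:
  fixes \<phi> :: "'a::euclidean_space \<Rightarrow> real"
  assumes c: "continuous_on UNIV \<phi>" and g: "has_gradient (legendre \<phi>) y g"
  shows "legendre \<phi> y = ereal (g \<bullet> y - \<phi> g)"
proof -
  have "\<bar>legendre \<phi> y\<bar> \<noteq> \<infinity>" using g eventually_nhds_x_imp_x[of "\<lambda>z. \<bar>legendre \<phi> z\<bar> \<noteq> \<infinity>" y] by (simp add: has_gradient_def)
  then obtain p where p: "legendre \<phi> y = ereal p" by (metis ereal_real')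
  have "p \<le> g \<bullet> y - \<phi> g"
  proof (rule field_le_epsilon)
    fix e :: real assume e: "e > 0"
    have "continuous_on UNIV (\<lambda>x. x \<bullet> y - \<phi> x)" by (intro continuous_intros c)
    then have "isCont (\<lambda>x. x \<bullet> y - \<phi> x) g" by (simp add: continuous_on_eq_continuous_at)
    then obtain d where d: "d > 0" "\<And>x. norm (x - g) < d \<Longrightarrow> \<bar>(x \<bullet> y - \<phi> x) - (g \<bullet> y - \<phi> g)\<bar> < e / 2"
      unfolding continuous_at_eps_delta dist_norm using e by (metis half_gt_zero real_norm_def)
    obtain \<delta> where dl: "\<delta> > 0" "\<And>z x. norm (z - y) < \<delta> \<Longrightarrow> legendre \<phi> z \<le> ereal (x \<bullet> z - \<phi> x + \<delta>) \<Longrightarrow> norm (x - g) < d"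
      using approx_maximizer_near_gradient[OF g d(1)] by blast
    define m where "m = min \<delta> (e / 2)"
    have "ereal (p - m) < legendre \<phi> y" using dl(1) e by (simp add: p m_def)
    then obtain x where x: "ereal (p - m) < ereal (x \<bullet> y - \<phi> x)" unfolding legendre_def less_SUP_iff by blast
    then have "p \<le> x \<bullet> y - \<phi> x + \<delta>" by (simp add: m_def)
    then have "norm (x - g) < d" using dl(2)[of y x] dl(1) p by simp
    note d(2)[OF this]
    moreover have "p - m < x \<bullet> y - \<phi> x" "m \<le> e / 2" using x by (simp_all add: m_def)
    ultimately show "p \<le> g \<bullet> y - \<phi> g + e" by linarith
  qed
  then show ?thesis using legendre_ge[of g y \<phi>] p by simp
qed

section \<open>From a small Fenchel gap to an image measure\<close>

lemma inner_compact_approx: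
  fixes M :: "'a::euclidean_space measure"
  assumes "finite_measure M" "sets M = sets borel" "B \<in> sets borel" "e > 0"
  obtains K where "compact K" "K \<subseteq> B" "measure M (B - K) < e"
proof -
  interpret finite_measure M by fact
  have "emeasure M B = (SUP K\<in>{K. K \<subseteq> B \<and> compact K}. emeasure M K)"
    using assms by (intro inner_regular) auto
  moreover have "ennreal (measure M B - e) < emeasure M B" if "measure M B > 0"
    using assms(4) that by (simp add: emeasure_eq_measure ennreal_lessI)
  ultimately have "\<exists>K. compact K \<and> K \<subseteq> B \<and> measure M B - e < measure M K"
  proof (cases "measure M B > 0")
    case True
    then have "ennreal (measure M B - e) < (SUP K\<in>{K. K \<subseteq> B \<and> compact K}. emeasure M K)"
      using \<open>emeasure M B = _\<close> \<open>_ \<Longrightarrow> ennreal (measure M B - e) < emeasure M B\<close> by simp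
    then obtain K where "K \<subseteq> B" "compact K" "ennreal (measure M B - e) < emeasure M K"
      unfolding less_SUP_iff by blast
    then show ?thesis by (auto simp: emeasure_eq_measure ennreal_less_iff intro: exI[of _ K])
      (metis ennreal_less_iff leI ennreal_neg measure_nonneg not_le order_less_le_trans)
  next
    case False
    then show ?thesis using assms(4) by (intro exI[of _ "{}"]) (auto simp: not_less)
  qed
  then obtain K where K: "compact K" "K \<subseteq> B" "measure M B - e < measure M K" by blast
  then have "measure M (B - K) = measure M B - measure M K"
    using assms by (intro finite_measure_Diff) (auto simp: compact_imp_closed)
  with K that show ?thesis by simp
qed

text \<open>The value \<open>\<phi>\<^sup>*(y)\<close> is written as \<open>G y \<bullet> y - \<phi> (G y)\<close>, which is real-valued and measurable.\<close>

abbreviation fenchel_gap :: "('a::euclidean_space \<Rightarrow> real) \<Rightarrow> ('a \<Rightarrow> 'a) \<Rightarrow> 'a \<times> 'a \<Rightarrow> real" where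
  "fenchel_gap \<phi> G z \<equiv> \<phi> (fst z) + (G (snd z) \<bullet> snd z - \<phi> (G (snd z))) - fst z \<bullet> snd z"

text \<open>The gap threshold that forces x close to the gradient depends on y, but it can be chosen
  uniformly for all points near y. On a compact set of nearly full measure finitely many such
  neighbourhoods suffice, which gives a single threshold \<open>d\<close> and turns smallness of the
  gap in probability into convergence in probability.\<close>

lemma image_measure_of_small_gap:
  fixes \<xi> \<nu> :: "'a::euclidean_space measure"
  assumes nu: "prob_space \<nu>" and snu: "sets \<nu> = sets borel" and G: "G \<in> borel_measurable \<nu>"
    and xi: "prob_space \<xi>" "sets \<xi> = sets borel"
    and c: "continuous_on UNIV \<phi>" and g: "AE y in \<nu>. has_gradient (legendre \<phi>) y (G y)"
    and gap: "\<And>\<delta> \<eta>. \<delta> > 0 \<Longrightarrow> \<eta> > 0 \<Longrightarrow> \<exists>\<pi>. coupling \<xi> \<nu> \<pi> \<and>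
      measure \<pi> {z. fenchel_gap \<phi> G z \<ge> \<delta>} \<le> \<eta>"
  shows "distr \<nu> borel G = \<xi>"
proof (rule marginal_eq_image[OF nu snu G xi])
  fix \<epsilon> \<eta> :: real assume e: "\<epsilon> > 0" and eta: "\<eta> > 0"
  interpret N: prob_space \<nu> by fact
  have sp: "space \<nu> = UNIV" using sets_eq_imp_space_eq[OF snu] by simp
  have Gb: "G \<in> borel_measurable borel" using G snu measurable_cong_sets by blast
  obtain Z where Z: "{y. \<not> has_gradient (legendre \<phi>) y (G y)} \<subseteq> Z" "emeasure \<nu> Z = 0" "Z \<in> sets \<nu>"
    using AE_E[OF g] sp by auto
  obtain K where K: "compact K" "K \<subseteq> UNIV - Z" "measure \<nu> ((UNIV - Z) - K) < \<eta> / 2"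
    using inner_compact_approx[OF N.finite_measure_axioms snu, of "UNIV - Z" "\<eta> / 2"] Z(3) snu eta by (metis half_gt_zero sets.compl_sets space_borel)
  have nK: "measure \<nu> (- K) \<le> \<eta> / 2"
  proof -
    have Kb: "K \<in> sets \<nu>" using K(1) snu by (simp add: compact_imp_closed)
    have "- K = ((UNIV - Z) - K) \<union> Z" using K(2) by auto
    moreover have "(UNIV - Z) - K \<in> sets \<nu>" using Z(3) Kb sp by (metis sets.Diff sets.top)
    ultimately have "measure \<nu> (- K) \<le> measure \<nu> ((UNIV - Z) - K) + measure \<nu> Z" using Z(3) by (simp add: measure_Un_le)
    then show ?thesis using K(3) Z(2) by (simp add: measure_def)
  qed
  have hg: "has_gradient (legendre \<phi>) y (G y)" if "y \<in> K" for y using that K(2) Z(1) by blast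
  have feq: "legendre \<phi> y = ereal (G y \<bullet> y - \<phi> (G y))" if "y \<in> K" for y
    by (rule fenchel_equality_at_gradient[OF c hg[OF that]])
  have "\<exists>\<delta>>0. \<forall>z x. norm (z - y) < \<delta> \<longrightarrow> legendre \<phi> z \<le> ereal (x \<bullet> z - \<phi> x + \<delta>) \<longrightarrow> norm (x - G y) < \<epsilon> / 2" if "y \<in> K" for y
    using approx_maximizer_near_gradient[OF hg[OF that], of "\<epsilon> / 2"] e by (metis half_gt_zero)
  then obtain \<delta> where dl: "\<And>y. y \<in> K \<Longrightarrow> \<delta> y > 0"
      "\<And>y z x. y \<in> K \<Longrightarrow> norm (z - y) < \<delta> y \<Longrightarrow> legendre \<phi> z \<le> ereal (x \<bullet> z - \<phi> x + \<delta> y) \<Longrightarrow> norm (x - G y) < \<epsilon> / 2"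
    by metis
  have "K \<subseteq> (\<Union>y\<in>K. ball y (\<delta> y))" using dl(1) by force
  then obtain F where F: "F \<subseteq> K" "finite F" "K \<subseteq> (\<Union>y\<in>F. ball y (\<delta> y))"
    using compactE_image[OF K(1), of K "\<lambda>y. ball y (\<delta> y)"] by blast
  \<comment> \<open>The extra element 1 keeps the minimum defined when \<open>F\<close> is
    empty.\<close>
  define d where "d = Min (insert 1 (\<delta> ` F))"
  have d: "d > 0" "\<And>y. y \<in> F \<Longrightarrow> d \<le> \<delta> y" using F dl(1) by (auto simp: d_def)
  \<comment> \<open>Both x and \<open>G z\<close> are approximate maximizers at z, the latter an
    exact one, so each is within \<epsilon>/2 of the gradient at the centre y of the covering
    ball.\<close>
  have key: "norm (x - G z) < \<epsilon>" if z: "z \<in> K" and lt: "\<phi> x + (G z \<bullet> z - \<phi> (G z)) - x \<bullet> z < d" for x z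
  proof -
    obtain y where y: "y \<in> F" "norm (z - y) < \<delta> y" using F(3) z by (auto simp: dist_norm norm_minus_commute)
    have yK: "y \<in> K" using y F by blast
    have "norm (x - G y) < \<epsilon> / 2" using lt d(2)[OF y(1)] by (intro dl(2)[OF yK y(2)]) (simp add: feq[OF z])
    moreover have "norm (G z - G y) < \<epsilon> / 2" using dl(1)[OF yK] by (intro dl(2)[OF yK y(2)]) (simp add: feq[OF z])
    ultimately show ?thesis using norm_triangle_ineq4[of "x - G y" "G z - G y"] by simp
  qed
  obtain \<pi> where pi: "coupling \<xi> \<nu> \<pi>" and le: "measure \<pi> {z. fenchel_gap \<phi> G z \<ge> d} \<le> \<eta> / 2"
    using gap[OF d(1), of "\<eta> / 2"] eta by auto
  note cf = coupling_facts[OF pi nu]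
  interpret P: prob_space \<pi> by (rule cf)
  have [measurable]: "\<phi> \<in> borel_measurable borel" using c by (rule borel_measurable_continuous_onI)
  have [measurable]: "fst \<in> borel_measurable \<pi>" "snd \<in> borel_measurable \<pi>" using cf by auto
  have [measurable]: "(\<lambda>z. G (snd z)) \<in> borel_measurable \<pi>" using measurable_compose[OF cf(5) Gb] .
  let ?A = "{z. fenchel_gap \<phi> G z \<ge> d}"
  have "{z\<in>space \<pi>. fenchel_gap \<phi> G z \<ge> d} \<in> sets \<pi>" by measurable
  then have A: "?A \<in> sets \<pi>" using cf(2) by simp
  have B: "snd -` (- K) \<in> sets \<pi>" using measurable_sets[OF cf(5), of "- K"] K(1) cf(2) by (simp add: compact_imp_closed open_Compl)
  have "\<nu> = distr \<pi> borel snd" using pi by (simp add: coupling_def)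
  then have "measure \<pi> (snd -` (- K)) = measure \<nu> (- K)"
    using measure_distr[OF cf(5), of "- K"] K(1) cf(2) by (simp add: compact_imp_closed open_Compl)
  then have mB: "measure \<pi> (snd -` (- K)) \<le> \<eta> / 2" using nK by simp
  have "measure \<pi> {z. norm (fst z - G (snd z)) \<ge> \<epsilon>} \<le> measure \<pi> (?A \<union> snd -` (- K))"
  proof (intro P.finite_measure_mono sets.Un A B subsetI)
    fix z assume "z \<in> {z. norm (fst z - G (snd z)) \<ge> \<epsilon>}"
    then show "z \<in> ?A \<union> snd -` (- K)" using key[of "snd z" "fst z"] by force
  qed
  also have "\<dots> \<le> measure \<pi> ?A + measure \<pi> (snd -` (- K))" by (intro measure_Un_le A B)
  finally show "\<exists>\<pi>. coupling \<xi> \<nu> \<pi> \<and> measure \<pi> {z. norm (fst z - G (snd z)) \<ge> \<epsilon>} \<le> \<eta>"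
    using pi le mB by (intro exI[of _ \<pi>]) auto
qed

section \<open>Integrating convex functions against measures with finite second moment\<close>

lemma convex_lower_bound:
  fixes f :: "'a::euclidean_space \<Rightarrow> real"
  assumes f: "convex_on UNIV f"
  obtains C where "C \<ge> 0" "\<And>x. f x \<ge> - (C * (1 + norm x))"
proof -
  have "continuous_on (sphere 0 1) f" by (rule continuous_on_subset[OF convex_on_continuous[OF open_UNIV f]]) simp
  then have "bounded (f ` sphere 0 1)" by (intro compact_imp_bounded compact_continuous_image) auto
  then obtain M where M: "M > 0" "\<And>x. norm x = 1 \<Longrightarrow> \<bar>f x\<bar> \<le> M" unfolding bounded_pos by auto
  define C where "C = \<bar>f 0\<bar> + M"
  have "f x \<ge> - (C * (1 + norm x))" for x
  proof (cases "x = 0")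
    case True
    then show ?thesis using M(1) by (simp add: C_def)
  next
    case False
    have p: "1 + norm x > 0" by (simp add: add_pos_nonneg)
    \<comment> \<open>0 is the combination of x with weight t and of the unit vector opposite to x
      with weight 1 - t; boundedness of f on the unit sphere then limits how negative f x can
      be.\<close>
    define t where "t = 1 / (1 + norm x)"
    have t: "0 < t" "t \<le> 1" "1 - t = t * norm x" using p unfolding t_def by (simp_all add: field_simps)
    define u where "u = - ((1 / norm x) *\<^sub>R x)"
    have u: "norm u = 1" using False by (simp add: u_def)
    have "(1 - t) *\<^sub>R u + t *\<^sub>R x = 0" unfolding t(3) using False by (simp add: u_def)
    then have "f 0 \<le> (1 - t) * f u + t * f x" using convex_onD[OF f, of t u x] t by simp
    also have "(1 - t) * f u \<le> t * norm x * M" unfolding t(3) using M(2)[OF u] t(1) by (intro mult_left_mono) auto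
    finally have "t * (- f x) \<le> t * (norm x * M) - f 0" by (simp add: algebra_simps)
    also have "\<dots> = t * (norm x * M - (1 + norm x) * f 0)"
    proof -
      have "t * (1 + norm x) = 1" using p by (simp add: t_def)
      then show ?thesis by (metis mult.assoc mult_1 right_diff_distrib)
    qed
    finally have "- f x \<le> norm x * M - (1 + norm x) * f 0" using t(1) by (metis mult_le_cancel_left_pos)
    also have "\<dots> \<le> norm x * M + (1 + norm x) * \<bar>f 0\<bar>"
      using mult_left_mono[of "- f 0" "\<bar>f 0\<bar>" "1 + norm x"] by simp
    also have "\<dots> \<le> C * (1 + norm x)" using M(1) by (simp add: C_def algebra_simps)
    finally show ?thesis by simp
  qed
  then show ?thesis using that[of C] M(1) by (auto simp: C_def)
qed

lemma norm_le_one_plus_sq: "norm x \<le> 1 + (norm x)\<^sup>2"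
  using sum_squares_bound[of "norm x" 1] norm_ge_zero[of x] unfolding one_power2 by linarith

lemma P2_facts:
  assumes "P2 M"
  shows "prob_space M" "sets M = sets borel" "space M = UNIV" "integrable M (\<lambda>x. (norm x)\<^sup>2)"
    "integrable M norm" "integrable M (\<lambda>x. 1 + (norm x)\<^sup>2)"
proof -
  show p: "prob_space M" and s: "sets M = sets borel" and i: "integrable M (\<lambda>x. (norm x)\<^sup>2)"
    using assms by (auto simp: P2_def)
  show "space M = UNIV" using sets_eq_imp_space_eq[OF s] by simp
  interpret prob_space M by (rule p)
  show i2: "integrable M (\<lambda>x. 1 + (norm x)\<^sup>2)" using i by (intro Bochner_Integration.integrable_add) auto
  show "integrable M norm"
  proof (rule Bochner_Integration.integrable_bound[OF i2])
    show "norm \<in> borel_measurable M" by (simp add: measurable_cong_sets[OF s refl])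
    show "AE x in M. norm (norm x) \<le> norm (1 + (norm x)\<^sup>2)" by (auto intro!: AE_I2 norm_le_one_plus_sq)
  qed
qed

lemma P2_integrable:
  fixes f :: "'a::euclidean_space \<Rightarrow> real"
  assumes P: "P2 M" and f: "f \<in> borel_measurable borel" and b: "\<And>x. \<bar>f x\<bar> \<le> C * (1 + (norm x)\<^sup>2)"
  shows "integrable M f"
proof (rule Bochner_Integration.integrable_bound[OF integrable_mult_right[OF P2_facts(6)[OF P], of C]])
  show "f \<in> borel_measurable M" using f measurable_cong_sets[OF P2_facts(2)[OF P] refl] by blast
  show "AE x in M. norm (f x) \<le> norm (C * (1 + (norm x)\<^sup>2))" by (rule AE_I2) (use b in \<open>auto intro: order_trans[OF _ abs_ge_self]\<close>)
qed

text \<open>Thus, under finite second moments, extended integrals of convex functions always exist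
  and +\<infinity> is the only infinite value.\<close>

lemma convex_neg_part_finite:
  fixes f :: "'a::euclidean_space \<Rightarrow> real"
  assumes P: "P2 M" and f: "convex_on UNIV f"
  shows "(\<integral>\<^sup>+x. ennreal (- f x) \<partial>M) < \<infinity>"
proof -
  obtain C where C: "C \<ge> 0" "\<And>x. f x \<ge> - (C * (1 + norm x))" using convex_lower_bound[OF f] by blast
  interpret prob_space M by (rule P2_facts[OF P])
  have "integrable M (\<lambda>x. C * (1 + norm x))"
    using P2_facts(5)[OF P] by (intro integrable_mult_right Bochner_Integration.integrable_add) auto
  then have "(\<integral>\<^sup>+x. ennreal (C * (1 + norm x)) \<partial>M) < \<infinity>"
    using C(1) by (subst nn_integral_eq_integral) auto
  moreover have "(\<integral>\<^sup>+x. ennreal (- f x) \<partial>M) \<le> (\<integral>\<^sup>+x. ennreal (C * (1 + norm x)) \<partial>M)"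
    using C(2) by (intro nn_integral_mono ennreal_leI) (smt (verit))
  ultimately show ?thesis by (rule le_less_trans[rotated])
qed

text \<open>As the negative parts are finite, the subtractions in \<open>ext_int\<close> can be
  cleared. The convex order becomes an inequality between nonnegative integrals that remains usable
  when positive parts are infinite.\<close>

lemma cx_leI:
  fixes \<mu> \<xi> :: "'a::euclidean_space measure"
  assumes P: "P2 \<mu>" "P2 \<xi>"
    and le: "\<And>\<phi>. convex_on UNIV \<phi> \<Longrightarrow> (\<integral>\<^sup>+x. ennreal (\<phi> x) \<partial>\<mu>) + (\<integral>\<^sup>+x. ennreal (- \<phi> x) \<partial>\<xi>)
      \<le> (\<integral>\<^sup>+x. ennreal (- \<phi> x) \<partial>\<mu>) + (\<integral>\<^sup>+x. ennreal (\<phi> x) \<partial>\<xi>)"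
  shows "cx_le \<mu> \<xi>"
  unfolding cx_le_def
proof (intro allI impI)
  fix \<phi> :: "'a \<Rightarrow> real" assume c: "convex_on UNIV \<phi>"
  obtain b where b: "(\<integral>\<^sup>+x. ennreal (- \<phi> x) \<partial>\<mu>) = ennreal b" "b \<ge> 0"
    using convex_neg_part_finite[OF P(1) c] by (metis enn2real_nonneg ennreal_enn2real infinity_ennreal_def)
  obtain d where d: "(\<integral>\<^sup>+x. ennreal (- \<phi> x) \<partial>\<xi>) = ennreal d" "d \<ge> 0"
    using convex_neg_part_finite[OF P(2) c] by (metis enn2real_nonneg ennreal_enn2real infinity_ennreal_def)
  show "ext_int \<mu> \<phi> \<le> ext_int \<xi> \<phi>"
  proof (cases "(\<integral>\<^sup>+x. ennreal (\<phi> x) \<partial>\<xi>)")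
    case (real r)
    then have "(\<integral>\<^sup>+x. ennreal (\<phi> x) \<partial>\<mu>) + ennreal d \<le> ennreal (b + r)" using le[OF c] b d by simp
    moreover from this obtain a where "(\<integral>\<^sup>+x. ennreal (\<phi> x) \<partial>\<mu>) = ennreal a" "a \<ge> 0"
      by (cases "(\<integral>\<^sup>+x. ennreal (\<phi> x) \<partial>\<mu>)") (auto simp: top_unique)
    ultimately show ?thesis using b d real unfolding ext_int_def
      by (simp add: enn2ereal_ennreal flip: ennreal_plus)
  next
    case top
    then show ?thesis using d unfolding ext_int_def by (simp add: enn2ereal_ennreal)
  qed
qed

lemma ext_int_integrable:
  assumes "integrable M f"
  shows "ext_int_exists M f" "ext_int M f = ereal (\<integral>x. f x \<partial>M)"
proof -
  obtain a b where "(\<integral>\<^sup>+x. ennreal (f x) \<partial>M) = ennreal a" "a \<ge> 0" "(\<integral>\<^sup>+x. ennreal (- f x) \<partial>M) = ennreal b" "b \<ge> 0"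
    using assms unfolding real_integrable_def by (metis enn2real_nonneg ennreal_enn2real infinity_ennreal_def top.not_eq_extremum)
  then show "ext_int_exists M f" "ext_int M f = ereal (\<integral>x. f x \<partial>M)"
    using assms unfolding ext_int_exists_def ext_int_def real_lebesgue_integral_def[OF assms]
    by (auto simp: enn2ereal_ennreal)
qed

lemma cx_leD:
  assumes "cx_le \<mu> \<xi>" "convex_on UNIV f" "integrable \<mu> f" "integrable \<xi> f"
  shows "(\<integral>x. f x \<partial>\<mu>) \<le> (\<integral>x. f x \<partial>\<xi>)"
  using assms ext_int_integrable unfolding cx_le_def by (metis ereal_less_eq(3))

section \<open>Expansions give minimizers\<close>

lemma coupling_of_map:
  fixes \<nu> :: "'a::euclidean_space measure"
  assumes G: "G \<in> borel_measurable \<nu>" and s: "sets \<nu> = sets borel"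
  shows "coupling (distr \<nu> borel G) \<nu> (distr \<nu> (borel \<Otimes>\<^sub>M borel) (\<lambda>y. (G y, y)))"
    and "(\<lambda>y. (G y, y)) \<in> \<nu> \<rightarrow>\<^sub>M borel \<Otimes>\<^sub>M borel"
proof -
  have id: "(\<lambda>y. y) \<in> borel_measurable \<nu>" by (simp add: measurable_cong_sets[OF s refl])
  show m: "(\<lambda>y. (G y, y)) \<in> \<nu> \<rightarrow>\<^sub>M borel \<Otimes>\<^sub>M borel" using G id by (rule measurable_Pair)
  have "distr \<nu> borel (\<lambda>y. y) = \<nu>" by (rule distr_id2) (rule s[symmetric])
  then show "coupling (distr \<nu> borel G) \<nu> (distr \<nu> (borel \<Otimes>\<^sub>M borel) (\<lambda>y. (G y, y)))"
    unfolding coupling_def using distr_distr[OF measurable_fst m] distr_distr[OF measurable_snd m] by (simp add: o_def)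
qed

lemma T2_le_map:
  fixes \<nu> :: "'a::euclidean_space measure"
  assumes G: "G \<in> borel_measurable \<nu>" and s: "sets \<nu> = sets borel"
  shows "T2 (distr \<nu> borel G) \<nu> \<le> (\<integral>\<^sup>+y. ennreal ((norm (G y - y))\<^sup>2) \<partial>\<nu>)"
proof -
  let ?\<pi> = "distr \<nu> (borel \<Otimes>\<^sub>M borel) (\<lambda>y. (G y, y))"
  have "T2 (distr \<nu> borel G) \<nu> \<le> (\<integral>\<^sup>+z. sq_cost z \<partial>?\<pi>)"
    unfolding T2_def using coupling_of_map(1)[OF assms] by (intro INF_lower) simp
  also have "\<dots> = (\<integral>\<^sup>+y. ennreal ((norm (G y - y))\<^sup>2) \<partial>\<nu>)"
  proof -
    have "(\<lambda>z::'a \<times> 'a. sq_cost z) \<in> borel_measurable (borel \<Otimes>\<^sub>M borel)" by measurable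
    then show ?thesis using nn_integral_distr[OF coupling_of_map(2)[OF assms], of "\<lambda>z. sq_cost z"] by simp
  qed
  finally show ?thesis .
qed

text \<open>Quadratic growth on both sides: above because |.|^2/2 - \<phi> is convex and hence
  bounded below linearly, below because finiteness of the transform at y0 gives \<phi> an affine
  minorant.\<close>

lemma semiconcave_integrable:
  fixes \<phi> :: "'a::euclidean_space \<Rightarrow> real"
  assumes P: "P2 M" and f: "convex_on UNIV (\<lambda>x. (norm x)\<^sup>2 / 2 - \<phi> x)" and c: "continuous_on UNIV \<phi>"
    and y0: "legendre \<phi> y0 \<noteq> \<infinity>"
  shows "integrable M \<phi>"
proof -
  obtain C where C: "C \<ge> 0" "\<And>x. (norm x)\<^sup>2 / 2 - \<phi> x \<ge> - (C * (1 + norm x))" using convex_lower_bound[OF f] by blast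
  have "legendre \<phi> y0 \<noteq> - \<infinity>" using legendre_ge[of 0 y0 \<phi>] by auto
  then obtain p where "legendre \<phi> y0 = ereal p" using y0 by (cases "legendre \<phi> y0") auto
  then have p: "x \<bullet> y0 - \<phi> x \<le> p" for x using legendre_ge[of x y0 \<phi>] by simp
  have "\<bar>\<phi> x\<bar> \<le> (1 + 2 * C + \<bar>p\<bar> + norm y0) * (1 + (norm x)\<^sup>2)" for x
  proof -
    define w where "w = 1 + (norm x)\<^sup>2"
    have n: "norm x \<le> w" unfolding w_def by (rule norm_le_one_plus_sq)
    have w: "w \<ge> 1" "(norm x)\<^sup>2 / 2 \<le> w" by (simp_all add: w_def)
    have "C * (1 + norm x) \<le> C * (w + w)" using C(1) n w by (intro mult_left_mono add_mono) auto
    moreover have "\<bar>p\<bar> \<le> \<bar>p\<bar> * w" using mult_left_mono[OF w(1), of "\<bar>p\<bar>"] by simp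
    moreover have "norm y0 * norm x \<le> norm y0 * w" using n by (intro mult_left_mono) auto
    moreover have "- (x \<bullet> y0) \<le> norm y0 * norm x" using Cauchy_Schwarz_ineq2[of x y0] by (simp add: mult.commute)
    moreover have "0 \<le> norm y0 * w" "0 \<le> \<bar>p\<bar> * w" "0 \<le> C * w" using C(1) w by simp_all
    moreover have "(1 + 2 * C + \<bar>p\<bar> + norm y0) * w = w + 2 * (C * w) + \<bar>p\<bar> * w + norm y0 * w" "C * (w + w) = 2 * (C * w)"
      by (simp_all add: algebra_simps)
    ultimately show ?thesis using C(2)[of x] p[of x] w unfolding w_def[symmetric] by linarith
  qed
  then show ?thesis by (rule P2_integrable[OF P borel_measurable_continuous_onI[OF c]])
qed

theorem expansion_image_minimal:
  fixes \<mu> \<nu> \<xi> :: "'a::euclidean_space measure"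
  assumes P: "P2 \<mu>" "P2 \<nu>" and ex: "convex_expansion \<psi>" and G: "G \<in> borel_measurable \<nu>"
    and g: "AE y in \<nu>. has_gradient \<psi> y (G y)" and mu: "distr \<nu> borel G = \<mu>"
    and xi: "\<xi> \<in> Pcx \<mu>" and le: "T2 \<xi> \<nu> \<le> T2 \<mu> \<nu>"
  shows "\<xi> = \<mu>"
proof -
  obtain \<phi> where c: "continuous_on UNIV \<phi>" and h: "hess_le_id \<phi>" and psi: "\<psi> = legendre \<phi>"
    using ex by (auto simp: convex_expansion_def)
  obtain y0 where y0: "legendre \<phi> y0 \<noteq> \<infinity>" using ex psi by (auto simp: convex_expansion_def proper_fun_def)
  define f where "f x = (norm x)\<^sup>2 / 2 - \<phi> x" for x
  have f: "convex_on UNIV f" unfolding f_def by (rule hess_le_id_imp_convex[OF c h])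
  have Pxi: "P2 \<xi>" and cx: "cx_le \<mu> \<xi>" using xi by (auto simp: Pcx_def)
  note N = P2_facts[OF P(2)] and X = P2_facts[OF Pxi] and M = P2_facts[OF P(1)]
  interpret N: prob_space \<nu> by (rule N)
  have if': "integrable M f" if "P2 M" for M
    unfolding f_def using P2_facts(4)[OF that] semiconcave_integrable[OF that f[unfolded f_def] c y0]
    by (intro Bochner_Integration.integrable_diff) auto
  have fle: "(\<integral>x. f x \<partial>\<mu>) \<le> (\<integral>x. f x \<partial>\<xi>)" by (rule cx_leD[OF cx f if'[OF P(1)] if'[OF Pxi]])
  have muG: "integrable \<nu> (\<lambda>y. F (G y))" "(\<integral>y. F (G y) \<partial>\<nu>) = (\<integral>x. F x \<partial>\<mu>)" if "integrable \<mu> F" for F :: "'a \<Rightarrow> real"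
  proof -
    have F: "F \<in> borel_measurable borel" using that M(2) measurable_cong_sets[OF M(2) refl] by blast
    show "integrable \<nu> (\<lambda>y. F (G y))" "(\<integral>y. F (G y) \<partial>\<nu>) = (\<integral>x. F x \<partial>\<mu>)"
      using that integrable_distr_eq[OF G F] integral_distr[OF G F] unfolding mu[symmetric] by simp_all
  qed
  have idm: "(\<lambda>y. y) \<in> borel_measurable \<nu>" by (simp add: measurable_cong_sets[OF N(2) refl])
  have sq: "(norm (a - b))\<^sup>2 \<le> 2 * (norm a)\<^sup>2 + 2 * (norm b)\<^sup>2" for a b :: 'a
  proof -
    have "(norm (a - b))\<^sup>2 + (norm (a + b))\<^sup>2 = 2 * (norm a)\<^sup>2 + 2 * (norm b)\<^sup>2"
      unfolding power2_norm_eq_inner by (simp add: inner_add_left inner_add_right inner_diff_left inner_diff_right inner_commute)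
    then show ?thesis using zero_le_power2[of "norm (a + b)"] by linarith
  qed
  have icG: "integrable \<nu> (\<lambda>y. (norm (G y - y))\<^sup>2)"
  proof (rule Bochner_Integration.integrable_bound)
    show "integrable \<nu> (\<lambda>y. 2 * (norm (G y))\<^sup>2 + 2 * (norm y)\<^sup>2)"
      using muG(1)[OF M(4)] N(4) by (intro Bochner_Integration.integrable_add integrable_mult_right)
    show "(\<lambda>y. (norm (G y - y))\<^sup>2) \<in> borel_measurable \<nu>" using G idm by measurable
  qed (use sq in auto)
  define cG where "cG = (\<integral>y. (norm (G y - y))\<^sup>2 \<partial>\<nu>)"
  have cG: "(\<integral>\<^sup>+y. ennreal ((norm (G y - y))\<^sup>2) \<partial>\<nu>) = ennreal cG" "cG \<ge> 0"
    unfolding cG_def by (rule nn_integral_eq_integral[OF icG]) (auto intro: integral_nonneg_AE)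
  have T: "T2 \<xi> \<nu> \<le> ennreal cG" using le T2_le_map[OF G N(2)] cG(1) unfolding mu by simp
  have "distr \<nu> borel G = \<xi>"
  proof (rule image_measure_of_small_gap[OF N(1,2) G X(1,2) c g[unfolded psi]])
    fix \<delta> \<eta> :: real assume de: "\<delta> > 0" "\<eta> > 0"
    \<comment> \<open>The gap accounts for half of a cost difference, so the slack 2 \<delta> \<eta>
      bounds its integral by \<delta> \<eta>, and Markov's inequality bounds the exceptional
      probability by \<eta>.\<close>
    have "T2 \<xi> \<nu> < ennreal (cG + 2 * (\<delta> * \<eta>))"
      using T cG(2) de by (intro le_less_trans[OF T]) (simp add: ennreal_less_iff)
    then obtain \<pi> where pi: "coupling \<xi> \<nu> \<pi>" and lt: "(\<integral>\<^sup>+z. sq_cost z \<partial>\<pi>) < ennreal (cG + 2 * (\<delta> * \<eta>))"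
      unfolding T2_def INF_less_iff by blast
    note cf = coupling_facts[OF pi N(1)]
    interpret P: prob_space \<pi> by (rule cf)
    have [measurable]: "fst \<in> borel_measurable \<pi>" "snd \<in> borel_measurable \<pi>" using cf by auto
    have ic: "integrable \<pi> (\<lambda>z. (norm (fst z - snd z))\<^sup>2)"
      using lt by (intro integrableI_nonneg) (auto intro: less_trans)
    have "ennreal (\<integral>z. (norm (fst z - snd z))\<^sup>2 \<partial>\<pi>) < ennreal (cG + 2 * (\<delta> * \<eta>))"
      using lt nn_integral_eq_integral[OF ic] by simp
    then have c1: "(\<integral>z. (norm (fst z - snd z))\<^sup>2 \<partial>\<pi>) < cG + 2 * (\<delta> * \<eta>)"
      by (rule ennreal_less_iff[THEN iffD1, rotated]) (auto intro: integral_nonneg_AE)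
    define gap where "gap z = fenchel_gap \<phi> G z" for z
    \<comment> \<open>Written with \<open>f\<close>, the gap is half the transport cost plus terms
      depending on one coordinate each. Their integrals are fixed by the marginals, so the coupling
      enters only through its cost.\<close>
    have gap_eq: "gap z = (norm (fst z - snd z))\<^sup>2 / 2 - f (fst z) + f (G (snd z)) - (norm (G (snd z) - snd z))\<^sup>2 / 2" for z
      unfolding gap_def f_def power2_norm_eq_inner
      by (simp add: inner_diff_left inner_diff_right inner_commute field_simps)
    note i1 = coupling_fst_int[OF pi N(1) if'[OF Pxi]]
    note i2 = coupling_snd_int[OF pi N(1) muG(1)[OF if'[OF P(1)]]]
    note i3 = coupling_snd_int[OF pi N(1) icG]
    have ig: "integrable \<pi> gap" unfolding gap_eq using ic i1 i2 i3
      by (intro Bochner_Integration.integrable_add Bochner_Integration.integrable_diff) auto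
    have "(\<integral>z. gap z \<partial>\<pi>) = (\<integral>z. (norm (fst z - snd z))\<^sup>2 \<partial>\<pi>) / 2 - (\<integral>x. f x \<partial>\<xi>) + (\<integral>x. f x \<partial>\<mu>) - cG / 2"
      unfolding gap_eq using ic i1 i2 i3 muG(2)[OF if'[OF P(1)]] by (simp add: cG_def)
    then have small: "(\<integral>z. gap z \<partial>\<pi>) \<le> \<delta> * \<eta>" using c1 fle by simp
    have "AE y in \<nu>. \<forall>x. 0 \<le> \<phi> x + (G y \<bullet> y - \<phi> (G y)) - x \<bullet> y"
      using g
    proof eventually_elim
      case (elim y)
      from fenchel_equality_at_gradient[OF c elim[unfolded psi]] show ?case
        using legendre_ge[of _ y \<phi>] by (simp add: algebra_simps)
    qed
    moreover have "\<nu> = distr \<pi> borel snd" using pi by (simp add: coupling_def)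
    ultimately have "AE y in distr \<pi> borel snd. \<forall>x. 0 \<le> \<phi> x + (G y \<bullet> y - \<phi> (G y)) - x \<bullet> y" by metis
    from AE_distrD[OF cf(5) this] have nn: "AE z in \<pi>. 0 \<le> gap z" unfolding gap_def by eventually_elim blast
    have "\<delta> * measure \<pi> {z \<in> space \<pi>. \<delta> \<le> gap z} \<le> (\<integral>z. gap z \<partial>\<pi>)"
      using integral_Markov_inequality_measure[OF ig sets.top nn de(1)] de(1) by (simp add: field_simps)
    with small have "\<delta> * measure \<pi> {z. \<delta> \<le> gap z} \<le> \<delta> * \<eta>" using cf(2) by simp
    then have "measure \<pi> {z. \<delta> \<le> gap z} \<le> \<eta>" using de(1) by simp
    then show "\<exists>\<pi>. coupling \<xi> \<nu> \<pi> \<and> measure \<pi> {z. fenchel_gap \<phi> G z \<ge> \<delta>} \<le> \<eta>"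
      using pi unfolding gap_def by blast
  qed
  then show ?thesis using mu by simp
qed

section \<open>Rockafellar's potential\<close>

text \<open>Rockafellar's chains: the affine functions \<open>y \<mapsto> p \<bullet> y - c\<close> obtained by going along finitely many
  points of \<open>\<Gamma>\<close>, starting at \<open>(x0, y0)\<close>, with slope \<open>x - y\<close> at \<open>(x, y)\<close>.\<close>

inductive_set chain_affine :: "('a \<times> 'a) set \<Rightarrow> 'a \<times> 'a \<Rightarrow> ('a::euclidean_space \<times> real) set"
  for \<Gamma> and z0 where
  start: "(fst z0 - snd z0, (fst z0 - snd z0) \<bullet> snd z0) \<in> chain_affine \<Gamma> z0"
| step: "(p, c) \<in> chain_affine \<Gamma> z0 \<Longrightarrow> (x, y) \<in> \<Gamma> \<Longrightarrow>
    (x - y, (x - y) \<bullet> y - (p \<bullet> y - c)) \<in> chain_affine \<Gamma> z0"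

text \<open>The inductive form suits the supremum over all chains, while the perturbation argument
  needs the points themselves. Evaluated at \<open>snd z0\<close>, the path closes up and the value
  is a cyclic sum.\<close>

lemma chain_affine_path:
  assumes "(p, c) \<in> chain_affine \<Gamma> z0" "z0 \<in> \<Gamma>"
  shows "\<exists>N z. z 0 = z0 \<and> (\<forall>i\<le>N. z i \<in> \<Gamma>) \<and> p = fst (z N) - snd (z N) \<and>
    (\<forall>y. p \<bullet> y - c = (\<Sum>i<N. (fst (z i) - snd (z i)) \<bullet> (snd (z (Suc i)) - snd (z i)))
      + (fst (z N) - snd (z N)) \<bullet> (y - snd (z N)))"
  using assms
proof (induction rule: chain_affine.induct)
  case start
  then show ?case by (intro exI[of _ 0] exI[of _ "\<lambda>_. z0"]) (auto simp: inner_diff_right)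
next
  case (step p c x y)
  then obtain N z where z: "z 0 = z0" "\<forall>i\<le>N. z i \<in> \<Gamma>" "p = fst (z N) - snd (z N)"
    "\<forall>y. p \<bullet> y - c = (\<Sum>i<N. (fst (z i) - snd (z i)) \<bullet> (snd (z (Suc i)) - snd (z i)))
      + (fst (z N) - snd (z N)) \<bullet> (y - snd (z N))" by blast
  let ?z = "z(Suc N := (x, y))"
  have "(\<Sum>i<N. (fst (?z i) - snd (?z i)) \<bullet> (snd (?z (Suc i)) - snd (?z i))) = (\<Sum>i<N. (fst (z i) - snd (z i)) \<bullet> (snd (z (Suc i)) - snd (z i)))"
    by (intro sum.cong) auto
  then have "(\<Sum>i<Suc N. (fst (?z i) - snd (?z i)) \<bullet> (snd (?z (Suc i)) - snd (?z i))) = p \<bullet> y - c"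
    using z(4) by simp
  then show ?case using z(1,2) step.hyps(2)
    by (intro exI[of _ "Suc N"] exI[of _ ?z]) (auto simp: inner_diff_right le_Suc_eq)
qed

text \<open>Completing the square gives \<open>x \<bullet> y - \<bar>x\<bar>\<^sup>2/2 + (x \<bullet> p - \<bar>p\<bar>\<^sup>2/2 - c) = \<bar>y\<bar>\<^sup>2/2 + (p \<bullet> y - c) - \<bar>x - p - y\<bar>\<^sup>2/2\<close>,
  so the potential built from the chains is the transform of \<open>\<bar>\<cdot>\<bar>\<^sup>2/2\<close> plus Rockafellar's convex function.\<close>

theorem rockafellar_expansion:
  fixes \<Gamma> :: "('a::euclidean_space \<times> 'a) set"
  assumes z0: "z0 \<in> \<Gamma>" and mono: "\<And>p c. (p, c) \<in> chain_affine \<Gamma> z0 \<Longrightarrow> p \<bullet> snd z0 - c \<le> 0"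
  obtains \<phi> where "convex_on UNIV (\<lambda>x. (norm x)\<^sup>2 / 2 - \<phi> x)"
    "\<And>x y x'. (x, y) \<in> \<Gamma> \<Longrightarrow> x' \<bullet> y - \<phi> x' \<le> x \<bullet> y - \<phi> x"
proof -
  define A where "A = chain_affine \<Gamma> z0"
  define y0 where "y0 = snd z0"
  \<comment> \<open>This is |x|^2/2 minus |x - p|^2/2 + c, the latter being the conjugate of y
    \<mapsto> |y|^2/2 + p . y - c; thus \<open>\<phi>\<close> below is the infimum of these
    conjugates over all chains.\<close>
  define a where "a x pc = x \<bullet> fst pc - (norm (fst pc))\<^sup>2 / 2 - snd pc" for x and pc :: "'a \<times> real"
  define f where "f x = (SUP pc\<in>A. a x pc)" for x
  have A: "A \<noteq> {}" unfolding A_def using chain_affine.start by blast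
  have square: "x \<bullet> y - (norm x)\<^sup>2 / 2 + a x pc \<le> (norm y)\<^sup>2 / 2 + (fst pc \<bullet> y - snd pc)" for x y pc
  proof -
    have "(norm (x - fst pc - y))\<^sup>2 = (norm x)\<^sup>2 + (norm (fst pc))\<^sup>2 + (norm y)\<^sup>2 - 2 * (x \<bullet> fst pc) - 2 * (x \<bullet> y) + 2 * (fst pc \<bullet> y)"
      unfolding power2_norm_eq_inner by (simp add: inner_diff_left inner_diff_right inner_commute)
    moreover have "0 \<le> (norm (x - fst pc - y))\<^sup>2" by simp
    ultimately show ?thesis unfolding a_def by linarith
  qed
  \<comment> \<open>The point where cyclic monotonicity is used: all chains are nonpositive at y0,
    so the supremum is finite everywhere.\<close>
  have bdd: "bdd_above (a x ` A)" for x
  proof (rule bdd_aboveI2)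
    fix pc assume "pc \<in> A"
    then have "fst pc \<bullet> y0 - snd pc \<le> 0" using mono unfolding A_def y0_def by (cases pc) auto
    then show "a x pc \<le> (norm y0)\<^sup>2 / 2 - x \<bullet> y0 + (norm x)\<^sup>2 / 2" using square[of x y0 pc] by linarith
  qed
  have f: "convex_on UNIV f"
  proof (rule convex_onI)
    fix t :: real and x y :: 'a assume t: "0 < t" "t < 1"
    show "f ((1 - t) *\<^sub>R x + t *\<^sub>R y) \<le> (1 - t) * f x + t * f y"
      unfolding f_def[of "(1 - t) *\<^sub>R x + t *\<^sub>R y"]
    proof (rule cSUP_least[OF A])
      fix pc assume pc: "pc \<in> A"
      have "a ((1 - t) *\<^sub>R x + t *\<^sub>R y) pc = (1 - t) * a x pc + t * a y pc"
        unfolding a_def inner_add_left inner_scaleR_left by (simp add: field_simps)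
      also have "\<dots> \<le> (1 - t) * f x + t * f y"
        unfolding f_def using t pc bdd by (intro add_mono mult_left_mono cSUP_upper) auto
      finally show "a ((1 - t) *\<^sub>R x + t *\<^sub>R y) pc \<le> (1 - t) * f x + t * f y" .
    qed
  qed simp
  define \<phi> where "\<phi> x = (norm x)\<^sup>2 / 2 - f x" for x
  have "x' \<bullet> y - \<phi> x' \<le> x \<bullet> y - \<phi> x" if xy: "(x, y) \<in> \<Gamma>" for x y x'
  proof -
    have "f x' \<le> (x \<bullet> y - \<phi> x) - x' \<bullet> y + (norm x')\<^sup>2 / 2"
      unfolding f_def
    proof (rule cSUP_least[OF A])
      fix pc assume pc: "pc \<in> A"
      \<comment> \<open>The chain prolonged by (x, y). Its slope is x - y, so the square x - p - y
        vanishes and the completed square becomes an equality.\<close>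
      let ?q = "(x - y, (x - y) \<bullet> y - (fst pc \<bullet> y - snd pc))"
      have "?q \<in> A" using pc xy chain_affine.step unfolding A_def by (metis prod.collapse)
      then have "a x ?q \<le> f x" unfolding f_def using bdd by (intro cSUP_upper)
      moreover have "x \<bullet> y - (norm x)\<^sup>2 / 2 + a x ?q = (norm y)\<^sup>2 / 2 + (fst pc \<bullet> y - snd pc)"
        unfolding a_def power2_norm_eq_inner by (simp add: inner_diff_left inner_diff_right inner_commute field_simps)
      ultimately show "a x' pc \<le> (x \<bullet> y - \<phi> x) - x' \<bullet> y + (norm x')\<^sup>2 / 2"
        using square[of x' y pc] unfolding \<phi>_def by linarith
    qed
    then show ?thesis by (simp add: \<phi>_def)
  qed
  moreover have "convex_on UNIV (\<lambda>x. (norm x)\<^sup>2 / 2 - \<phi> x)" using f by (simp add: \<phi>_def)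
  ultimately show ?thesis using that by blast
qed

section \<open>Perturbing couplings upwards in convex order\<close>

text \<open>Jensen's inequality with positive and negative parts distributed so that no subtraction
  occurs; this is the integrand of the criterion \<open>cx_leI\<close>.\<close>

lemma ennreal_convex_parts:
  fixes p q r :: real
  assumes "p \<le> a * q + b * r" "a \<ge> 0" "b \<ge> 0"
  shows "ennreal p + (ennreal a * ennreal (- q) + ennreal b * ennreal (- r)) \<le> ennreal (- p) + (ennreal a * ennreal q + ennreal b * ennreal r)"
proof -
  have e: "ennreal x = ennreal (max 0 x)" for x by (simp add: max_def ennreal_neg)
  have parts: "x = max 0 x - max 0 (- x)" for x :: real by (simp add: max_def)
  have "max 0 p + (a * max 0 (- q) + b * max 0 (- r)) \<le> max 0 (- p) + (a * max 0 q + b * max 0 r)"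
  proof -
    have "max 0 p - max 0 (- p) \<le> a * (max 0 q - max 0 (- q)) + b * (max 0 r - max 0 (- r))"
      using assms(1) parts[of p] parts[of q] parts[of r] by simp
    then show ?thesis by (simp add: algebra_simps)
  qed
  then have "ennreal (max 0 p + (a * max 0 (- q) + b * max 0 (- r))) \<le> ennreal (max 0 (- p) + (a * max 0 q + b * max 0 r))"
    by (rule ennreal_leI)
  then show ?thesis
    using assms(2,3) unfolding e[of p] e[of "- p"] e[of q] e[of "- q"] e[of r] e[of "- r"]
    by (simp add: ennreal_plus ennreal_mult del: ennreal_max_0 ennreal_max_0')
qed

text \<open>A fraction of \<open>\<pi>\<close>, described by the self-coupling density \<open>w\<close>, is moved: of the mass paired by \<open>w\<close> at
  \<open>((x,y), (x',y'))\<close> the part \<open>1/(1+\<delta>)\<close> goes to \<open>(x' - \<delta>(y - y'), y')\<close> and the part \<open>\<delta>/(1+\<delta>)\<close> to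
  \<open>(y + x' - y', y)\<close>. The two new first coordinates average to \<open>x'\<close>, so the first marginal increases in
  convex order, while the second marginal is kept.\<close>

lemma perturbation_cost:
  fixes \<mu> \<nu> :: "'a::euclidean_space measure"
  assumes P: "P2 \<mu>" "P2 \<nu>" and opt: "\<And>\<xi>. \<xi> \<in> Pcx \<mu> \<Longrightarrow> T2 \<mu> \<nu> \<le> T2 \<xi> \<nu>"
    and pi: "coupling \<mu> \<nu> \<pi>" and fin: "(\<integral>\<^sup>+z. sq_cost z \<partial>\<pi>) < \<infinity>"
    and w[measurable]: "w \<in> borel_measurable (\<pi> \<Otimes>\<^sub>M \<pi>)" and s[measurable]: "s \<in> borel_measurable \<pi>" and s1: "\<And>z. s z \<le> 1"
    and m1: "\<And>H. H \<in> borel_measurable \<pi> \<Longrightarrow> (\<integral>\<^sup>+u. w u * H (fst u) \<partial>(\<pi> \<Otimes>\<^sub>M \<pi>)) = (\<integral>\<^sup>+z. s z * H z \<partial>\<pi>)"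
    and m2: "\<And>H. H \<in> borel_measurable \<pi> \<Longrightarrow> (\<integral>\<^sup>+u. w u * H (snd u) \<partial>(\<pi> \<Otimes>\<^sub>M \<pi>)) = (\<integral>\<^sup>+z. s z * H z \<partial>\<pi>)"
    and dl: "\<delta> > 0"
    and X: "X = (\<integral>\<^sup>+u. w u * ennreal ((norm (fst (snd u) - snd (snd u) - \<delta> *\<^sub>R (snd (fst u) - snd (snd u))))\<^sup>2) \<partial>(\<pi> \<Otimes>\<^sub>M \<pi>))" "X < \<infinity>"
  shows "T2 \<mu> \<nu> \<le> (\<integral>\<^sup>+z. (1 - s z) * sq_cost z \<partial>\<pi>) + ennreal (1 / (1 + \<delta>)) * X
     + ennreal (\<delta> / (1 + \<delta>)) * (\<integral>\<^sup>+z. s z * sq_cost z \<partial>\<pi>)"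
proof -
  let ?PP = "\<pi> \<Otimes>\<^sub>M \<pi>"
  \<comment> \<open>The weights are forced: a + b = 1 conserves mass, and b = a \<delta> cancels the
    displacements so that the two new points average to x'.\<close>
  define a b where "a = 1 / (1 + \<delta>)" and "b = \<delta> / (1 + \<delta>)"
  have ab: "a \<ge> 0" "b \<ge> 0" "a + b = 1" "b = a * \<delta>" using dl by (simp_all add: a_def b_def field_simps)
  have abe: "ennreal a + ennreal b = 1" using ab by (simp flip: ennreal_plus)
  note N = P2_facts[OF P(2)] and M = P2_facts[OF P(1)]
  note cf = coupling_facts[OF pi N(1)]
  interpret p: prob_space \<pi> by (rule cf)
  have sp: "sets \<pi> = sets (borel \<Otimes>\<^sub>M borel)" using pi by (simp add: coupling_def)
  note [measurable_cong] = sp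
  define T1 where "T1 u = (fst (snd u) - \<delta> *\<^sub>R (snd (fst u) - snd (snd u)), snd (snd u))" for u :: "('a \<times> 'a) \<times> ('a \<times> 'a)"
  define T2' where "T2' u = (snd (fst u) + (fst (snd u) - snd (snd u)), snd (fst u))" for u :: "('a \<times> 'a) \<times> ('a \<times> 'a)"
  have [measurable]: "T1 \<in> ?PP \<rightarrow>\<^sub>M borel \<Otimes>\<^sub>M borel" "T2' \<in> ?PP \<rightarrow>\<^sub>M borel \<Otimes>\<^sub>M borel"
    unfolding T1_def T2'_def by measurable
  define M0 where "M0 = density \<pi> (\<lambda>z. 1 - s z)"
  define M1 where "M1 = distr (density ?PP (\<lambda>u. ennreal a * w u)) (borel \<Otimes>\<^sub>M borel) T1"
  define M2 where "M2 = distr (density ?PP (\<lambda>u. ennreal b * w u)) (borel \<Otimes>\<^sub>M borel) T2'"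
  obtain R1 where R1: "sets R1 = sets M1"
    "\<And>F. F \<in> borel_measurable M1 \<Longrightarrow> (\<integral>\<^sup>+x. F x \<partial>R1) = (\<integral>\<^sup>+x. F x \<partial>M1) + (\<integral>\<^sup>+x. F x \<partial>M2)"
    using sum_measure_exists[of M1 M2] unfolding M1_def M2_def by auto
  obtain R where R: "sets R = sets M0"
    "\<And>F. F \<in> borel_measurable M0 \<Longrightarrow> (\<integral>\<^sup>+x. F x \<partial>R) = (\<integral>\<^sup>+x. F x \<partial>M0) + (\<integral>\<^sup>+x. F x \<partial>R1)"
    using sum_measure_exists[of M0 R1] R1(1) sp unfolding M0_def M1_def by auto
  have sR: "sets R = sets (borel \<Otimes>\<^sub>M borel)" using R(1) sp by (simp add: M0_def)
  have intR: "(\<integral>\<^sup>+z. F z \<partial>R) = (\<integral>\<^sup>+z. (1 - s z) * F z \<partial>\<pi>) + (ennreal a * (\<integral>\<^sup>+u. w u * F (T1 u) \<partial>?PP) + ennreal b * (\<integral>\<^sup>+u. w u * F (T2' u) \<partial>?PP))"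
    if F[measurable]: "F \<in> borel_measurable (borel \<Otimes>\<^sub>M borel)" for F
  proof -
    have "(\<integral>\<^sup>+z. F z \<partial>R) = (\<integral>\<^sup>+z. F z \<partial>M0) + ((\<integral>\<^sup>+z. F z \<partial>M1) + (\<integral>\<^sup>+z. F z \<partial>M2))"
    proof -
      have "F \<in> borel_measurable M0" "F \<in> borel_measurable M1"
        unfolding M0_def M1_def by measurable
      then show ?thesis using R(2) R1(2) by simp
    qed
    also have "(\<integral>\<^sup>+z. F z \<partial>M0) = (\<integral>\<^sup>+z. (1 - s z) * F z \<partial>\<pi>)"
      unfolding M0_def by (rule nn_integral_density) measurable
    also have "(\<integral>\<^sup>+z. F z \<partial>M1) = ennreal a * (\<integral>\<^sup>+u. w u * F (T1 u) \<partial>?PP)"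
      unfolding M1_def by (simp add: nn_integral_distr nn_integral_density mult.assoc nn_integral_cmult)
    also have "(\<integral>\<^sup>+z. F z \<partial>M2) = ennreal b * (\<integral>\<^sup>+u. w u * F (T2' u) \<partial>?PP)"
      unfolding M2_def by (simp add: nn_integral_distr nn_integral_density mult.assoc nn_integral_cmult)
    finally show ?thesis .
  qed
  note ds = nn_integral_split_weight[OF s _ s1]
  have sndR: "(\<integral>\<^sup>+z. h (snd z) \<partial>R) = (\<integral>\<^sup>+y. h y \<partial>\<nu>)" if h[measurable]: "h \<in> borel_measurable borel" for h
  proof -
    have "(\<integral>\<^sup>+z. h (snd z) \<partial>R) = (\<integral>\<^sup>+z. (1 - s z) * h (snd z) \<partial>\<pi>) + (ennreal a * (\<integral>\<^sup>+z. s z * h (snd z) \<partial>\<pi>) + ennreal b * (\<integral>\<^sup>+z. s z * h (snd z) \<partial>\<pi>))"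
      by (subst intR) (simp_all add: T1_def T2'_def m1[of "\<lambda>z. h (snd z)"] m2[of "\<lambda>z. h (snd z)"])
    also have "\<dots> = (\<integral>\<^sup>+z. h (snd z) \<partial>\<pi>)" using abe ds[of "\<lambda>z. h (snd z)"] by (simp flip: distrib_right)
    finally show ?thesis using coupling_snd_nn[OF pi N(1) h] by simp
  qed
  have mR: "fst \<in> borel_measurable R" "snd \<in> borel_measurable R"
    using measurable_cong_sets[OF sR refl] by auto
  define \<xi> where "\<xi> = distr R borel fst"
  have "distr R borel snd = \<nu>"
  proof (rule measure_eqI)
    fix A :: "'a set" assume "A \<in> sets (distr R borel snd)"
    then have A[measurable]: "A \<in> sets borel" by simp
    have "emeasure (distr R borel snd) A = (\<integral>\<^sup>+z. indicator A (snd z) \<partial>R)"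
      using mR(2) by (simp add: nn_integral_distr flip: nn_integral_indicator)
    then show "emeasure (distr R borel snd) A = emeasure \<nu> A" using sndR[of "indicator A"] N(2) by simp
  qed (use N in simp)
  then have cR: "coupling \<xi> \<nu> R" using sR by (simp add: coupling_def \<xi>_def)
  note cfR = coupling_facts[OF cR N(1)]
  define C where "C = (\<integral>\<^sup>+z. (1 - s z) * sq_cost z \<partial>\<pi>) + (ennreal a * X + ennreal b * (\<integral>\<^sup>+z. s z * sq_cost z \<partial>\<pi>))"
  have cost: "(\<integral>\<^sup>+z. sq_cost z \<partial>R) = C"
  proof -
    \<comment> \<open>Under \<open>T1\<close> the displacement becomes x' - y' - \<delta> (y - y');
      under \<open>T2'\<close> it is still x' - y', so that piece costs what the removed mass
      did.\<close>
    have "(\<integral>\<^sup>+u. w u * ennreal ((norm (fst (T1 u) - snd (T1 u)))\<^sup>2) \<partial>?PP) = X"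
      unfolding X(1) T1_def by (intro nn_integral_cong) (simp add: algebra_simps)
    moreover have "(\<integral>\<^sup>+u. w u * ennreal ((norm (fst (T2' u) - snd (T2' u)))\<^sup>2) \<partial>?PP) = (\<integral>\<^sup>+z. s z * sq_cost z \<partial>\<pi>)"
      unfolding T2'_def by (subst m2[symmetric]) simp_all
    ultimately show ?thesis unfolding C_def by (subst intR) simp_all
  qed
  have Cfin: "C < \<infinity>"
  proof -
    note dsc = ds[of "\<lambda>z. sq_cost z", simplified]
    have "(\<integral>\<^sup>+z. (1 - s z) * sq_cost z \<partial>\<pi>) < \<infinity>" "(\<integral>\<^sup>+z. s z * sq_cost z \<partial>\<pi>) < \<infinity>"
      using fin unfolding dsc[symmetric] by auto
    then show ?thesis using X(2) by (simp add: C_def ennreal_mult_less_top)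
  qed
  have Pxi: "P2 \<xi>"
    unfolding P2_def
  proof (intro conjI cfR(6,7))
    have "(\<integral>\<^sup>+x. ennreal ((norm x)\<^sup>2) \<partial>\<xi>) = (\<integral>\<^sup>+z. ennreal ((norm (fst z))\<^sup>2) \<partial>R)"
      using coupling_fst_nn[OF cR N(1), of "\<lambda>x. ennreal ((norm x)\<^sup>2)"] by simp
    also have "\<dots> \<le> (\<integral>\<^sup>+z. 2 * sq_cost z + 2 * ennreal ((norm (snd z))\<^sup>2) \<partial>R)"
    proof (rule nn_integral_mono)
      fix z :: "'a \<times> 'a"
      have "(norm (fst z))\<^sup>2 + (norm (fst z - 2 *\<^sub>R snd z))\<^sup>2 = 2 * (norm (fst z - snd z))\<^sup>2 + 2 * (norm (snd z))\<^sup>2"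
        unfolding power2_norm_eq_inner by (simp add: inner_diff_left inner_diff_right inner_commute)
      then have "(norm (fst z))\<^sup>2 \<le> 2 * (norm (fst z - snd z))\<^sup>2 + 2 * (norm (snd z))\<^sup>2"
        using zero_le_power2[of "norm (fst z - 2 *\<^sub>R snd z)"] by linarith
      from ennreal_leI[OF this]
      show "ennreal ((norm (fst z))\<^sup>2) \<le> 2 * sq_cost z + 2 * ennreal ((norm (snd z))\<^sup>2)"
        by (simp add: ennreal_plus ennreal_mult)
    qed
    also have "\<dots> = 2 * C + 2 * (\<integral>\<^sup>+y. ennreal ((norm y)\<^sup>2) \<partial>\<nu>)"
    proof -
      have [measurable]: "fst \<in> borel_measurable R" "snd \<in> borel_measurable R" using mR by auto
      show ?thesis using sndR[of "\<lambda>y. ennreal ((norm y)\<^sup>2)"]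
        by (subst nn_integral_add) (simp_all add: nn_integral_cmult cost)
    qed
    also have "\<dots> < \<infinity>" using Cfin nn_integral_eq_integral[OF N(4)] by (simp add: ennreal_mult_less_top)
    finally show "integrable \<xi> (\<lambda>x. (norm x)\<^sup>2)"
      by (intro integrableI_nonneg) (simp_all add: measurable_cong_sets[OF cfR(7) refl])
  qed
  have "cx_le \<mu> \<xi>"
  proof (rule cx_leI[OF P(1) Pxi])
    fix \<phi> :: "'a \<Rightarrow> real" assume cv: "convex_on UNIV \<phi>"
    have [measurable]: "\<phi> \<in> borel_measurable borel"
      by (intro borel_measurable_continuous_onI convex_on_continuous cv) simp
    \<comment> \<open>The factor t stands for 1 and -1, so that one identity covers the positive and
      the negative part of \<phi>.\<close>
    have mu: "(\<integral>\<^sup>+x. ennreal (t * \<phi> x) \<partial>\<mu>) = (\<integral>\<^sup>+z. (1 - s z) * ennreal (t * \<phi> (fst z)) \<partial>\<pi>) + (\<integral>\<^sup>+z. s z * ennreal (t * \<phi> (fst z)) \<partial>\<pi>)" for t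
      using coupling_fst_nn[OF pi N(1), of "\<lambda>x. ennreal (t * \<phi> x)"] ds[of "\<lambda>z. ennreal (t * \<phi> (fst z))"] by simp
    define J where "J t = ennreal a * (\<integral>\<^sup>+u. w u * ennreal (t * \<phi> (fst (T1 u))) \<partial>?PP) + ennreal b * (\<integral>\<^sup>+u. w u * ennreal (t * \<phi> (fst (T2' u))) \<partial>?PP)" for t
    have xi: "(\<integral>\<^sup>+x. ennreal (t * \<phi> x) \<partial>\<xi>) = (\<integral>\<^sup>+z. (1 - s z) * ennreal (t * \<phi> (fst z)) \<partial>\<pi>) + J t" for t
      using coupling_fst_nn[OF cR N(1), of "\<lambda>x. ennreal (t * \<phi> x)"] intR[of "\<lambda>z. ennreal (t * \<phi> (fst z))"] by (simp add: J_def)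
    have sJ: "(\<integral>\<^sup>+z. s z * ennreal (t * \<phi> (fst z)) \<partial>\<pi>) + J r = (\<integral>\<^sup>+u. w u * (ennreal (t * \<phi> (fst (snd u))) + (ennreal a * ennreal (r * \<phi> (fst (T1 u))) + ennreal b * ennreal (r * \<phi> (fst (T2' u))))) \<partial>?PP)" for t r
    proof -
      have "(\<integral>\<^sup>+u. w u * (ennreal (t * \<phi> (fst (snd u))) + (ennreal a * ennreal (r * \<phi> (fst (T1 u))) + ennreal b * ennreal (r * \<phi> (fst (T2' u))))) \<partial>?PP)
        = (\<integral>\<^sup>+u. w u * ennreal (t * \<phi> (fst (snd u))) + (ennreal a * (w u * ennreal (r * \<phi> (fst (T1 u)))) + ennreal b * (w u * ennreal (r * \<phi> (fst (T2' u))))) \<partial>?PP)"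
        by (intro nn_integral_cong) (simp add: distrib_left mult.left_commute)
      also have "\<dots> = (\<integral>\<^sup>+u. w u * ennreal (t * \<phi> (fst (snd u))) \<partial>?PP) + J r"
        unfolding J_def by (simp add: nn_integral_add nn_integral_cmult)
      finally show ?thesis using m2[of "\<lambda>z. ennreal (t * \<phi> (fst z))"] by simp
    qed
    have "(\<integral>\<^sup>+z. s z * ennreal (1 * \<phi> (fst z)) \<partial>\<pi>) + J (- 1) \<le> (\<integral>\<^sup>+z. s z * ennreal (- 1 * \<phi> (fst z)) \<partial>\<pi>) + J 1"
      unfolding sJ
    proof (intro nn_integral_mono mult_left_mono)
      fix u :: "('a \<times> 'a) \<times> ('a \<times> 'a)"
      have "fst (snd u) = a *\<^sub>R fst (T1 u) + b *\<^sub>R fst (T2' u)"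
      proof -
        have "a *\<^sub>R fst (T1 u) + b *\<^sub>R fst (T2' u) = (a + b) *\<^sub>R fst (snd u) + (b - a * \<delta>) *\<^sub>R (snd (fst u) - snd (snd u))"
          unfolding T1_def T2'_def by (simp add: algebra_simps)
        then show ?thesis using ab by simp
      qed
      then have "\<phi> (fst (snd u)) \<le> a * \<phi> (fst (T1 u)) + b * \<phi> (fst (T2' u))"
        using cv ab unfolding convex_on_def by simp
      from ennreal_convex_parts[OF this ab(1,2)]
      show "ennreal (1 * \<phi> (fst (snd u))) + (ennreal a * ennreal (- 1 * \<phi> (fst (T1 u))) + ennreal b * ennreal (- 1 * \<phi> (fst (T2' u))))
        \<le> ennreal (- 1 * \<phi> (fst (snd u))) + (ennreal a * ennreal (1 * \<phi> (fst (T1 u))) + ennreal b * ennreal (1 * \<phi> (fst (T2' u))))" by simp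
    qed simp
    then have "(\<integral>\<^sup>+x. ennreal (1 * \<phi> x) \<partial>\<mu>) + (\<integral>\<^sup>+x. ennreal (- 1 * \<phi> x) \<partial>\<xi>) \<le> (\<integral>\<^sup>+x. ennreal (- 1 * \<phi> x) \<partial>\<mu>) + (\<integral>\<^sup>+x. ennreal (1 * \<phi> x) \<partial>\<xi>)"
      unfolding mu xi by (metis (no_types, lifting) add.assoc add.left_commute add_left_mono)
    then show "(\<integral>\<^sup>+x. ennreal (\<phi> x) \<partial>\<mu>) + (\<integral>\<^sup>+x. ennreal (- \<phi> x) \<partial>\<xi>) \<le> (\<integral>\<^sup>+x. ennreal (- \<phi> x) \<partial>\<mu>) + (\<integral>\<^sup>+x. ennreal (\<phi> x) \<partial>\<xi>)" by simp
  qed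
  then have "T2 \<mu> \<nu> \<le> T2 \<xi> \<nu>" using opt Pxi by (simp add: Pcx_def)
  also have "\<dots> \<le> (\<integral>\<^sup>+z. sq_cost z \<partial>R)"
    unfolding T2_def using cR by (intro INF_lower) simp
  finally show ?thesis unfolding cost C_def a_def b_def by (simp add: add.assoc)
qed

lemma nn_integral_pair_mult:
  assumes "prob_space M" and [measurable]: "f \<in> borel_measurable M" "g \<in> borel_measurable M"
  shows "(\<integral>\<^sup>+u. f (fst u) * g (snd u) \<partial>(M \<Otimes>\<^sub>M M)) = (\<integral>\<^sup>+x. f x \<partial>M) * (\<integral>\<^sup>+x. g x \<partial>M)"
proof -
  interpret prob_space M by fact
  have "(\<integral>\<^sup>+u. f (fst u) * g (snd u) \<partial>(M \<Otimes>\<^sub>M M)) = (\<integral>\<^sup>+x. (\<integral>\<^sup>+y. f x * g y \<partial>M) \<partial>M)"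
    by (subst nn_integral_fst[symmetric]) simp_all
  then show ?thesis by (simp add: nn_integral_cmult nn_integral_multc)
qed

text \<open>The mass transfer is cyclic: the density \<open>w\<close> pairs
  \<open>W (\<tau> i)\<close> with \<open>W i\<close>, the same mass for every i, and since \<tau>
  permutes I both its marginals are the same part of \<pi>. Expanding |p' - \<delta> d|^2 with p' .
  d \<ge> v i and |d|^2 \<le> B bounds the new cost; near optimality allows a saving of at most
  e.\<close>

lemma cycle_gain:
  fixes \<mu> \<nu> :: "'a::euclidean_space measure" and W :: "'i \<Rightarrow> ('a \<times> 'a) set"
  assumes P: "P2 \<mu>" "P2 \<nu>" and opt: "\<And>\<xi>. \<xi> \<in> Pcx \<mu> \<Longrightarrow> T2 \<mu> \<nu> \<le> T2 \<xi> \<nu>"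
    and pi: "coupling \<mu> \<nu> \<pi>" and near: "(\<integral>\<^sup>+z. sq_cost z \<partial>\<pi>) \<le> T2 \<mu> \<nu> + ennreal e"
    and fin: "T2 \<mu> \<nu> < \<infinity>" and e: "e \<ge> 0"
    and I: "finite I" "I \<noteq> {}" "bij_betw \<tau> I I"
    and W: "\<And>i. i \<in> I \<Longrightarrow> W i \<in> sets borel" "\<And>i. i \<in> I \<Longrightarrow> m \<le> measure \<pi> (W i)" and m: "m > 0"
    and v: "\<And>i u u'. i \<in> I \<Longrightarrow> u \<in> W (\<tau> i) \<Longrightarrow> u' \<in> W i \<Longrightarrow> v i \<le> (fst u' - snd u') \<bullet> (snd u - snd u')"
    and B: "\<And>i u u'. i \<in> I \<Longrightarrow> u \<in> W (\<tau> i) \<Longrightarrow> u' \<in> W i \<Longrightarrow> (norm (snd u - snd u'))\<^sup>2 \<le> B" "B \<ge> 0"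
    and dl: "\<delta> > 0"
  shows "m / real (card I) / (1 + \<delta>) * (2 * \<delta> * (\<Sum>i\<in>I. v i) - \<delta>\<^sup>2 * real (card I) * B) \<le> e"
proof -
  let ?PP = "\<pi> \<Otimes>\<^sub>M \<pi>"
  note N = P2_facts[OF P(2)]
  note cf = coupling_facts[OF pi N(1)]
  interpret p: prob_space \<pi> by (rule cf)
  have sp: "sets \<pi> = sets (borel \<Otimes>\<^sub>M borel)" using pi by (simp add: coupling_def)
  note [measurable_cong] = sp
  define n where "n = real (card I)"
  have n: "n > 0" using I by (simp add: n_def card_gt_0_iff)
  \<comment> \<open>The sets \<open>W i\<close> may overlap. Each contributes a density c / Q i
    \<le> 1/n to \<open>s\<close>, so that \<open>s\<close> stays below 1.\<close>
  define c where "c = m / n"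
  have c: "c > 0" using m n by (simp add: c_def)
  define Q where "Q i = measure \<pi> (W i)" for i
  have Q: "Q i \<ge> m" "Q i > 0" if "i \<in> I" for i using W(2)[OF that] m by (simp_all add: Q_def)
  have \<tau>I: "\<tau> i \<in> I" if "i \<in> I" for i using I(3) that by (auto simp: bij_betw_def)
  have [measurable]: "W i \<in> sets \<pi>" if "i \<in> I" for i using W(1)[OF that] cf(1) by simp
  have [measurable]: "W (\<tau> i) \<in> sets \<pi>" if "i \<in> I" for i using W(1)[OF \<tau>I[OF that]] cf(1) by simp
  \<comment> \<open>Normalised so that each product of \<open>W (\<tau> i)\<close> and
    \<open>W i\<close> carries mass c under \<open>w\<close>.\<close>
  define k where "k i = ennreal (c / (Q (\<tau> i) * Q i))" for i
  have k1: "k i * ennreal (Q (\<tau> i)) = ennreal (c / Q i)" and k2: "k i * ennreal (Q i) = ennreal (c / Q (\<tau> i))"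
    and k12: "k i * (ennreal (Q (\<tau> i)) * ennreal (Q i)) = ennreal c" if "i \<in> I" for i
    using Q[OF that] Q[OF \<tau>I[OF that]] c unfolding k_def by (simp_all flip: ennreal_mult)
  define one :: "'i \<Rightarrow> ('a \<times> 'a) \<times> ('a \<times> 'a) \<Rightarrow> ennreal" where
    "one i u = indicator (W (\<tau> i)) (fst u) * indicator (W i) (snd u)" for i u
  define w where "w u = (\<Sum>i\<in>I. k i * one i u)" for u
  define s where "s z = (\<Sum>i\<in>I. ennreal (c / Q i) * indicator (W i) z)" for z
  have one[measurable]: "one i \<in> borel_measurable ?PP" if "i \<in> I" for i
    unfolding one_def using that by measurable
  have w[measurable]: "w \<in> borel_measurable ?PP" unfolding w_def by measurable
  have s[measurable]: "s \<in> borel_measurable \<pi>" unfolding s_def by measurable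
  have emW: "(\<integral>\<^sup>+z. indicator (W i) z \<partial>\<pi>) = ennreal (Q i)" if "i \<in> I" for i
    using that by (simp add: Q_def p.emeasure_eq_measure)
  have sH: "(\<integral>\<^sup>+z. s z * H z \<partial>\<pi>) = (\<Sum>i\<in>I. ennreal (c / Q i) * (\<integral>\<^sup>+z. indicator (W i) z * H z \<partial>\<pi>))" if [measurable]: "H \<in> borel_measurable \<pi>" for H
    unfolding s_def sum_distrib_right by (subst nn_integral_sum) (auto intro!: sum.cong simp: mult.assoc nn_integral_cmult)
  have m2: "(\<integral>\<^sup>+u. w u * H (snd u) \<partial>?PP) = (\<integral>\<^sup>+z. s z * H z \<partial>\<pi>)" if H[measurable]: "H \<in> borel_measurable \<pi>" for H
  proof -
    have "(\<integral>\<^sup>+u. w u * H (snd u) \<partial>?PP) = (\<Sum>i\<in>I. (\<integral>\<^sup>+u. k i * (indicator (W (\<tau> i)) (fst u) * (indicator (W i) (snd u) * H (snd u))) \<partial>?PP))"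
      unfolding w_def sum_distrib_right one_def by (subst nn_integral_sum) (auto intro!: sum.cong nn_integral_cong simp: mult.assoc)
    also have "\<dots> = (\<Sum>i\<in>I. ennreal (c / Q i) * (\<integral>\<^sup>+z. indicator (W i) z * H z \<partial>\<pi>))"
    proof (rule sum.cong[OF refl])
      fix i assume i: "i \<in> I"
      have "(\<integral>\<^sup>+u. k i * (indicator (W (\<tau> i)) (fst u) * (indicator (W i) (snd u) * H (snd u))) \<partial>?PP)
        = k i * (\<integral>\<^sup>+u. indicator (W (\<tau> i)) (fst u) * (indicator (W i) (snd u) * H (snd u)) \<partial>?PP)"
        using i by (intro nn_integral_cmult) measurable
      also have "\<dots> = k i * (ennreal (Q (\<tau> i)) * (\<integral>\<^sup>+z. indicator (W i) z * H z \<partial>\<pi>))"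
        using i nn_integral_pair_mult[OF p.prob_space_axioms, of "indicator (W (\<tau> i))" "\<lambda>z. indicator (W i) z * H z"] emW[OF \<tau>I[OF i]] by simp
      finally show "(\<integral>\<^sup>+u. k i * (indicator (W (\<tau> i)) (fst u) * (indicator (W i) (snd u) * H (snd u))) \<partial>?PP) = ennreal (c / Q i) * (\<integral>\<^sup>+z. indicator (W i) z * H z \<partial>\<pi>)"
        using k1[OF i] by (simp flip: mult.assoc)
    qed
    finally show ?thesis using sH[OF H] by simp
  qed
  have m1: "(\<integral>\<^sup>+u. w u * H (fst u) \<partial>?PP) = (\<integral>\<^sup>+z. s z * H z \<partial>\<pi>)" if H[measurable]: "H \<in> borel_measurable \<pi>" for H
  proof -
    have "(\<integral>\<^sup>+u. w u * H (fst u) \<partial>?PP) = (\<Sum>i\<in>I. (\<integral>\<^sup>+u. k i * ((indicator (W (\<tau> i)) (fst u) * H (fst u)) * indicator (W i) (snd u)) \<partial>?PP))"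
      unfolding w_def sum_distrib_right one_def by (subst nn_integral_sum) (auto intro!: sum.cong nn_integral_cong simp: ac_simps)
    also have "\<dots> = (\<Sum>i\<in>I. ennreal (c / Q (\<tau> i)) * (\<integral>\<^sup>+z. indicator (W (\<tau> i)) z * H z \<partial>\<pi>))"
    proof (rule sum.cong[OF refl])
      fix i assume i: "i \<in> I"
      have "(\<integral>\<^sup>+u. k i * ((indicator (W (\<tau> i)) (fst u) * H (fst u)) * indicator (W i) (snd u)) \<partial>?PP)
        = k i * (\<integral>\<^sup>+u. (indicator (W (\<tau> i)) (fst u) * H (fst u)) * indicator (W i) (snd u) \<partial>?PP)"
        using i by (intro nn_integral_cmult) measurable
      also have "\<dots> = k i * ((\<integral>\<^sup>+z. indicator (W (\<tau> i)) z * H z \<partial>\<pi>) * ennreal (Q i))"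
        using i nn_integral_pair_mult[OF p.prob_space_axioms, of "\<lambda>z. indicator (W (\<tau> i)) z * H z" "indicator (W i)"] emW[OF i] by simp
      finally show "(\<integral>\<^sup>+u. k i * ((indicator (W (\<tau> i)) (fst u) * H (fst u)) * indicator (W i) (snd u)) \<partial>?PP) = ennreal (c / Q (\<tau> i)) * (\<integral>\<^sup>+z. indicator (W (\<tau> i)) z * H z \<partial>\<pi>)"
        by (simp only: k2[OF i, symmetric] ac_simps)
    qed
    also have "\<dots> = (\<integral>\<^sup>+z. s z * H z \<partial>\<pi>)"
      unfolding sH[OF H] by (rule sum.reindex_bij_betw[OF I(3)])
    finally show ?thesis .
  qed
  have s1: "s z \<le> 1" for z
  proof -
    have "s z \<le> (\<Sum>i\<in>I. ennreal (1 / n))"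
      unfolding s_def
    proof (rule sum_mono)
      fix i assume i: "i \<in> I"
      have "c / Q i \<le> c / m" using Q[OF i] m c by (intro divide_left_mono) auto
      then have "ennreal (c / Q i) \<le> ennreal (1 / n)" using m n by (intro ennreal_leI) (simp add: c_def)
      then show "ennreal (c / Q i) * indicator (W i) z \<le> ennreal (1 / n)" by (simp add: indicator_def)
    qed
    also have "\<dots> = 1" using n by (simp add: n_def ennreal_of_nat_eq_real_of_nat flip: ennreal_mult)
    finally show ?thesis .
  qed
  define X where "X = (\<integral>\<^sup>+u. w u * ennreal ((norm (fst (snd u) - snd (snd u) - \<delta> *\<^sub>R (snd (fst u) - snd (snd u))))\<^sup>2) \<partial>?PP)"
  define Y where "Y = (\<integral>\<^sup>+z. s z * sq_cost z \<partial>\<pi>)"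
  define D where "D = (\<integral>\<^sup>+z. (1 - s z) * sq_cost z \<partial>\<pi>)"
  have DY: "D + Y = (\<integral>\<^sup>+z. sq_cost z \<partial>\<pi>)"
    unfolding D_def Y_def by (rule nn_integral_split_weight[OF s _ s1]) measurable
  \<comment> \<open>The \<open>v i\<close> may be negative; shifting them by \<open>K\<close> on
    both sides makes every term nonnegative, and the shift cancels in
    \<open>S1 - S2\<close>.\<close>
  define K where "K = (\<Sum>i\<in>I. \<bar>v i\<bar>)"
  have K: "\<bar>v i\<bar> \<le> K" if "i \<in> I" for i unfolding K_def using that I(1) by (intro member_le_sum) auto
  have K0: "K \<ge> 0" unfolding K_def by (simp add: sum_nonneg)
  have int_one: "(\<integral>\<^sup>+u. (\<Sum>i\<in>I. k i * one i u * ennreal (r i)) \<partial>?PP) = (\<Sum>i\<in>I. ennreal c * ennreal (r i))" for r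
  proof -
    have "(\<integral>\<^sup>+u. (\<Sum>i\<in>I. k i * one i u * ennreal (r i)) \<partial>?PP) = (\<Sum>i\<in>I. (\<integral>\<^sup>+u. k i * one i u * ennreal (r i) \<partial>?PP))"
      by (rule nn_integral_sum) measurable
    also have "\<dots> = (\<Sum>i\<in>I. ennreal c * ennreal (r i))"
    proof (rule sum.cong[OF refl])
      fix i assume i: "i \<in> I"
      have "(\<integral>\<^sup>+u. one i u \<partial>?PP) = ennreal (Q (\<tau> i)) * ennreal (Q i)"
        unfolding one_def using i nn_integral_pair_mult[OF p.prob_space_axioms, of "indicator (W (\<tau> i))" "indicator (W i)"] emW[OF i] emW[OF \<tau>I[OF i]] by simp
      then show "(\<integral>\<^sup>+u. k i * one i u * ennreal (r i) \<partial>?PP) = ennreal c * ennreal (r i)"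
        using one[OF i] k12[OF i] by (simp add: nn_integral_multc nn_integral_cmult)
    qed
    finally show ?thesis .
  qed
  \<comment> \<open>Kept additive because X is not yet known to be finite; its finiteness is deduced
    from this inequality.\<close>
  have XY: "X + (\<Sum>i\<in>I. ennreal c * ennreal (2 * \<delta> * (v i + K))) \<le> Y + (\<Sum>i\<in>I. ennreal c * ennreal (2 * \<delta> * K + \<delta>\<^sup>2 * B))"
  proof -
    have m_w: "(\<lambda>u. w u * ennreal ((norm (fst (snd u) - snd (snd u) - \<delta> *\<^sub>R (snd (fst u) - snd (snd u))))\<^sup>2)) \<in> borel_measurable ?PP"
      "(\<lambda>u. w u * ennreal ((norm (fst (snd u) - snd (snd u)))\<^sup>2)) \<in> borel_measurable ?PP" by measurable
    have m_s: "(\<lambda>u. \<Sum>i\<in>I. k i * one i u * ennreal (r i)) \<in> borel_measurable ?PP" for r by measurable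
    have "X + (\<Sum>i\<in>I. ennreal c * ennreal (2 * \<delta> * (v i + K))) = (\<integral>\<^sup>+u. w u * ennreal ((norm (fst (snd u) - snd (snd u) - \<delta> *\<^sub>R (snd (fst u) - snd (snd u))))\<^sup>2) + (\<Sum>i\<in>I. k i * one i u * ennreal (2 * \<delta> * (v i + K))) \<partial>?PP)"
      unfolding X_def int_one[symmetric] by (rule nn_integral_add[symmetric, OF m_w(1) m_s])
    also have "\<dots> \<le> (\<integral>\<^sup>+u. w u * ennreal ((norm (fst (snd u) - snd (snd u)))\<^sup>2) + (\<Sum>i\<in>I. k i * one i u * ennreal (2 * \<delta> * K + \<delta>\<^sup>2 * B)) \<partial>?PP)"
    proof (rule nn_integral_mono)
      fix u :: "('a \<times> 'a) \<times> ('a \<times> 'a)"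
      let ?p = "fst (snd u) - snd (snd u)" and ?d = "snd (fst u) - snd (snd u)"
      have "w u * ennreal ((norm (?p - \<delta> *\<^sub>R ?d))\<^sup>2) + (\<Sum>i\<in>I. k i * one i u * ennreal (2 * \<delta> * (v i + K)))
        = (\<Sum>i\<in>I. k i * one i u * (ennreal ((norm (?p - \<delta> *\<^sub>R ?d))\<^sup>2) + ennreal (2 * \<delta> * (v i + K))))"
        unfolding w_def by (simp add: sum_distrib_right distrib_left sum.distrib)
      also have "\<dots> \<le> (\<Sum>i\<in>I. k i * one i u * (ennreal ((norm ?p)\<^sup>2) + ennreal (2 * \<delta> * K + \<delta>\<^sup>2 * B)))"
      proof (rule sum_mono)
        fix i assume i: "i \<in> I"
        show "k i * one i u * (ennreal ((norm (?p - \<delta> *\<^sub>R ?d))\<^sup>2) + ennreal (2 * \<delta> * (v i + K))) \<le> k i * one i u * (ennreal ((norm ?p)\<^sup>2) + ennreal (2 * \<delta> * K + \<delta>\<^sup>2 * B))"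
        proof (cases "fst u \<in> W (\<tau> i) \<and> snd u \<in> W i")
          case True
          then have "v i \<le> ?p \<bullet> ?d" "(norm ?d)\<^sup>2 \<le> B" using v[OF i] B(1)[OF i] by blast+
          then have "2 * \<delta> * v i \<le> 2 * \<delta> * (?p \<bullet> ?d)" "\<delta>\<^sup>2 * (norm ?d)\<^sup>2 \<le> \<delta>\<^sup>2 * B" using dl by (auto intro!: mult_left_mono)
          moreover have "(norm (?p - \<delta> *\<^sub>R ?d))\<^sup>2 = (norm ?p)\<^sup>2 - 2 * \<delta> * (?p \<bullet> ?d) + \<delta>\<^sup>2 * (norm ?d)\<^sup>2"
            unfolding power2_norm_eq_inner by (simp add: inner_diff_left[of ?p] inner_diff_right[of _ ?p] inner_commute[of ?d ?p] power2_eq_square right_diff_distrib)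
          ultimately have "(norm (?p - \<delta> *\<^sub>R ?d))\<^sup>2 + 2 * \<delta> * (v i + K) \<le> (norm ?p)\<^sup>2 + (2 * \<delta> * K + \<delta>\<^sup>2 * B)"
            by (simp add: distrib_left)
          from ennreal_leI[OF this] show ?thesis
            using dl K[OF i] K0 B(2) by (intro mult_left_mono) (simp_all flip: ennreal_plus)
        next
          case False
          then have "one i u = 0" unfolding one_def by (auto simp: indicator_def)
          then show ?thesis by simp
        qed
      qed
      also have "\<dots> = w u * ennreal ((norm ?p)\<^sup>2) + (\<Sum>i\<in>I. k i * one i u * ennreal (2 * \<delta> * K + \<delta>\<^sup>2 * B))"
        unfolding w_def by (simp add: sum_distrib_right distrib_left sum.distrib)
      finally show "w u * ennreal ((norm (?p - \<delta> *\<^sub>R ?d))\<^sup>2) + (\<Sum>i\<in>I. k i * one i u * ennreal (2 * \<delta> * (v i + K)))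
        \<le> w u * ennreal ((norm ?p)\<^sup>2) + (\<Sum>i\<in>I. k i * one i u * ennreal (2 * \<delta> * K + \<delta>\<^sup>2 * B))" .
    qed
    also have "\<dots> = Y + (\<Sum>i\<in>I. ennreal c * ennreal (2 * \<delta> * K + \<delta>\<^sup>2 * B))"
      unfolding Y_def int_one[symmetric] by (subst nn_integral_add[OF m_w(2) m_s]) (simp add: m2[of "\<lambda>z. sq_cost z"])
    finally show ?thesis .
  qed
  obtain t where t: "T2 \<mu> \<nu> = ennreal t" "t \<ge> 0" using fin by (metis enn2real_nonneg ennreal_enn2real infinity_ennreal_def)
  have DYle: "D + Y \<le> ennreal (t + e)" using near t e by (simp add: DY)
  then have "D + Y < \<infinity>" by (rule le_less_trans) simp
  then obtain dr yr where dy: "D = ennreal dr" "dr \<ge> 0" "Y = ennreal yr" "yr \<ge> 0"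
    by (metis add_top_left_ennreal add_top_right_ennreal enn2real_nonneg ennreal_enn2real infinity_ennreal_def less_irrefl top.not_eq_extremum)
  have sum_e: "(\<Sum>i\<in>I. ennreal c * ennreal (r i)) = ennreal (\<Sum>i\<in>I. c * r i)" if "\<And>i. i \<in> I \<Longrightarrow> r i \<ge> 0" for r
    using that c by (subst sum_ennreal[symmetric]) (auto intro!: sum.cong simp: ennreal_mult)
  have nn1: "0 \<le> 2 * \<delta> * (v i + K)" if "i \<in> I" for i using dl K[OF that] by simp
  have nn2: "0 \<le> 2 * \<delta> * K + \<delta>\<^sup>2 * B" using dl K0 B(2) by simp
  define S1 where "S1 = (\<Sum>i\<in>I. c * (2 * \<delta> * (v i + K)))"
  define S2 where "S2 = (\<Sum>i\<in>I. c * (2 * \<delta> * K + \<delta>\<^sup>2 * B))"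
  have S: "S1 \<ge> 0" "S2 \<ge> 0" unfolding S1_def S2_def using c nn1 nn2 by (auto intro!: sum_nonneg)
  have "X + ennreal S1 \<le> ennreal (yr + S2)"
    using XY dy(3,4) S sum_e[of "\<lambda>i. 2 * \<delta> * (v i + K)"] sum_e[of "\<lambda>_. 2 * \<delta> * K + \<delta>\<^sup>2 * B"] nn1 nn2 unfolding S1_def S2_def by simp
  moreover from this have "X + ennreal S1 < \<infinity>" by (rule le_less_trans) simp
  then obtain xr where x: "X = ennreal xr" "xr \<ge> 0" by (metis add_top_right_ennreal add.commute enn2real_nonneg ennreal_enn2real infinity_ennreal_def less_irrefl top.not_eq_extremum)
  ultimately have xle: "xr + S1 \<le> yr + S2" using S dy(4) by (simp flip: ennreal_plus)
  have fin': "(\<integral>\<^sup>+z. sq_cost z \<partial>\<pi>) < \<infinity>" using \<open>D + Y < \<infinity>\<close> DY by simp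
  have "T2 \<mu> \<nu> \<le> D + ennreal (1 / (1 + \<delta>)) * X + ennreal (\<delta> / (1 + \<delta>)) * Y"
    unfolding D_def Y_def by (rule perturbation_cost[OF P opt pi fin' w s s1 m1 m2 dl X_def]) (simp_all add: x)
  moreover have "ennreal x1 + ennreal x2 * ennreal x3 + ennreal x4 * ennreal x5 = ennreal (x1 + x2 * x3 + x4 * x5)"
    if "x1 \<ge> 0" "x2 \<ge> 0" "x3 \<ge> 0" "x4 \<ge> 0" "x5 \<ge> 0" for x1 x2 x3 x4 x5
    using that by (simp add: ennreal_plus ennreal_mult)
  ultimately have "ennreal t \<le> ennreal (dr + 1 / (1 + \<delta>) * xr + \<delta> / (1 + \<delta>) * yr)"
    using dy x dl t by (metis add_nonneg_nonneg divide_nonneg_nonneg less_imp_le zero_le_one)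
  then have tle: "t \<le> dr + 1 / (1 + \<delta>) * xr + \<delta> / (1 + \<delta>) * yr" using dy x dl by (subst (asm) ennreal_le_iff) auto
  have "dr + yr \<le> t + e" using DYle dy t e by (simp flip: ennreal_plus)
  moreover have "1 / (1 + \<delta>) * xr + \<delta> / (1 + \<delta>) * yr \<le> yr - 1 / (1 + \<delta>) * (S1 - S2)"
  proof -
    have "1 / (1 + \<delta>) * xr \<le> 1 / (1 + \<delta>) * (yr + S2 - S1)" using xle dl by (intro mult_left_mono) auto
    moreover have "1 / (1 + \<delta>) * yr + \<delta> / (1 + \<delta>) * yr = yr"
    proof -
      have "1 / (1 + \<delta>) + \<delta> / (1 + \<delta>) = 1" using dl by (simp flip: add_divide_distrib)
      then show ?thesis by (metis distrib_right mult_1)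
    qed
    ultimately show ?thesis by (simp only: right_diff_distrib distrib_left)
  qed
  ultimately have "1 / (1 + \<delta>) * (S1 - S2) \<le> e" using tle by linarith
  moreover have "S1 - S2 = c * (2 * \<delta> * (\<Sum>i\<in>I. v i) - \<delta>\<^sup>2 * n * B)"
  proof -
    have "S1 - S2 = (\<Sum>i\<in>I. (c * (2 * \<delta>)) * v i - c * (\<delta>\<^sup>2 * B))"
      unfolding S1_def S2_def sum_subtractf[symmetric] by (intro sum.cong refl) (simp add: algebra_simps)
    also have "\<dots> = c * (2 * \<delta>) * (\<Sum>i\<in>I. v i) - n * (c * (\<delta>\<^sup>2 * B))"
      by (simp only: sum_subtractf sum_distrib_left[symmetric] sum_constant n_def) (simp add: ac_simps)
    also have "\<dots> = c * (2 * \<delta> * (\<Sum>i\<in>I. v i) - \<delta>\<^sup>2 * n * B)" by (simp add: algebra_simps)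
    finally show ?thesis .
  qed
  ultimately show ?thesis by (simp add: c_def n_def mult.commute[of "1 + \<delta>" "real (card I)"])
qed

text \<open>A diagonal subsequence makes the masses of all sets of a countable basis converge;
  \<Gamma> consists of the points all of whose basic neighbourhoods have a positive limit. A compact
  set missing \<Gamma> is covered by finitely many basic sets with limit 0. Without tightness
  \<Gamma> might be empty, which is excluded later.\<close>

lemma asymptotic_support:
  fixes \<pi> :: "nat \<Rightarrow> 'b::second_countable_topology measure"
  assumes p: "\<And>n. prob_space (\<pi> n)" and s: "\<And>n. sets (\<pi> n) = sets borel"
  obtains k \<Gamma> where "strict_mono (k :: nat \<Rightarrow> nat)"
    "\<And>z W. z \<in> \<Gamma> \<Longrightarrow> open W \<Longrightarrow> z \<in> W \<Longrightarrow> \<exists>m>0. \<forall>\<^sub>F n in sequentially. m \<le> measure (\<pi> (k n)) W"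
    "\<And>K. compact K \<Longrightarrow> K \<inter> \<Gamma> = {} \<Longrightarrow> K \<in> sets borel \<Longrightarrow> (\<lambda>n. measure (\<pi> (k n)) K) \<longlonglongrightarrow> 0"
proof -
  obtain \<B> :: "'b set set" where B: "countable \<B>" "topological_basis \<B>" using ex_countable_basis by blast
  have Bo: "open U" if "U \<in> \<B>" for U using B(2) that by (rule topological_basis_open)
  have fm: "finite_measure (\<pi> n)" for n using p prob_space.finite_measure by blast
  have le1: "norm (measure (\<pi> n) U) \<le> 1" for n U using prob_space.prob_le_1[OF p] by simp
  obtain k :: "nat \<Rightarrow> nat" where k: "strict_mono k" "\<And>U. U \<in> \<B> \<Longrightarrow> \<exists>l. (\<lambda>n. measure (\<pi> (k n)) U) \<longlonglongrightarrow> l"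
    using function_convergent_subsequence[OF B(1), of "\<lambda>n U. measure (\<pi> n) U" 1] le1 by metis
  then obtain l where l: "\<And>U. U \<in> \<B> \<Longrightarrow> (\<lambda>n. measure (\<pi> (k n)) U) \<longlonglongrightarrow> l U" by metis
  have l0: "l U \<ge> 0" if "U \<in> \<B>" for U using l[OF that] by (rule LIMSEQ_le_const) simp
  define \<Gamma> where "\<Gamma> = {z. \<forall>U\<in>\<B>. z \<in> U \<longrightarrow> l U > 0}"
  have on_support: "\<exists>m>0. \<forall>\<^sub>F n in sequentially. m \<le> measure (\<pi> (k n)) W" if z: "z \<in> \<Gamma>" "open W" "z \<in> W" for z W
  proof -
    obtain U where U: "U \<in> \<B>" "z \<in> U" "U \<subseteq> W" using topological_basisE[OF B(2) z(2,3)] by blast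
    then have lU: "l U > 0" using z(1) by (auto simp: \<Gamma>_def)
    have "\<forall>\<^sub>F n in sequentially. l U / 2 < measure (\<pi> (k n)) U" using l[OF U(1)] lU by (intro order_tendstoD) auto
    then have "\<forall>\<^sub>F n in sequentially. l U / 2 \<le> measure (\<pi> (k n)) W"
    proof eventually_elim
      case (elim n)
      have "measure (\<pi> (k n)) U \<le> measure (\<pi> (k n)) W"
        using U(3) z(2) s by (intro finite_measure.finite_measure_mono[OF fm]) auto
      then show ?case using elim by simp
    qed
    then show ?thesis using lU by (intro exI[of _ "l U / 2"]) auto
  qed
  have off_support: "(\<lambda>n. measure (\<pi> (k n)) K) \<longlonglongrightarrow> 0" if K: "compact K" "K \<inter> \<Gamma> = {}" "K \<in> sets borel" for K
  proof -
    have "K \<subseteq> \<Union>{U\<in>\<B>. l U = 0}"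
    proof
      fix z assume "z \<in> K"
      then obtain U where "U \<in> \<B>" "z \<in> U" "\<not> l U > 0" using K(2) by (auto simp: \<Gamma>_def)
      then show "z \<in> \<Union>{U\<in>\<B>. l U = 0}" using l0[of U] by force
    qed
    then obtain F where F: "F \<subseteq> {U\<in>\<B>. l U = 0}" "finite F" "K \<subseteq> \<Union>F"
      using compactE[OF K(1), of "{U\<in>\<B>. l U = 0}"] Bo by blast
    have "(\<lambda>n. \<Sum>U\<in>F. measure (\<pi> (k n)) U) \<longlonglongrightarrow> (\<Sum>U\<in>F. 0)"
    proof (rule tendsto_sum)
      fix U assume "U \<in> F"
      then show "(\<lambda>n. measure (\<pi> (k n)) U) \<longlonglongrightarrow> 0" using l[of U] F(1) by auto
    qed
    then have lim: "(\<lambda>n. \<Sum>U\<in>F. measure (\<pi> (k n)) U) \<longlonglongrightarrow> 0" by simp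
    have le: "measure (\<pi> (k n)) K \<le> (\<Sum>U\<in>F. measure (\<pi> (k n)) U)" for n
    proof -
      have Fs: "U \<in> sets (\<pi> (k n))" if "U \<in> F" for U using that F(1) Bo s by auto
      have "measure (\<pi> (k n)) K \<le> measure (\<pi> (k n)) (\<Union>U\<in>F. U)"
        using F(2,3) Fs by (intro finite_measure.finite_measure_mono[OF fm]) auto
      also have "\<dots> \<le> (\<Sum>U\<in>F. measure (\<pi> (k n)) U)"
        using Fs by (intro finite_measure.finite_measure_subadditive_finite[OF fm F(2)]) auto
      finally show ?thesis .
    qed
    show ?thesis by (rule Lim_null_comparison[OF _ lim]) (simp add: le)
  qed
  show ?thesis using k(1) on_support off_support by (rule that)
qed

section \<open>Minimizers give expansions\<close>

lemma T2_finite: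
  fixes \<mu> \<nu> :: "'a::euclidean_space measure"
  assumes P: "P2 \<mu>" "P2 \<nu>"
  shows "T2 \<mu> \<nu> < \<infinity>"
proof -
  note N = P2_facts[OF P(2)] and M = P2_facts[OF P(1)]
  interpret M: prob_space \<mu> by (rule M)
  interpret N: prob_space \<nu> by (rule N)
  interpret MN: pair_prob_space \<mu> \<nu> ..
  note [measurable_cong] = M(2) N(2)
  have s: "sets (\<mu> \<Otimes>\<^sub>M \<nu>) = sets (borel \<Otimes>\<^sub>M borel)" using M(2) N(2) by (rule sets_pair_measure_cong)
  have "distr (\<mu> \<Otimes>\<^sub>M \<nu>) borel fst = distr (\<mu> \<Otimes>\<^sub>M \<nu>) \<mu> fst" by (rule distr_cong) (simp_all add: M(2))
  then have f: "distr (\<mu> \<Otimes>\<^sub>M \<nu>) borel fst = \<mu>" using N.distr_pair_fst by simp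
  have g: "distr (\<mu> \<Otimes>\<^sub>M \<nu>) borel snd = \<nu>"
  proof (rule measure_eqI)
    fix A :: "'a set" assume "A \<in> sets (distr (\<mu> \<Otimes>\<^sub>M \<nu>) borel snd)"
    then have A[measurable]: "A \<in> sets borel" by simp
    have "snd -` A \<inter> space (\<mu> \<Otimes>\<^sub>M \<nu>) = space \<mu> \<times> A" using M(3) N(3) by (auto simp: space_pair_measure)
    then have "emeasure (distr (\<mu> \<Otimes>\<^sub>M \<nu>) borel snd) A = emeasure (\<mu> \<Otimes>\<^sub>M \<nu>) (space \<mu> \<times> A)"
      by (subst emeasure_distr) auto
    also have "\<dots> = emeasure \<nu> A" using A N(2) by (subst N.emeasure_pair_measure_Times) (auto simp: M.emeasure_space_1)
    finally show "emeasure (distr (\<mu> \<Otimes>\<^sub>M \<nu>) borel snd) A = emeasure \<nu> A" .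
  qed (use N in simp)
  have c: "coupling \<mu> \<nu> (\<mu> \<Otimes>\<^sub>M \<nu>)" using s f g by (simp add: coupling_def)
  note cf = coupling_facts[OF c N(1)]
  have "T2 \<mu> \<nu> \<le> (\<integral>\<^sup>+z. sq_cost z \<partial>(\<mu> \<Otimes>\<^sub>M \<nu>))"
    unfolding T2_def using c by (intro INF_lower) simp
  also have "\<dots> \<le> (\<integral>\<^sup>+z. 2 * ennreal ((norm (fst z))\<^sup>2) + 2 * ennreal ((norm (snd z))\<^sup>2) \<partial>(\<mu> \<Otimes>\<^sub>M \<nu>))"
  proof (rule nn_integral_mono)
    fix z :: "'a \<times> 'a"
    have "(norm (fst z - snd z))\<^sup>2 + (norm (fst z + snd z))\<^sup>2 = 2 * (norm (fst z))\<^sup>2 + 2 * (norm (snd z))\<^sup>2"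
      unfolding power2_norm_eq_inner by (simp add: inner_add_left inner_add_right inner_diff_left inner_diff_right inner_commute)
    then have "(norm (fst z - snd z))\<^sup>2 \<le> 2 * (norm (fst z))\<^sup>2 + 2 * (norm (snd z))\<^sup>2"
      using zero_le_power2[of "norm (fst z + snd z)"] by linarith
    from ennreal_leI[OF this]
    show "sq_cost z \<le> 2 * ennreal ((norm (fst z))\<^sup>2) + 2 * ennreal ((norm (snd z))\<^sup>2)"
      by (simp add: ennreal_plus ennreal_mult)
  qed
  also have "\<dots> = 2 * (\<integral>\<^sup>+x. ennreal ((norm x)\<^sup>2) \<partial>\<mu>) + 2 * (\<integral>\<^sup>+x. ennreal ((norm x)\<^sup>2) \<partial>\<nu>)"
    using coupling_fst_nn[OF c N(1), of "\<lambda>x. ennreal ((norm x)\<^sup>2)"] coupling_snd_nn[OF c N(1), of "\<lambda>x. ennreal ((norm x)\<^sup>2)"]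
    by (subst nn_integral_add) (simp_all add: nn_integral_cmult)
  also have "\<dots> < \<infinity>"
    using nn_integral_eq_integral[OF N(4)] nn_integral_eq_integral[OF M(4)] by (simp add: ennreal_mult_less_top)
  finally show ?thesis .
qed

lemma near_optimal_support_monotone:
  fixes \<mu> \<nu> :: "'a::euclidean_space measure"
  assumes P: "P2 \<mu>" "P2 \<nu>" and opt: "\<And>\<xi>. \<xi> \<in> Pcx \<mu> \<Longrightarrow> T2 \<mu> \<nu> \<le> T2 \<xi> \<nu>"
    and pi: "\<And>n. coupling \<mu> \<nu> (\<pi> n)"
    and near: "\<And>n. (\<integral>\<^sup>+z. sq_cost z \<partial>\<pi> n) \<le> T2 \<mu> \<nu> + ennreal (e n)"
    and e: "\<And>n. e n \<ge> 0" "e \<longlonglongrightarrow> 0"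
    and supp: "\<And>z W. z \<in> \<Gamma> \<Longrightarrow> open W \<Longrightarrow> z \<in> W \<Longrightarrow> \<exists>m>0. \<forall>\<^sub>F n in sequentially. m \<le> measure (\<pi> n) W"
    and z0: "z0 \<in> \<Gamma>" and ch: "(p, c) \<in> chain_affine \<Gamma> z0"
  shows "p \<bullet> snd z0 - c \<le> 0"
proof (rule ccontr)
  define S where "S = p \<bullet> snd z0 - c"
  assume "\<not> p \<bullet> snd z0 - c \<le> 0"
  then have S: "S > 0" by (simp add: S_def)
  obtain N z where z: "z 0 = z0" "\<And>i. i \<le> N \<Longrightarrow> z i \<in> \<Gamma>" "p = fst (z N) - snd (z N)"
    "p \<bullet> snd z0 - c = (\<Sum>i<N. (fst (z i) - snd (z i)) \<bullet> (snd (z (Suc i)) - snd (z i))) + (fst (z N) - snd (z N)) \<bullet> (snd z0 - snd (z N))"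
    using chain_affine_path[OF ch z0] by blast
  \<comment> \<open>The cyclic successor on 0..N: it closes the chain by returning from its last
    point to \<open>z0\<close>.\<close>
  define \<tau> where "\<tau> i = (if i = N then 0 else Suc i)" for i
  have tau: "bij_betw \<tau> {..N} {..N}"
    unfolding \<tau>_def by (rule bij_betwI[where g="\<lambda>j. if j = 0 then N else j - 1"]) auto
  have tauI: "\<tau> i \<le> N" if "i \<le> N" for i using that by (auto simp: \<tau>_def)
  define V where "V u u' = (fst u' - snd u') \<bullet> (snd u - snd u')" for u u' :: "'a \<times> 'a"
  have SV: "S = (\<Sum>i\<le>N. V (z (\<tau> i)) (z i))"
  proof -
    have "(\<Sum>i\<le>N. V (z (\<tau> i)) (z i)) = (\<Sum>i<N. V (z (\<tau> i)) (z i)) + V (z (\<tau> N)) (z N)"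
      by (simp add: lessThan_Suc_atMost[symmetric])
    also have "(\<Sum>i<N. V (z (\<tau> i)) (z i)) = (\<Sum>i<N. (fst (z i) - snd (z i)) \<bullet> (snd (z (Suc i)) - snd (z i)))"
      by (intro sum.cong) (auto simp: \<tau>_def V_def)
    finally show ?thesis using z(4,1) by (simp add: S_def \<tau>_def V_def)
  qed
  define n where "n = real (N + 1)"
  have n: "n > 0" by (simp add: n_def)
  \<comment> \<open>Each of the n inner products gives up S/(2n). This leaves room for open
    neighbourhoods while the lower bounds still add up to S/2.\<close>
  define v where "v i = V (z (\<tau> i)) (z i) - S / (2 * n)" for i
  have sv: "(\<Sum>i\<le>N. v i) = S / 2"
    unfolding v_def sum_subtractf SV[symmetric] using n by (simp add: n_def field_simps)
  \<comment> \<open>The added 1 makes the bound strict at the centres, so that it persists nearby,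
    and keeps B positive when all second coordinates coincide.\<close>
  define B where "B = (\<Sum>i\<le>N. (norm (snd (z (\<tau> i)) - snd (z i)))\<^sup>2 + 1)"
  have B1: "(norm (snd (z (\<tau> i)) - snd (z i)))\<^sup>2 + 1 \<le> B" if "i \<le> N" for i
    unfolding B_def using that by (intro member_le_sum[of i "{..N}" "\<lambda>i. (norm (snd (z (\<tau> i)) - snd (z i)))\<^sup>2 + 1"]) auto
  have B: "B > 0" using B1[of 0] zero_le_power2[of "norm (snd (z (\<tau> 0)) - snd (z 0))"] by linarith
  define good where "good i AA \<longleftrightarrow> open (fst AA) \<and> open (snd AA) \<and> z (\<tau> i) \<in> fst AA \<and> z i \<in> snd AA \<and>
    (\<forall>u\<in>fst AA. \<forall>u'\<in>snd AA. v i < V u u' \<and> (norm (snd u - snd u'))\<^sup>2 < B)" for i AA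
  have "\<exists>AA. good i AA" if i: "i \<le> N" for i
  proof -
    have "open {uu. v i < V (fst uu) (snd uu) \<and> (norm (snd (fst uu) - snd (snd uu)))\<^sup>2 < B}"
      unfolding V_def by (intro open_Collect_conj open_Collect_less continuous_intros)
    moreover have "(z (\<tau> i), z i) \<in> {uu. v i < V (fst uu) (snd uu) \<and> (norm (snd (fst uu) - snd (snd uu)))\<^sup>2 < B}"
      using B1[OF i] S n by (simp add: v_def)
    ultimately obtain A A' where AA: "open A" "open A'" "(z (\<tau> i), z i) \<in> A \<times> A'"
      "A \<times> A' \<subseteq> {uu. v i < V (fst uu) (snd uu) \<and> (norm (snd (fst uu) - snd (snd uu)))\<^sup>2 < B}"
      by (rule open_prod_elim)
    then have "v i < V u u' \<and> (norm (snd u - snd u'))\<^sup>2 < B" if "u \<in> A" "u' \<in> A'" for u u'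
      using subsetD[OF AA(4), of "(u, u')"] that by simp
    then have "good i (A, A')" using AA(1-3) by (simp add: good_def)
    then show ?thesis by blast
  qed
  then obtain AA where "\<And>i. i \<le> N \<Longrightarrow> good i (AA i)" by metis
  note AA = this[unfolded good_def]
  define A A' where "A i = fst (AA i)" and "A' i = snd (AA i)" for i
  have A: "\<And>i. i \<le> N \<Longrightarrow> open (A i)" "\<And>i. i \<le> N \<Longrightarrow> open (A' i)"
    "\<And>i. i \<le> N \<Longrightarrow> z (\<tau> i) \<in> A i" "\<And>i. i \<le> N \<Longrightarrow> z i \<in> A' i"
    "\<And>i u u'. i \<le> N \<Longrightarrow> u \<in> A i \<Longrightarrow> u' \<in> A' i \<Longrightarrow> v i < V u u' \<and> (norm (snd u - snd u'))\<^sup>2 < B"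
    using AA by (simp_all add: A_def A'_def)
  \<comment> \<open>The point \<open>z i\<close> plays two roles, as second partner in pair i and as
    first partner in the pair j with \<tau> j = i; its neighbourhood must serve both.\<close>
  define W where "W i = A' i \<inter> (\<Inter>j\<in>{j\<in>{..N}. \<tau> j = i}. A j)" for i
  have W: "open (W i)" "z i \<in> W i" "W i \<subseteq> A' i" "W (\<tau> i) \<subseteq> A i" if "i \<le> N" for i
    using that A(1-4) by (auto simp: W_def intro!: open_Int open_INT)
  have "\<exists>m>0. \<forall>\<^sub>F n in sequentially. m \<le> measure (\<pi> n) (W i)" if "i \<le> N" for i
    by (rule supp[OF z(2)[OF that] W(1,2)[OF that]])
  then obtain m where m: "\<And>i. i \<le> N \<Longrightarrow> m i > 0" "\<And>i. i \<le> N \<Longrightarrow> \<forall>\<^sub>F n in sequentially. m i \<le> measure (\<pi> n) (W i)" by metis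
  define m0 where "m0 = Min (m ` {..N})"
  have m0: "m0 > 0" "\<And>i. i \<le> N \<Longrightarrow> m0 \<le> m i" using m(1) by (auto simp: m0_def)
  \<comment> \<open>The maximizer of \<delta> S - \<delta>^2 n B, where the value is \<delta>
    S/2.\<close>
  define \<delta> where "\<delta> = S / (2 * n * B)"
  have dl: "\<delta> > 0" using S n B by (simp add: \<delta>_def)
  define gain where "gain = m0 / n / (1 + \<delta>) * (2 * \<delta> * (\<Sum>i\<le>N. v i) - \<delta>\<^sup>2 * n * B)"
  have "2 * \<delta> * (\<Sum>i\<le>N. v i) - \<delta>\<^sup>2 * n * B = \<delta> * (S - \<delta> * n * B)" unfolding sv by (simp add: power2_eq_square algebra_simps)
  also have "\<delta> * n * B = S / 2" using n B by (simp add: \<delta>_def)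
  finally have eq: "2 * \<delta> * (\<Sum>i\<le>N. v i) - \<delta>\<^sup>2 * n * B = \<delta> * S / 2" by simp
  have gain: "gain > 0" unfolding gain_def eq using m0(1) n dl S by simp
  have "\<forall>\<^sub>F k in sequentially. \<forall>i\<in>{..N}. m i \<le> measure (\<pi> k) (W i)"
    using m(2) by (intro eventually_ball_finite) auto
  moreover have "\<forall>\<^sub>F k in sequentially. e k < gain" using e(2) gain by (rule order_tendstoD)
  ultimately have "\<forall>\<^sub>F k in sequentially. (\<forall>i\<in>{..N}. m i \<le> measure (\<pi> k) (W i)) \<and> e k < gain" by (rule eventually_conj)
  then obtain k where k: "\<And>i. i \<le> N \<Longrightarrow> m i \<le> measure (\<pi> k) (W i)" "e k < gain"
    unfolding eventually_sequentially by auto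
  have "m0 / real (card {..N}) / (1 + \<delta>) * (2 * \<delta> * (\<Sum>i\<in>{..N}. v i) - \<delta>\<^sup>2 * real (card {..N}) * B) \<le> e k"
  proof (rule cycle_gain[OF P opt pi near T2_finite[OF P] e(1) _ _ tau, where W=W])
    show "W i \<in> sets borel" if "i \<in> {..N}" for i using W(1)[of i] that by simp
    show "m0 \<le> measure (\<pi> k) (W i)" if "i \<in> {..N}" for i using that m0(2)[of i] k(1)[of i] by simp
    show "v i \<le> (fst u' - snd u') \<bullet> (snd u - snd u')" if "i \<in> {..N}" "u \<in> W (\<tau> i)" "u' \<in> W i" for i u u'
      using A(5)[of i u u'] W(3,4)[of i] that unfolding V_def by force
    show "(norm (snd u - snd u'))\<^sup>2 \<le> B" if "i \<in> {..N}" "u \<in> W (\<tau> i)" "u' \<in> W i" for i u u'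
      using A(5)[of i u u'] W(3,4)[of i] that by force
  qed (use m0 B dl in auto)
  then have "gain \<le> e k" unfolding gain_def n_def by simp
  then show False using k(2) by simp
qed

lemma tight_compact:
  fixes M :: "'a::euclidean_space measure"
  assumes "prob_space M" "sets M = sets borel" "measure M (- B) = 0" "B \<in> sets borel" "e > 0"
  obtains K where "compact K" "K \<subseteq> B" "measure M (- K) < e"
proof -
  interpret prob_space M by fact
  have sp: "space M = UNIV" using sets_eq_imp_space_eq[OF assms(2)] by simp
  obtain K where K: "compact K" "K \<subseteq> B" "measure M (B - K) < e"
    using inner_compact_approx[OF finite_measure_axioms assms(2,4,5)] by blast
  have Kb: "K \<in> sets borel" using K(1) by (simp add: compact_imp_closed)
  have "- K = (B - K) \<union> - B" using K(2) by auto
  then have "measure M (- K) \<le> measure M (B - K) + measure M (- B)"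
    using assms(2,4) Kb by (simp add: measure_Un_le)
  then show ?thesis using that K assms(3) by simp
qed

text \<open>The error depends on the marginals alone, hence is uniform over all couplings; this
  reduces estimates along the sequence to compact rectangles.\<close>

lemma coupling_outside_rectangle:
  fixes \<mu> \<nu> :: "'a::euclidean_space measure"
  assumes pi: "coupling \<mu> \<nu> \<pi>" and nu: "prob_space \<nu>" and K: "K \<in> sets borel" "L \<in> sets borel" and E: "E \<in> sets \<pi>"
  shows "measure \<pi> E \<le> measure \<pi> (E \<inter> (K \<times> L)) + measure \<mu> (- K) + measure \<nu> (- L)"
proof -
  note cf = coupling_facts[OF pi nu]
  interpret p: prob_space \<pi> by (rule cf)
  have b: "- K \<in> sets borel" "- L \<in> sets borel" using K by auto
  have s: "fst -` (- K) \<in> sets \<pi>" "snd -` (- L) \<in> sets \<pi>"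
    using measurable_sets[OF cf(4) b(1)] measurable_sets[OF cf(5) b(2)] cf(2) by auto
  have KL: "K \<times> L \<in> sets \<pi>" using K pi by (simp add: coupling_def)
  have m: "measure \<pi> (fst -` (- K)) = measure \<mu> (- K)" "measure \<pi> (snd -` (- L)) = measure \<nu> (- L)"
    using measure_distr[OF cf(4) b(1)] measure_distr[OF cf(5) b(2)] pi cf(2) by (auto simp: coupling_def)
  have "measure \<pi> E \<le> measure \<pi> ((E \<inter> (K \<times> L)) \<union> (fst -` (- K) \<union> snd -` (- L)))"
    using E s KL by (intro p.finite_measure_mono) auto
  also have "\<dots> \<le> measure \<pi> (E \<inter> (K \<times> L)) + measure \<pi> (fst -` (- K) \<union> snd -` (- L))"
    using E s KL by (intro measure_Un_le) auto
  also have "measure \<pi> (fst -` (- K) \<union> snd -` (- L)) \<le> measure \<pi> (fst -` (- K)) + measure \<pi> (snd -` (- L))"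
    using s by (intro measure_Un_le) auto
  finally show ?thesis using m by simp
qed

theorem minimal_imp_expansion:
  fixes \<mu> \<nu> :: "'a::euclidean_space measure"
  assumes P: "P2 \<mu>" "P2 \<nu>" and ac: "absolutely_continuous lborel \<nu>"
    and opt: "\<And>\<xi>. \<xi> \<in> Pcx \<mu> \<Longrightarrow> T2 \<mu> \<nu> \<le> T2 \<xi> \<nu>"
  shows "\<exists>\<psi> G. convex_expansion \<psi> \<and> G \<in> borel_measurable \<nu> \<and>
            (AE x in \<nu>. has_gradient \<psi> x (G x)) \<and> distr \<nu> borel G = \<mu>"
proof -
  note N = P2_facts[OF P(2)] and M = P2_facts[OF P(1)]
  interpret M: prob_space \<mu> by (rule M)
  interpret N: prob_space \<nu> by (rule N)
  have "\<exists>\<pi>. coupling \<mu> \<nu> \<pi> \<and> (\<integral>\<^sup>+z. sq_cost z \<partial>\<pi>) \<le> T2 \<mu> \<nu> + ennreal (step n)" for n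
  proof -
    obtain t where t: "T2 \<mu> \<nu> = ennreal t" "t \<ge> 0"
      using T2_finite[OF P] by (metis enn2real_nonneg ennreal_enn2real infinity_ennreal_def)
    have "T2 \<mu> \<nu> < T2 \<mu> \<nu> + ennreal (step n)" using step_pos[of n] t by (simp add: ennreal_less_iff flip: ennreal_plus)
    then show ?thesis unfolding T2_def[of \<mu> \<nu>] INF_less_iff by (auto intro: less_imp_le)
  qed
  then obtain \<pi>0 where pi0: "\<And>n. coupling \<mu> \<nu> (\<pi>0 n)" "\<And>n. (\<integral>\<^sup>+z. sq_cost z \<partial>\<pi>0 n) \<le> T2 \<mu> \<nu> + ennreal (step n)"
    by metis
  obtain k \<Gamma> where k: "strict_mono (k :: nat \<Rightarrow> nat)"
    and on: "\<And>z W. z \<in> \<Gamma> \<Longrightarrow> open W \<Longrightarrow> z \<in> W \<Longrightarrow> \<exists>m>0. \<forall>\<^sub>F n in sequentially. m \<le> measure (\<pi>0 (k n)) W"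
    and off: "\<And>K. compact K \<Longrightarrow> K \<inter> \<Gamma> = {} \<Longrightarrow> K \<in> sets borel \<Longrightarrow> (\<lambda>n. measure (\<pi>0 (k n)) K) \<longlonglongrightarrow> 0"
    using asymptotic_support[of \<pi>0] coupling_facts(1,3)[OF pi0(1) N(1)] by metis
  define \<pi> where "\<pi> n = \<pi>0 (k n)" for n
  have pi: "coupling \<mu> \<nu> (\<pi> n)" for n by (simp add: \<pi>_def pi0)
  note cf = coupling_facts[OF pi N(1)]
  have off': "\<forall>\<^sub>F n in sequentially. measure (\<pi> n) E < e" if "compact E" "E \<inter> \<Gamma> = {}" "e > 0" for E e
  proof -
    have "(\<lambda>n. measure (\<pi> n) E) \<longlonglongrightarrow> 0" unfolding \<pi>_def using that by (intro off) (auto simp: compact_imp_closed)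
    then show ?thesis using that(3) by (rule order_tendstoD)
  qed
  \<comment> \<open>With both tails below 1/3, a rectangle of mass below 1/3 would contradict total
    mass 1; this shows that \<Gamma> is nonempty.\<close>
  obtain KM where KM: "compact KM" "measure \<mu> (- KM) < 1 / 3" using tight_compact[OF M(1,2), of UNIV "1/3"] by auto
  obtain KN where KN: "compact KN" "measure \<nu> (- KN) < 1 / 3" using tight_compact[OF N(1,2), of UNIV "1/3"] by auto
  have "\<Gamma> \<noteq> {}"
  proof
    assume "\<Gamma> = {}"
    then have "\<forall>\<^sub>F n in sequentially. measure (\<pi> n) (KM \<times> KN) < 1 / 3" using KM KN by (intro off' compact_Times) auto
    then obtain n where "measure (\<pi> n) (KM \<times> KN) < 1 / 3" by (auto simp: eventually_sequentially)
    moreover have "measure (\<pi> n) UNIV \<le> measure (\<pi> n) (UNIV \<inter> (KM \<times> KN)) + measure \<mu> (- KM) + measure \<nu> (- KN)"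
      by (rule coupling_outside_rectangle[OF pi N(1)]) (use cf KM KN in \<open>auto simp: compact_imp_closed\<close>)
    moreover have "measure (\<pi> n) UNIV = 1" using prob_space.prob_space[OF cf(3)[of n]] cf(2)[of n] by simp
    ultimately show False using KM KN by simp
  qed
  then obtain z0 where z0: "z0 \<in> \<Gamma>" by blast
  have mono: "p \<bullet> snd z0 - c \<le> 0" if "(p, c) \<in> chain_affine \<Gamma> z0" for p c
  proof (rule near_optimal_support_monotone[OF P opt pi, where e="\<lambda>n. step (k n)"])
    show "(\<integral>\<^sup>+z. sq_cost z \<partial>\<pi> n) \<le> T2 \<mu> \<nu> + ennreal (step (k n))" for n by (simp add: \<pi>_def pi0)
    show "(\<lambda>n. step (k n)) \<longlonglongrightarrow> 0" using LIMSEQ_subseq_LIMSEQ[OF step_tendsto k] by (simp add: o_def)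
  qed (use that z0 on step_pos in \<open>auto simp: \<pi>_def less_imp_le\<close>)
  obtain \<phi> where f: "convex_on UNIV (\<lambda>x. (norm x)\<^sup>2 / 2 - \<phi> x)"
    and sub: "\<And>x y x'. (x, y) \<in> \<Gamma> \<Longrightarrow> x' \<bullet> y - \<phi> x' \<le> x \<bullet> y - \<phi> x"
    using rockafellar_expansion[OF z0 mono] by metis
  define \<psi> where "\<psi> = legendre \<phi>"
  have cphi: "continuous_on UNIV \<phi>" by (rule convex_imp_hess_le_id(1)[OF f])
  have eqG: "\<psi> y = ereal (x \<bullet> y - \<phi> x)" if "(x, y) \<in> \<Gamma>" for x y
    unfolding \<psi>_def
  proof (rule antisym)
    show "legendre \<phi> y \<le> ereal (x \<bullet> y - \<phi> x)" unfolding legendre_def using sub[OF that] by (intro SUP_least) simp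
  qed (rule legendre_ge)
  have ex: "convex_expansion \<psi>" unfolding \<psi>_def
    by (rule convex_expansion_legendre[OF f, of "snd z0"]) (use eqG[of "fst z0" "snd z0"] z0 in \<open>simp add: \<psi>_def\<close>)
  have cv: "\<psi> ((1 - t) *\<^sub>R x + t *\<^sub>R y) \<le> ereal (1 - t) * \<psi> x + ereal t * \<psi> y" if "0 \<le> t" "t \<le> 1" for x y t
    using legendre_convex[of \<phi>] that unfolding convex_ext_def \<psi>_def by blast
  define C where "C = {y. \<psi> y \<noteq> \<infinity>}"
  define g where "g y = real_of_ereal (\<psi> y)" for y
  have psig: "\<psi> y = ereal (g y)" if "y \<in> C" for y
    using that legendre_ge[of 0 y \<phi>] by (cases "\<psi> y") (auto simp: C_def g_def \<psi>_def)
  have cvg: "(1 - t) *\<^sub>R x + t *\<^sub>R y \<in> C \<and> g ((1 - t) *\<^sub>R x + t *\<^sub>R y) \<le> (1 - t) * g x + t * g y"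
    if "x \<in> C" "y \<in> C" "0 \<le> t" "t \<le> 1" for x y t
  proof -
    have *: "\<psi> ((1 - t) *\<^sub>R x + t *\<^sub>R y) \<le> ereal ((1 - t) * g x + t * g y)"
      using cv[OF that(3,4), of x y] psig[OF that(1)] psig[OF that(2)] by simp
    then have "(1 - t) *\<^sub>R x + t *\<^sub>R y \<in> C" by (auto simp: C_def)
    with psig[OF this] * show ?thesis by simp
  qed
  have Cc: "convex C" unfolding convex_alt using cvg by blast
  define U where "U = interior C"
  have U: "open U" "U \<subseteq> C" by (simp_all add: U_def interior_subset)
  have gU: "convex_on U g"
    by (rule convex_onI) (use cvg U(2) Cc in \<open>auto simp: U_def convex_interior subset_iff\<close>)
  \<comment> \<open>Second coordinates of points of \<Gamma> lie in C, since \<psi> is finite there.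
    A compact L outside the closure of C therefore gives rectangles K \<times> L missing \<Gamma>,
    whose masses tend to 0, while \<nu> of L is fixed.\<close>
  have nuC: "measure \<nu> (- closure C) = 0"
  proof -
    have "measure \<nu> (- closure C) \<le> 0 + e" if e: "e > 0" for e
    proof -
      obtain K where K: "compact K" "measure \<mu> (- K) < e / 3" using tight_compact[OF M(1,2), of UNIV "e/3"] e by auto
      obtain L where L: "compact L" "L \<subseteq> - closure C" "measure \<nu> (- closure C - L) < e / 3"
        using inner_compact_approx[OF N.finite_measure_axioms N(2), of "- closure C" "e/3"] e by auto
      have "(K \<times> L) \<inter> \<Gamma> = {}"
      proof (rule ccontr)
        assume "(K \<times> L) \<inter> \<Gamma> \<noteq> {}"
        then obtain x y where "y \<in> L" "(x, y) \<in> \<Gamma>" by auto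
        then have "y \<in> C" using eqG[of x y] by (simp add: C_def)
        then show False using \<open>y \<in> L\<close> L(2) closure_subset[of C] by blast
      qed
      then have "\<forall>\<^sub>F n in sequentially. measure (\<pi> n) (K \<times> L) < e / 3" using K L e by (intro off' compact_Times) auto
      then obtain n where n: "measure (\<pi> n) (K \<times> L) < e / 3" by (auto simp: eventually_sequentially)
      have Lb: "L \<in> sets borel" "K \<in> sets borel" using L K by (auto simp: compact_imp_closed)
      have "snd -` L \<in> sets (\<pi> n)" using measurable_sets[OF cf(5) Lb(1), of n] cf(2)[of n] by simp
      from coupling_outside_rectangle[OF pi N(1) Lb(2) _ this, of UNIV]
      have "measure (\<pi> n) (snd -` L) \<le> measure (\<pi> n) (snd -` L \<inter> K \<times> UNIV) + measure \<mu> (- K)" by simp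
      moreover have "snd -` L \<inter> K \<times> UNIV = K \<times> L" by auto
      moreover have "measure \<nu> L = measure (\<pi> n) (snd -` L)"
        using measure_distr[OF cf(5) Lb(1), of n] pi[of n] cf(2)[of n] by (simp add: coupling_def)
      ultimately have "measure \<nu> L < 2 * (e / 3)" using n K(2) by simp
      moreover have "measure \<nu> (- closure C) \<le> measure \<nu> (- closure C - L) + measure \<nu> L"
      proof -
        have "- closure C = (- closure C - L) \<union> L" using L(2) by auto
        moreover have "- closure C - L \<in> sets \<nu>" "L \<in> sets \<nu>" using Lb N(2) by auto
        ultimately show ?thesis by (metis measure_Un_le)
      qed
      ultimately show ?thesis using L(3) by simp
    qed
    then have "measure \<nu> (- closure C) \<le> 0" by (rule field_le_epsilon)
    then show ?thesis by (simp add: measure_le_0_iff)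
  qed
  obtain G Z where G: "G \<in> borel_measurable borel" and Z: "Z \<in> null_sets lborel"
    and der: "\<And>y. y \<in> U - Z \<Longrightarrow> (g has_derivative (\<lambda>h. G y \<bullet> h)) (at y)"
    using convex_differentiable_AE[OF U(1) gU] by blast
  have lnull: "X \<in> null_sets \<nu>" if "X \<in> null_sets lborel" for X using ac that by (auto simp: absolutely_continuous_def)
  \<comment> \<open>The frontier of a convex set is Lebesgue null, so \<nu>, which charges the
    closure of C, is concentrated on its interior.\<close>
  have fr: "frontier C \<in> null_sets \<nu>"
  proof (rule lnull)
    have "frontier C \<in> null_sets (completion lborel)" using negligible_convex_frontier[OF Cc] negligible_iff_null_sets by blast
    then show "frontier C \<in> null_sets lborel" by (simp add: null_sets_completion_iff)
  qed
  define Y where "Y = U - Z"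
  have Zb: "Z \<in> sets borel" using Z by auto
  have Yb: "Y \<in> sets borel" using U(1) Zb by (auto simp: Y_def)
  have nuY: "measure \<nu> (- Y) = 0"
  proof -
    have "- Y = (- closure C \<union> frontier C) \<union> Z"
      using closure_subset interior_subset unfolding Y_def U_def frontier_def by blast
    moreover have st: "- closure C \<in> sets \<nu>" "frontier C \<in> sets \<nu>" "Z \<in> sets \<nu>" using N(2) Zb by auto
    ultimately have "measure \<nu> (- Y) \<le> measure \<nu> (- closure C \<union> frontier C) + measure \<nu> Z"
      using measure_Un_le[OF sets.Un[OF st(1,2)] st(3)] by (simp only:)
    also have "measure \<nu> (- closure C \<union> frontier C) \<le> measure \<nu> (- closure C) + measure \<nu> (frontier C)"
      by (rule measure_Un_le[OF st(1,2)])
    also have "measure \<nu> (frontier C) = 0" using fr by (simp add: measure_def null_sets_def)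
    also have "measure \<nu> Z = 0" using lnull[OF Z] by (simp add: measure_def null_sets_def)
    finally show ?thesis using nuC by (simp add: measure_le_0_iff)
  qed
  have grad: "has_gradient \<psi> y (G y)" if "y \<in> Y" for y
    unfolding has_gradient_def
  proof
    have "\<forall>\<^sub>F z in nhds y. z \<in> U" using that U(1) by (intro eventually_nhds_in_open) (auto simp: Y_def)
    then show "\<forall>\<^sub>F z in nhds y. \<bar>\<psi> z\<bar> \<noteq> \<infinity>" by eventually_elim (use U(2) psig in fastforce)
    show "((\<lambda>z. real_of_ereal (\<psi> z)) has_derivative (\<lambda>h. G y \<bullet> h)) (at y)"
      using der[of y] that by (simp add: Y_def g_def[abs_def])
  qed
  have AEg: "AE y in \<nu>. has_gradient \<psi> y (G y)"
  proof (rule AE_I')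
    show "- Y \<in> null_sets \<nu>" using nuY Yb N(2) by (simp add: null_sets_def N.emeasure_eq_measure)
    show "{y \<in> space \<nu>. \<not> has_gradient \<psi> y (G y)} \<subseteq> - Y" using grad by auto
  qed
  have Gn: "G \<in> borel_measurable \<nu>" using G by (simp add: measurable_cong_sets[OF N(2) refl])
  have "distr \<nu> borel G = \<mu>"
  proof (rule image_measure_of_small_gap[OF N(1,2) Gn M(1,2) cphi AEg[unfolded \<psi>_def]])
    fix \<delta> \<eta> :: real assume de: "\<delta> > 0" "\<eta> > 0"
    obtain K where K: "compact K" "measure \<mu> (- K) < \<eta> / 3" using tight_compact[OF M(1,2), of UNIV "\<eta>/3"] de by auto
    obtain L where L: "compact L" "L \<subseteq> Y" "measure \<nu> (- L) < \<eta> / 3" using tight_compact[OF N(1,2) nuY Yb, of "\<eta>/3"] de by auto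
    \<comment> \<open>Stated with \<open>g\<close>, which is continuous on L inside the open set U,
      so that the set is compact; it misses \<Gamma> because the gap is 0 there. The version with
      \<open>G\<close> need only be measurable.\<close>
    define E where "E = {z \<in> K \<times> L. \<delta> \<le> \<phi> (fst z) + g (snd z) - fst z \<bullet> snd z}"
    have "continuous_on U g" by (rule convex_on_continuous[OF U(1) gU])
    then have gL: "continuous_on L g" using L(2) by (auto simp: Y_def intro: continuous_on_subset)
    have "continuous_on (K \<times> L) (\<lambda>z. \<phi> (fst z) + g (snd z) - fst z \<bullet> snd z)"
      by (intro continuous_intros continuous_on_compose2[OF cphi] continuous_on_compose2[OF gL]) auto
    then have "closed ((\<lambda>z. \<phi> (fst z) + g (snd z) - fst z \<bullet> snd z) -` {\<delta>..} \<inter> (K \<times> L))"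
      using K L by (intro continuous_on_closed_vimage[THEN iffD1, rule_format]) (auto intro: compact_imp_closed closed_Times)
    moreover have "E = (K \<times> L) \<inter> ((\<lambda>z. \<phi> (fst z) + g (snd z) - fst z \<bullet> snd z) -` {\<delta>..} \<inter> (K \<times> L))" by (auto simp: E_def)
    ultimately have Ec: "compact E" using compact_Times[OF K(1) L(1)] by (simp add: compact_Int_closed)
    have "E \<inter> \<Gamma> = {}"
    proof (rule ccontr)
      assume "E \<inter> \<Gamma> \<noteq> {}"
      then obtain x y where xy: "(x, y) \<in> E" "(x, y) \<in> \<Gamma>" by auto
      have "g y = x \<bullet> y - \<phi> x" using eqG[OF xy(2)] by (simp add: g_def)
      then show False using xy(1) de(1) by (simp add: E_def)
    qed
    then have "\<forall>\<^sub>F n in sequentially. measure (\<pi> n) E < \<eta> / 3" using Ec de by (intro off') auto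
    then obtain n where n: "measure (\<pi> n) E < \<eta> / 3" by (auto simp: eventually_sequentially)
    let ?E = "{z. fenchel_gap \<phi> G z \<ge> \<delta>}"
    have [measurable]: "\<phi> \<in> borel_measurable borel" using cphi by (rule borel_measurable_continuous_onI)
    have [measurable]: "fst \<in> borel_measurable (\<pi> n)" "snd \<in> borel_measurable (\<pi> n)" using cf by auto
    have [measurable]: "(\<lambda>z. G (snd z)) \<in> borel_measurable (\<pi> n)" using measurable_compose[OF cf(5) G] .
    have "{z\<in>space (\<pi> n). fenchel_gap \<phi> G z \<ge> \<delta>} \<in> sets (\<pi> n)" by measurable
    then have Es: "?E \<in> sets (\<pi> n)" using cf(2) by simp
    \<comment> \<open>On L the gradient exists, so Fenchel equality identifies \<open>g y\<close>
      with the value written through \<open>G\<close>.\<close>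
    have "?E \<inter> (K \<times> L) = E"
    proof -
      have "g y = G y \<bullet> y - \<phi> (G y)" if "y \<in> L" for y
        using fenchel_equality_at_gradient[OF cphi grad[unfolded \<psi>_def]] that L(2) by (auto simp: g_def \<psi>_def)
      then show ?thesis unfolding E_def by auto
    qed
    then have "measure (\<pi> n) ?E \<le> \<eta>"
      using coupling_outside_rectangle[OF pi N(1) borel_compact[OF K(1)] borel_compact[OF L(1)] Es] n K(2) L(3) by simp
    then show "\<exists>\<pi>. coupling \<mu> \<nu> \<pi> \<and> measure \<pi> {z. fenchel_gap \<phi> G z \<ge> \<delta>} \<le> \<eta>"
      using pi by blast
  qed
  then show ?thesis using ex Gn AEg by blast
qed

theorem mainTheorem11:
  fixes \<mu> \<nu> :: "'a::euclidean_space measure"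
  assumes "P2 \<mu>" and "P2 \<nu>" and "absolutely_continuous lborel \<nu>"
  shows "(\<mu> \<in> Pcx \<mu> \<and> (\<forall>\<xi>\<in>Pcx \<mu>. \<xi> \<noteq> \<mu> \<longrightarrow> T2 \<mu> \<nu> < T2 \<xi> \<nu>))
     \<longleftrightarrow> (\<exists>\<psi> G. convex_expansion \<psi> \<and> G \<in> borel_measurable \<nu> \<and>
            (AE x in \<nu>. has_gradient \<psi> x (G x)) \<and> distr \<nu> borel G = \<mu>)"
proof
  assume "\<mu> \<in> Pcx \<mu> \<and> (\<forall>\<xi>\<in>Pcx \<mu>. \<xi> \<noteq> \<mu> \<longrightarrow> T2 \<mu> \<nu> < T2 \<xi> \<nu>)"
  then have "T2 \<mu> \<nu> \<le> T2 \<xi> \<nu>" if "\<xi> \<in> Pcx \<mu>" for \<xi> using that by (cases "\<xi> = \<mu>") (auto intro: less_imp_le)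
  then show "\<exists>\<psi> G. convex_expansion \<psi> \<and> G \<in> borel_measurable \<nu> \<and>
            (AE x in \<nu>. has_gradient \<psi> x (G x)) \<and> distr \<nu> borel G = \<mu>"
    by (rule minimal_imp_expansion[OF assms])
next
  assume "\<exists>\<psi> G. convex_expansion \<psi> \<and> G \<in> borel_measurable \<nu> \<and>
            (AE x in \<nu>. has_gradient \<psi> x (G x)) \<and> distr \<nu> borel G = \<mu>"
  then obtain \<psi> G where "convex_expansion \<psi>" "G \<in> borel_measurable \<nu>" "AE x in \<nu>. has_gradient \<psi> x (G x)" "distr \<nu> borel G = \<mu>"
    by blast
  then have "\<xi> = \<mu>" if "\<xi> \<in> Pcx \<mu>" "T2 \<xi> \<nu> \<le> T2 \<mu> \<nu>" for \<xi>
    using that by (rule expansion_image_minimal[OF assms(1,2)])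
  moreover have "\<mu> \<in> Pcx \<mu>" using assms(1) by (simp add: Pcx_def cx_le_def)
  ultimately show "\<mu> \<in> Pcx \<mu> \<and> (\<forall>\<xi>\<in>Pcx \<mu>. \<xi> \<noteq> \<mu> \<longrightarrow> T2 \<mu> \<nu> < T2 \<xi> \<nu>)" by (metis not_le)
qed

end
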